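(* Consider the stochastic first-order method described in the context with proximal function $\phi(\mathbf z)=\frac{\hat\rho}{2}\|\mathbf z\|_1^2$, $\hat\rho>0$, and variance-reduced gradient estimates $G^k$ (with parameters $q_0,m_1,m$) as described in the context, and suppose the standing assumptions in the context hold. Let $\Omega=e^2\log d$. Suppose $\eta_k=\eta>0$ for all $k$, $t=2\eta/\hat\rho$, $\frac{\hat\rho}{4\eta}-\frac L2-\frac{2t\Omega^2L^2q_0}{m}>0$, and $p_k=1/K$. Then $$\mathbb E\big[\mathrm{dist}_{\|\cdot\|_\infty}(0,\partial(f+\delta_X)(\mathbf x^{Y+1}))\big]\le\left(L+\frac{\hat\rho+1}{\eta}+\sqrt{\frac{4\Omega^2L^2q_0}{m}}\right)\sqrt{\frac{\frac{\Delta_f}{K}+\frac{t\,\Omega e^2(\log d)\sigma_\infty^2}{2m_1}}{\frac{\hat\rho}{4\eta}-\frac L2-\frac{2t\Omega^2L^2q_0}{m}}}+\sqrt{\frac{\Omega e^2(\log d)\sigma_\infty^2}{m_1}}.$$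
   Context: Problem: minimize $f(\mathbf x)=\mathbb E[F(\mathbf x,\zeta)]$ over $\mathbf x\in X$, where $X\subseteq\mathbb R^d$ ($d\ge2$) is nonempty, closed and convex, $\zeta$ is a random vector with values in $\Xi$, $f:\mathbb R^d\to\mathbb R$ is well defined, finite and everywhere differentiable (possibly nonconvex). $\|\cdot\|$ is the Euclidean norm. $F(\cdot,\zeta)$ is everywhere differentiable for every $\zeta\in\Xi$, its gradient $\nabla F(\mathbf x,\zeta)$ can be evaluated (stochastic first-order oracle), and $\mathbb E[\nabla F(\mathbf x,\zeta)]=\nabla f(\mathbf x)$ for all $\mathbf x\in X$. Standing assumptions: (i) $\sigma_\infty^2:=\max_{\mathbf x\in X}\mathbb E[\|\nabla F(\mathbf x,\zeta)-\nabla f(\mathbf x)\|_\infty^2]<\infty$; (ii) for a constant $L\ge0$, $\mathbb E[\|\nabla F(\mathbf x,\zeta)-\nabla F(\mathbf y,\zeta)\|_\infty^2]\le L^2\|\mathbf x-\mathbf y\|_1^2$ for all $\mathbf x,\mathbf y\in X$; (iii) $f(\mathbf x)\ge\underline f$ for all $\mathbf x\in X$, for some $\underline f\in\mathbb R$. Algorithm: choose $\mathbf x^1\in X$ and a positive integer $K$. For $k=1,\dots,K$: form a gradient estimate $G^k$ and set $$\mathbf x^{k+1}=\arg\min_{\mathbf x\in X}\left\{\tfrac12\|\mathbf x-(\mathbf x^k-\eta_kG^k)\|^2+\phi(\mathbf x-\mathbf x^k)\right\}.$$ Output $\mathbf x^{Y+1}$, where $Y$ is a random index, independent of everything else, with $\mathbb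 P[Y=k]=p_k$, $k=1,\dots,K$. Variance-reduced estimate: given positive integers $q_0,m_1,m$, let $m_k=m_1$ if $k\equiv1\pmod{q_0}$ and $m_k=m$ otherwise; with $\zeta_i^k$ i.i.d. copies of $\zeta$ drawn afresh at each iteration (independent of the past), $$G^k=\begin{cases}\frac1{m_k}\sum_{i=1}^{m_k}\nabla F(\mathbf x^k,\zeta_i^k), & k\equiv1\pmod{q_0},\\ \frac1{m_k}\sum_{i=1}^{m_k}\big(\nabla F(\mathbf x^k,\zeta_i^k)-\nabla F(\mathbf x^{k-1},\zeta_i^k)\big)+G^{k-1}, & \text{otherwise.}\end{cases}$$ Notation: $\Delta_f=\mathbb E[f(\mathbf x^1)]-\underline f$. $\delta_X$ is the indicator function of $X$ ($0$ on $X$, $+\infty$ off $X$), $\partial$ is the Fréchet subdifferential, so for $\mathbf x\in X$, $\partial(f+\delta_X)(\mathbf x)=\nabla f(\mathbf x)+N_X(\mathbf x)$ with $N_X$ the normal cone, and $\mathrm{dist}_{\|\cdot\|_\infty}(0,S)=\inf\{\|\mathbf v\|_\infty:\mathbf v\in S\}$. *)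

theory Defs
  imports "HOL-Probability.Probability"
begin

text \<open>The library's \<open>infnorm\<close> is the \<open>\<ell>\<^sub>\<infinity>\<close> norm; the plain \<open>norm\<close> is Euclidean.\<close>

definition l1norm :: "real ^ 'n \<Rightarrow> real" where
  "l1norm x = (\<Sum>i\<in>UNIV. \<bar>x $ i\<bar>)"

text \<open>Indicator function in the sense of convex analysis, not the 0/1-valued \<open>indicator\<close>.\<close>

definition delta_set :: "'a set \<Rightarrow> 'a \<Rightarrow> ereal" where
  "delta_set X x = (if x \<in> X then 0 else \<infinity>)"

definition frechet_subdiff :: "('a::real_inner \<Rightarrow> ereal) \<Rightarrow> 'a \<Rightarrow> 'a set" where
  "frechet_subdiff h x =
     {v. \<bar>h x\<bar> \<noteq> \<infinity> \<and>
         0 \<le> Liminf (at x) (\<lambda>y. (h y - h x - ereal (v \<bullet> (y - x))) / ereal (norm (y - x)))}"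

text \<open>Valued in \<open>ennreal\<close> so that the distance to the empty set is \<open>\<infinity>\<close>.\<close>

definition dist_inf_zero :: "'a::euclidean_space set \<Rightarrow> ennreal" where
  "dist_inf_zero S = (INF v\<in>S. ennreal (infnorm v))"

text \<open>\<open>P\<close> is the law of the random datum (a probability measure on \<open>\<Xi> = space P\<close>),
  \<open>gF\<close> the gradient of \<open>F\<close> in its first argument, and \<open>gf\<close> the gradient of \<open>f\<close>.\<close>

definition sigma_inf_sq ::
  "(real ^ 'n) set \<Rightarrow> 'z measure \<Rightarrow> (real ^ 'n \<Rightarrow> 'z \<Rightarrow> real ^ 'n) \<Rightarrow> (real ^ 'n \<Rightarrow> real ^ 'n) \<Rightarrow> ennreal"
  where
  "sigma_inf_sq X P gF gf = (SUP x\<in>X. \<integral>\<^sup>+z. ennreal ((infnorm (gF x z - gf x))\<^sup>2) \<partial>P)"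

definition prox_step ::
  "(real ^ 'n) set \<Rightarrow> (real ^ 'n \<Rightarrow> real) \<Rightarrow> real \<Rightarrow> real ^ 'n \<Rightarrow> real ^ 'n \<Rightarrow> real ^ 'n \<Rightarrow> bool"
  where
  "prox_step X \<phi> \<eta> x g x' \<longleftrightarrow>
     is_arg_min (\<lambda>y. 1/2 * (norm (y - (x - \<eta> *\<^sub>R g)))\<^sup>2 + \<phi> (y - x)) (\<lambda>y. y \<in> X) x'"

text \<open>Written with \<open>1 mod q\<^sub>0\<close> so that \<open>q\<^sub>0 = 1\<close> restarts at every iteration.\<close>

definition restart :: "nat \<Rightarrow> nat \<Rightarrow> bool" where
  "restart q\<^sub>0 k \<longleftrightarrow> k mod q\<^sub>0 = 1 mod q\<^sub>0"

definition batch_size :: "nat \<Rightarrow> nat \<Rightarrow> nat \<Rightarrow> nat \<Rightarrow> nat" where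
  "batch_size q\<^sub>0 m\<^sub>1 m k = (if restart q\<^sub>0 k then m\<^sub>1 else m)"

text \<open>One step of the recursion defining the estimates \<open>g k\<close> from the iterates \<open>x k\<close> and the
  samples \<open>z k i\<close>; the case \<open>k = 1\<close> is always a restart.\<close>

definition vr_estimate ::
  "(real ^ 'n \<Rightarrow> 'z \<Rightarrow> real ^ 'n) \<Rightarrow> nat \<Rightarrow> nat \<Rightarrow> nat \<Rightarrow>
   (nat \<Rightarrow> real ^ 'n) \<Rightarrow> (nat \<Rightarrow> nat \<Rightarrow> 'z) \<Rightarrow> (nat \<Rightarrow> real ^ 'n) \<Rightarrow> nat \<Rightarrow> bool"
  where
  "vr_estimate gF q\<^sub>0 m\<^sub>1 m x z g k \<longleftrightarrow>
     g k = (let b = batch_size q\<^sub>0 m\<^sub>1 m k in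
       if restart q\<^sub>0 k then (1 / real b) *\<^sub>R (\<Sum>i=1..b. gF (x k) (z k i))
       else (1 / real b) *\<^sub>R (\<Sum>i=1..b. gF (x k) (z k i) - gF (x (k - 1)) (z k i)) + g (k - 1))"

definition sample_idx :: "nat \<Rightarrow> (nat \<Rightarrow> nat) \<Rightarrow> (nat \<times> nat) set" where
  "sample_idx K b = (SIGMA k:{1..K}. {1..b k})"

definition sample_family :: "(nat \<times> nat) set \<Rightarrow> (nat \<Rightarrow> nat \<Rightarrow> 'w \<Rightarrow> 'z) \<Rightarrow> 'w \<Rightarrow> nat \<times> nat \<Rightarrow> 'z" where
  "sample_family J \<zeta> \<omega> = (\<lambda>j\<in>J. \<zeta> (fst j) (snd j) \<omega>)"

text \<open>The library's \<open>indep_var\<close> forces both variables to have the same value type.\<close>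

definition (in prob_space) indep_rv :: "'b measure \<Rightarrow> ('a \<Rightarrow> 'b) \<Rightarrow> 'c measure \<Rightarrow> ('a \<Rightarrow> 'c) \<Rightarrow> bool" where
  "indep_rv N\<^sub>1 U N\<^sub>2 V \<longleftrightarrow>
     random_variable N\<^sub>1 U \<and> random_variable N\<^sub>2 V \<and>
     indep_set {U -` A \<inter> space M | A. A \<in> sets N\<^sub>1} {V -` B \<inter> space M | B. B \<in> sets N\<^sub>2}"

end

theory Submission
  imports Defs
begin

text \<open>
  The \<open>\<ell>\<^sub>1\<close> proximal term turns the usual descent estimate into
  \<open>(\<rho>/(4\<eta>) - L/2) |x\<^sup>k\<^sup>+\<^sup>1 - x\<^sup>k|\<^sub>1\<^sup>2 \<le> f(x\<^sup>k) - f(x\<^sup>k\<^sup>+\<^sup>1) + (t/2) |\<epsilon>\<^sup>k|\<^sub>\<infinity>\<^sup>2\<close> with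
  \<open>\<epsilon>\<^sup>k = G\<^sup>k - \<nabla>f(x\<^sup>k)\<close>. Between two restarts the errors \<open>\<epsilon>\<^sup>k\<close> are partial sums of martingale
  differences, one for each sample. Since \<open>|\<cdot>|\<^sub>\<infinity>\<^sup>2\<close> is within a factor \<open>e\<close> of the smooth function
  \<open>|\<cdot>|\<^sub>2\<^sub>q\<^sup>2\<close> for \<open>q\<close> about \<open>log d\<close>, whose second derivative is of order \<open>q\<close>, adding a sample raises
  the expected potential by at most a logarithmic factor times the second moment of its sup norm. This
  bounds \<open>E |\<epsilon>\<^sup>k|\<^sub>\<infinity>\<^sup>2\<close> by the variance at the last restart and the steps taken since; summing the
  descent estimate over \<open>k\<close> then closes the loop. Finally, the optimality condition of the proximal step
  exhibits an element of \<open>\<nabla>f(x\<^sup>k\<^sup>+\<^sup>1) + N\<^sub>X(x\<^sup>k\<^sup>+\<^sup>1)\<close> controlled by the step and the error.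
\<close>

section \<open>The norms\<close>

text \<open>The sup norm comes from no inner product. Independent centred terms therefore cannot be
  summed by orthogonality, which is what the potential replaces, and centring a gradient difference
  may enlarge its second moment: the triangle inequality and Jensen pay a factor 4, the 4 of the
  final bound. The square of e^2 log d is the smoothness constant (2q - 1) d^(1/q) of the potential
  for q = ceil (log d), rounded up. The factor q0 counts in how many error bounds one step can
  occur. Errors are bounded by steps and steps by errors, so the sum of squared steps is finally
  absorbed into its own left-hand side. This requires finite expectations, which are not given:
  second moments are extended nonnegative integrals until an induction over the iterations shows
  them finite. Each iterate depends on all earlier samples, so a fresh sample must be integrated out
  with the past held fixed. A product-law identity does this in place of conditional expectations,
  at the price of measurability of the iterates with respect to the past. As they are given only as
  minimizers, this rests on the stability of the proximal step.\<close>

lemma l1norm_nonneg [simp]: "0 \<le> l1norm x"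
  by (simp add: l1norm_def sum_nonneg)

lemma l1norm_zero [simp]: "l1norm 0 = 0"
  by (simp add: l1norm_def)

lemma l1norm_minus [simp]: "l1norm (- x) = l1norm x"
  by (simp add: l1norm_def)

lemma l1norm_minus_commute: "l1norm (x - y) = l1norm (y - x)"
  by (metis l1norm_minus minus_diff_eq)

lemma l1norm_scaleR [simp]: "l1norm (a *\<^sub>R x) = \<bar>a\<bar> * l1norm x"
  by (simp add: l1norm_def abs_mult sum_distrib_left)

lemma l1norm_triangle: "l1norm (x + y) \<le> l1norm x + l1norm y"
  unfolding l1norm_def sum.distrib [symmetric] by (intro sum_mono) (simp add: abs_triangle_ineq)

lemma l1norm_triangle_diff: "l1norm x \<le> l1norm y + l1norm (x - y)"
  using l1norm_triangle [of y "x - y"] by simp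

lemma continuous_on_l1norm [continuous_intros]:
  "continuous_on S g \<Longrightarrow> continuous_on S (\<lambda>x. l1norm (g x))"
  unfolding l1norm_def by (intro continuous_intros)

lemma borel_measurable_l1norm [measurable (raw)]:
  assumes "g \<in> borel_measurable N"
  shows "(\<lambda>x. l1norm (g x)) \<in> borel_measurable N"
  by (rule borel_measurable_continuous_on [OF _ assms]) (intro continuous_intros)

lemma borel_measurable_infnorm [measurable (raw)]:
  fixes g :: "'a \<Rightarrow> 'b::euclidean_space"
  assumes "g \<in> borel_measurable N"
  shows "(\<lambda>x. infnorm (g x)) \<in> borel_measurable N"
  by (rule borel_measurable_continuous_on [OF _ assms]) (intro continuous_intros)

lemma l1norm_le_norm: "l1norm (x :: real ^ 'n) \<le> real CARD('n) * norm x"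
  unfolding l1norm_def using sum_bounded_above [of UNIV "\<lambda>i. \<bar>x $ i\<bar>" "norm x"]
  by (simp add: component_le_norm_cart)

lemma infnorm_le_iff_cart: "infnorm (x :: real ^ 'n) \<le> r \<longleftrightarrow> (\<forall>i. \<bar>x $ i\<bar> \<le> r)"
proof
  show "infnorm x \<le> r \<Longrightarrow> \<forall>i. \<bar>x $ i\<bar> \<le> r"
    using component_le_infnorm_cart order_trans by blast
  show "\<forall>i. \<bar>x $ i\<bar> \<le> r \<Longrightarrow> infnorm x \<le> r"
    unfolding infnorm_cart by (rule cSup_least) auto
qed

lemma infnorm_le_l1norm: "infnorm (x :: real ^ 'n) \<le> l1norm x"
  unfolding infnorm_le_iff_cart l1norm_def
  by (auto intro: member_le_sum [where f = "\<lambda>i. \<bar>x $ i\<bar>"])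

lemma inner_le_infnorm_l1norm: "x \<bullet> y \<le> infnorm x * l1norm (y :: real ^ 'n)"
  unfolding inner_vec_def l1norm_def sum_distrib_left
proof (rule sum_mono)
  fix i
  have "x $ i \<bullet> y $ i \<le> \<bar>x $ i\<bar> * \<bar>y $ i\<bar>"
    using abs_ge_self [of "x $ i * y $ i"] by (simp add: abs_mult)
  also have "\<dots> \<le> infnorm x * \<bar>y $ i\<bar>"
    by (intro mult_right_mono component_le_infnorm_cart) simp
  finally show "x $ i \<bullet> y $ i \<le> infnorm x * \<bar>y $ i\<bar>" .
qed

lemma integrable_infnorm:
  fixes g :: "'z \<Rightarrow> real ^ 'n"
  assumes "integrable P g"
  shows "integrable P (\<lambda>z. infnorm (g z))"
  using borel_measurable_integrable [OF assms]
  by (intro Bochner_Integration.integrable_bound [OF integrable_norm [OF assms]])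
    (auto simp: infnorm_pos_le infnorm_le_norm)

section \<open>A smooth substitute for the squared sup norm\<close>

text \<open>Weighted AM-GM for \<open>s ^ q\<close> and 1 with weights (q - 1)/q and 1/q; equality
  holds at \<open>s = 1\<close>. It is the pointwise inequality behind the Hoelder-type bound on the
  second derivative of the potential.\<close>

lemma power_le_weighted_AMGM:
  fixes s :: real
  assumes "s \<ge> 0" "q \<ge> 1"
  shows "real q * s ^ (q - 1) \<le> (real q - 1) * s ^ q + 1"
proof -
  obtain r where r: "q = Suc r" using assms(2) by (cases q) auto
  have "(real r + 1) * s ^ r \<le> real r * s ^ Suc r + 1"
  proof (induction r)
    case (Suc r)
    \<comment> \<open>Both factors change sign at \<open>s = 1\<close>. Expanded and added to
      \<open>s\<close> times the induction hypothesis, this gives the next case.\<close>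
    have "(s - 1) * (s ^ Suc r - 1) \<ge> 0"
      using one_le_power [of s "Suc r"] power_le_one [of s "Suc r"] assms(1)
      by (cases "s \<ge> 1") (auto intro: mult_nonneg_nonneg mult_nonpos_nonpos simp del: power_Suc)
    moreover have "s * ((real r + 1) * s ^ r) \<le> s * (real r * s ^ Suc r + 1)"
      using Suc assms(1) by (rule mult_left_mono)
    ultimately show ?case by (simp add: algebra_simps)
  qed auto
  then show ?thesis by (simp add: r algebra_simps)
qed

text \<open>The squared \<open>\<ell>\<^sub>2\<^sub>q\<close> norm; the shift \<open>e > 0\<close> makes it twice differentiable at the origin.\<close>

definition pnorm_sq :: "nat \<Rightarrow> real \<Rightarrow> real ^ 'n \<Rightarrow> real" where
  "pnorm_sq q e x = (e + (\<Sum>i\<in>UNIV. (x $ i) ^ (2 * q))) powr (1 / real q)"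

lemma continuous_on_pnorm_sq:
  assumes "e > 0"
  shows "continuous_on S (pnorm_sq q e :: real ^ 'n \<Rightarrow> real)"
proof -
  have "e + (\<Sum>i\<in>UNIV. (x $ i) ^ (2 * q)) \<noteq> 0" for x :: "real ^ 'n"
    using assms sum_nonneg [of UNIV "\<lambda>i. (x $ i) ^ (2 * q)"] by (simp add: add_pos_nonneg)
  then show ?thesis unfolding pnorm_sq_def [abs_def] by (intro continuous_intros) auto
qed

lemma pnorm_sq_zero: "q \<ge> 1 \<Longrightarrow> pnorm_sq q e 0 = e powr (1 / real q)"
  by (simp add: pnorm_sq_def zero_power)

lemma pnorm_sq_nonneg [simp]: "0 \<le> pnorm_sq q e x"
  by (simp add: pnorm_sq_def)

lemma infnorm_sq_le_pnorm_sq: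
  fixes x :: "real ^ 'n"
  assumes "e > 0" "q \<ge> 1"
  shows "(infnorm x)\<^sup>2 \<le> pnorm_sq q e x"
proof -
  have "\<bar>x $ i\<bar> \<le> sqrt (pnorm_sq q e x)" for i
  proof (rule real_le_rsqrt)
    have "\<bar>x $ i\<bar>\<^sup>2 = ((x $ i) ^ (2 * q)) powr (1 / real q)"
    proof (cases "x $ i = 0")
      case False
      then have "((x $ i) ^ (2 * q)) powr (1 / real q) = (((x $ i)\<^sup>2) powr real q) powr (1 / real q)"
        by (subst powr_realpow) (auto simp: power_mult)
      also have "\<dots> = (x $ i)\<^sup>2"
        using assms by (simp only: powr_powr) (simp add: powr_one)
      finally show ?thesis by simp
    qed (use assms in auto)
    also have "\<dots> \<le> pnorm_sq q e x"
      unfolding pnorm_sq_def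
    proof (rule powr_mono2)
      have "(x $ i) ^ (2 * q) \<le> (\<Sum>i\<in>UNIV. (x $ i) ^ (2 * q))"
        by (rule member_le_sum [where f = "\<lambda>i. (x $ i) ^ (2 * q)"]) auto
      then show "(x $ i) ^ (2 * q) \<le> e + (\<Sum>i\<in>UNIV. (x $ i) ^ (2 * q))" using assms by simp
    qed auto
    finally show "\<bar>x $ i\<bar>\<^sup>2 \<le> pnorm_sq q e x" .
  qed
  then have "infnorm x \<le> sqrt (pnorm_sq q e x)" by (simp add: infnorm_le_iff_cart)
  then show ?thesis
    by (metis pnorm_sq_nonneg infnorm_pos_le power_mono real_sqrt_pow2)
qed

text \<open>The tangent inequality at a common scale \<open>c\<close>, summed over the coordinates,
  is Hoelder between the exponents 2q - 2 and 2q. The total \<open>u\<close> may exceed the sum of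
  the powers because \<open>pnorm_sq\<close> carries a shift.\<close>

lemma sum_power_le_powr:
  fixes v :: "real ^ 'n"
  assumes "q \<ge> 1" "u > 0" "(\<Sum>i\<in>UNIV. (v $ i) ^ (2 * q)) \<le> u"
  shows "u powr (1 / real q - 1) * (\<Sum>i\<in>UNIV. (v $ i) ^ (2 * q - 2))
     \<le> real CARD('n) powr (1 / real q)"
proof -
  define D where "D = real CARD('n)"
  have D: "D > 0" by (simp add: D_def)
  \<comment> \<open>\<open>c\<close> is the common squared coordinate of a vector with equal
    coordinates and total \<open>u\<close>, the case of equality.\<close>
  define c where "c = (u / D) powr (1 / real q)"
  have c: "c > 0" using assms D by (simp add: c_def)
  have cq: "c ^ q = u / D"
    using assms D by (simp add: c_def powr_realpow [symmetric] powr_powr)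
  have "real q * (\<Sum>i\<in>UNIV. ((v $ i)\<^sup>2 / c) ^ (q - 1))
      \<le> (\<Sum>i\<in>(UNIV::'n set). (real q - 1) * ((v $ i)\<^sup>2 / c) ^ q + 1)"
    unfolding sum_distrib_left using assms c
    by (intro sum_mono power_le_weighted_AMGM) auto
  also have "\<dots> = (real q - 1) * ((\<Sum>i\<in>UNIV. (v $ i) ^ (2 * q)) / c ^ q) + D"
    by (simp add: sum.distrib D_def sum_distrib_left sum_divide_distrib power_divide power_mult)
  also have "\<dots> \<le> (real q - 1) * D + D"
  proof -
    have "(\<Sum>i\<in>UNIV. (v $ i) ^ (2 * q)) / c ^ q \<le> D"
      using assms D by (simp add: cq divide_le_eq)
    then show ?thesis using assms by (intro add_right_mono mult_left_mono) auto
  qed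
  also have "\<dots> = real q * D" by (simp add: algebra_simps)
  finally have "(\<Sum>i\<in>UNIV. ((v $ i)\<^sup>2 / c) ^ (q - 1)) \<le> D" using assms by simp
  moreover have "(\<Sum>i\<in>UNIV. ((v $ i)\<^sup>2 / c) ^ (q - 1)) = (\<Sum>i\<in>UNIV. (v $ i) ^ (2 * q - 2)) / c ^ (q - 1)"
    by (simp add: power_divide power_mult [symmetric] sum_divide_distrib diff_mult_distrib2)
  ultimately have "(\<Sum>i\<in>UNIV. (v $ i) ^ (2 * q - 2)) \<le> D * c ^ (q - 1)"
    using c by (simp add: divide_le_eq)
  then have "u powr (1 / real q - 1) * (\<Sum>i\<in>UNIV. (v $ i) ^ (2 * q - 2))
      \<le> u powr (1 / real q - 1) * (D * c ^ (q - 1))"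
    by (rule mult_left_mono) simp
  also have "\<dots> = u powr (1 / real q - 1) * (D * (u / D) powr (1 - 1 / real q))"
    using assms D by (simp add: c_def powr_realpow [symmetric] powr_powr of_nat_diff diff_divide_distrib)
  also have "\<dots> = (u powr (1 / real q - 1) * u powr (1 - 1 / real q)) * (D powr 1 / D powr (1 - 1 / real q))"
    using assms D by (simp add: powr_divide)
  also have "\<dots> = D powr (1 / real q)"
    using assms D by (simp only: powr_add [symmetric] powr_diff [symmetric]) simp
  finally show ?thesis by (simp add: D_def)
qed

text \<open>Second-order Taylor expansion along the segment from \<open>x\<close> to
  \<open>x + y\<close>, with \<open>g\<close> the gradient at \<open>x\<close>. Only the linearity
  of its term matters later, since that term vanishes in expectation for centred \<open>y\<close>;
  hence \<open>g\<close> is existential.\<close>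

lemma pnorm_sq_add_le:
  fixes x :: "real ^ 'n"
  assumes e: "e > 0" and q: "q \<ge> 1"
  shows "\<exists>g. \<forall>y. pnorm_sq q e (x + y) \<le> pnorm_sq q e x + g \<bullet> y
     + (2 * real q - 1) * real CARD('n) powr (1 / real q) * (infnorm y)\<^sup>2"
proof -
  define r where "r = 1 / real q"
  define u where "u = (\<lambda>v::real^'n. e + (\<Sum>i\<in>UNIV. (v $ i) ^ (2 * q)))"
  have u: "u v > 0" for v
    using e sum_nonneg [of UNIV "\<lambda>i. (v $ i) ^ (2 * q)"] by (simp add: u_def add_pos_nonneg)
  have h: "pnorm_sq q e v = u v powr r" for v by (simp add: pnorm_sq_def u_def r_def)
  define C where "C = (2 * real q - 1) * real CARD('n) powr r"
  define g where "g = (\<chi> i. r * u x powr (r - 1) * (2 * real q * (x $ i) ^ (2 * q - 1)))"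
  have "pnorm_sq q e (x + y) \<le> pnorm_sq q e x + g \<bullet> y + C * (infnorm y)\<^sup>2" for y
  proof -
    define w where "w = (\<lambda>s. x + s *\<^sub>R y)"
    define u1 where "u1 = (\<lambda>s. \<Sum>i\<in>UNIV. 2 * real q * (w s $ i) ^ (2 * q - 1) * y $ i)"
    define u2 where "u2 = (\<lambda>s. \<Sum>i\<in>UNIV. 2 * real q * (2 * real q - 1) * (w s $ i) ^ (2 * q - 2) * (y $ i)\<^sup>2)"
    have d0: "((\<lambda>s. u (w s)) has_real_derivative u1 s) (at s)" for s
      unfolding u_def u1_def w_def
      by (auto intro!: derivative_eq_intros sum.cong simp: algebra_simps)
    have q2: "real (q * 2 - Suc 0) = 2 * real q - 1" "q * 2 - Suc (Suc 0) = q * 2 - 2"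
      using q by (auto simp: of_nat_diff)
    have d1: "(u1 has_real_derivative u2 s) (at s)" for s
      unfolding u1_def u2_def w_def
      by (auto intro!: derivative_eq_intros sum.cong simp: q2 power2_eq_square algebra_simps)
    \<comment> \<open>Derivatives along the segment indexed by order; the last branch is the second
      derivative, the highest one consulted.\<close>
    define diff where "diff = (\<lambda>(k::nat) s. if k = 0 then u (w s) powr r
       else if k = 1 then r * u (w s) powr (r - 1) * u1 s
       else r * (u (w s) powr (r - 1) * u2 s) + r * ((r - 1) * u (w s) powr (r - 1 - 1) * (u1 s)\<^sup>2))"
    have dp: "((\<lambda>s. u (w s) powr a) has_real_derivative a * u (w s) powr (a - 1) * u1 s) (at s)" for a s
      by (rule has_real_derivative_powr [THEN DERIV_chain2, OF _ d0]) (rule u)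
    have D: "(diff k has_real_derivative diff (Suc k) s) (at s)" if "k < 2" for k s
    proof (cases "k = 0")
      case True
      then show ?thesis using dp [of r s] by (simp add: diff_def)
    next
      case False
      then have [simp]: "k = 1" using that by auto
      have "((\<lambda>s. r * (u (w s) powr (r - 1) * u1 s)) has_real_derivative diff 2 s) (at s)"
        by (rule derivative_eq_intros dp d1 refl)+ (simp add: diff_def power2_eq_square algebra_simps)
      then show ?thesis by (simp add: diff_def mult.assoc numeral_2_eq_2)
    qed
    obtain s where s: "diff 0 1 = (\<Sum>m<2. (diff m 0 / fact m) * (1 - 0)^m) + (diff 2 s / fact 2) * (1 - 0)^2"
      using Taylor_up [of 2 diff "diff 0" 0 1 0] D by auto
    have w0: "w 0 = x" "w 1 = x + y" by (simp_all add: w_def)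
    have "g \<bullet> y = diff 1 0"
      by (simp add: diff_def w0 u1_def g_def inner_vec_def sum_distrib_left algebra_simps)
    moreover have "diff 2 s \<le> 2 * (C * (infnorm y)\<^sup>2)"
    proof -
      have r: "0 < r" "r \<le> 1" using q by (auto simp: r_def)
      have "r * ((r - 1) * u (w s) powr (r - 1 - 1) * (u1 s)\<^sup>2) \<le> 0"
        using r by (intro mult_nonneg_nonpos mult_nonpos_nonneg) auto
      then have "diff 2 s \<le> r * (u (w s) powr (r - 1) * u2 s)" by (simp add: diff_def)
      also have "\<dots> \<le> r * (u (w s) powr (r - 1) *
          (\<Sum>i\<in>UNIV. 2 * real q * (2 * real q - 1) * (w s $ i) ^ (2 * q - 2) * (infnorm y)\<^sup>2))"
      proof (intro mult_left_mono)
        show "u2 s \<le> (\<Sum>i\<in>UNIV. 2 * real q * (2 * real q - 1) * (w s $ i) ^ (2 * q - 2) * (infnorm y)\<^sup>2)"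
          unfolding u2_def
        proof (intro sum_mono mult_left_mono)
          fix i
          show "(y $ i)\<^sup>2 \<le> (infnorm y)\<^sup>2"
            using power_mono [OF component_le_infnorm_cart [of y i], of 2] by simp
          have "even (2 * q - 2)" by simp
          then show "0 \<le> 2 * real q * (2 * real q - 1) * (w s $ i) ^ (2 * q - 2)"
            using q by (intro mult_nonneg_nonneg zero_le_even_power) auto
        qed
      qed (use r in auto)
      also have "(\<Sum>i\<in>UNIV. 2 * real q * (2 * real q - 1) * (w s $ i) ^ (2 * q - 2) * (infnorm y)\<^sup>2) = 2 * real q * (2 * real q - 1) * (infnorm y)\<^sup>2 * (\<Sum>i\<in>UNIV. (w s $ i) ^ (2 * q - 2))"
        unfolding sum_distrib_left by (intro sum.cong) (auto simp: algebra_simps)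
      \<comment> \<open>\<open>r * real q = 1\<close> removes one factor q stemming from the
        exponent 2q, so the constant grows only linearly in q.\<close>
      also have "r * (u (w s) powr (r - 1) * \<dots>) = 2 * (2 * real q - 1) * (infnorm y)\<^sup>2
          * (u (w s) powr (r - 1) * (\<Sum>i\<in>UNIV. (w s $ i) ^ (2 * q - 2)))"
        using q by (simp add: r_def)
      also have "\<dots> \<le> 2 * (2 * real q - 1) * (infnorm y)\<^sup>2 * real CARD('n) powr r"
        unfolding r_def using q e u
        by (intro mult_left_mono sum_power_le_powr) (auto simp: u_def)
      finally show ?thesis by (simp add: C_def algebra_simps)
    qed
    moreover have "diff 0 1 = pnorm_sq q e (x + y)" "diff 0 0 = pnorm_sq q e x"
      by (simp_all add: diff_def h w0)
    ultimately show ?thesis using s by (simp add: numeral_2_eq_2)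
  qed
  then show ?thesis unfolding C_def r_def by blast
qed

text \<open>The linear term of the expansion integrates to zero because \<open>\<xi>\<close> is
  centred. An infinite second moment is treated apart: the bounding function is then not integrable,
  but the right-hand side is infinite because its coefficient is positive.\<close>

lemma nn_integral_pnorm_sq_add_le:
  fixes \<xi> :: "'z \<Rightarrow> real ^ 'n"
  assumes P: "prob_space P" and e: "e > 0" and q: "q \<ge> 1"
    and \<xi>: "has_bochner_integral P \<xi> 0"
  shows "(\<integral>\<^sup>+z. ennreal (pnorm_sq q e (v + \<xi> z)) \<partial>P) \<le> ennreal (pnorm_sq q e v)
     + ennreal ((2 * real q - 1) * real CARD('n) powr (1 / real q)) * (\<integral>\<^sup>+z. ennreal ((infnorm (\<xi> z))\<^sup>2) \<partial>P)"
    (is "_ \<le> _ + ennreal ?C * ?V")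
proof (cases "?V = \<infinity>")
  case True
  have "?C > 0" using q by (intro mult_pos_pos) auto
  then have "ennreal ?C \<noteq> 0" by (metis ennreal_eq_0_iff not_le)
  moreover have "c * \<infinity> = \<infinity>" if "c \<noteq> 0" for c :: ennreal
    using that by (simp add: ennreal_mult_top)
  ultimately have "ennreal ?C * ?V = \<infinity>" unfolding True by blast
  then show ?thesis by simp
next
  case False
  interpret prob_space P by (fact P)
  have [measurable]: "\<xi> \<in> borel_measurable P"
    using \<xi> by (auto simp: has_bochner_integral_iff)
  have C: "?C \<ge> 0" using q by (intro mult_nonneg_nonneg) auto
  obtain g where g: "\<And>y. pnorm_sq q e (v + y) \<le> pnorm_sq q e v + g \<bullet> y + ?C * (infnorm y)\<^sup>2"
    using pnorm_sq_add_le [OF e q] by metis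
  have i1: "integrable P (\<lambda>z. (infnorm (\<xi> z))\<^sup>2)"
    using False by (intro integrableI_nonneg) (auto simp: less_top)
  have hb: "has_bochner_integral P (\<lambda>z. g \<bullet> \<xi> z) (g \<bullet> 0)"
    using \<xi> by (rule has_bochner_integral_inner_right)
  then have i2: "integrable P (\<lambda>z. g \<bullet> \<xi> z)" "(\<integral>z. g \<bullet> \<xi> z \<partial>P) = 0"
    by (auto simp: has_bochner_integral_iff)
  let ?b = "\<lambda>z. pnorm_sq q e v + g \<bullet> \<xi> z + ?C * (infnorm (\<xi> z))\<^sup>2"
  have ib: "integrable P ?b" using i1 i2 by simp
  have "(\<integral>\<^sup>+z. ennreal (pnorm_sq q e (v + \<xi> z)) \<partial>P) \<le> (\<integral>\<^sup>+z. ennreal (?b z) \<partial>P)"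
    using g by (intro nn_integral_mono ennreal_leI)
  also have "\<dots> = ennreal (\<integral>z. ?b z \<partial>P)"
  proof (rule nn_integral_eq_integral [OF ib])
    show "AE z in P. 0 \<le> ?b z"
      using order_trans [OF pnorm_sq_nonneg g] by (intro AE_I2)
  qed
  also have "(\<integral>z. ?b z \<partial>P) = pnorm_sq q e v + ?C * (\<integral>z. (infnorm (\<xi> z))\<^sup>2 \<partial>P)"
    using i1 i2 by (simp add: prob_space)
  also have "ennreal \<dots> = ennreal (pnorm_sq q e v) + ennreal ?C * ennreal (\<integral>z. (infnorm (\<xi> z))\<^sup>2 \<partial>P)"
    using C by (subst ennreal_plus) (auto simp: ennreal_mult)
  also have "ennreal (\<integral>z. (infnorm (\<xi> z))\<^sup>2 \<partial>P) = ?V"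
    using i1 by (simp add: nn_integral_eq_integral)
  finally show ?thesis .
qed

text \<open>Origin of the constant e^2 log d. Rounding log d up makes d^(1/q) at most e. Further, 2q
  - 1 is at most 2 log d + 1, hence at most 8 (log d)^2 because log d is at least 1/2, and 8 is at
  most e^3. The product is e^4 (log d)^2.\<close>

lemma pnorm_constant_bound:
  assumes "d \<ge> 2" and q: "q = nat \<lceil>ln d\<rceil>"
  shows "q \<ge> 1" "(2 * real q - 1) * d powr (1 / real q) \<le> ((exp 1)\<^sup>2 * ln d)\<^sup>2"
proof -
  define l where "l = ln d"
  have l: "l \<ge> 1 / 2"
  proof -
    have "exp (1 / 2 :: real) \<le> 2"
      using exp_half_le2 by simp
    then show ?thesis unfolding l_def using assms(1)
      by (subst ln_ge_iff) auto
  qed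
  then have "\<lceil>l\<rceil> \<ge> 1" by linarith
  then show "q \<ge> 1" using q l_def by linarith
  have ql: "l \<le> real q" "real q \<le> l + 1" using l q by (auto simp: l_def)
  have "d powr (1 / real q) = exp (l / real q)"
    using assms(1) by (simp add: powr_def l_def)
  also have "\<dots> \<le> exp 1" using ql \<open>q \<ge> 1\<close> by simp
  finally have "(2 * real q - 1) * d powr (1 / real q) \<le> (2 * real q - 1) * exp 1"
    using \<open>q \<ge> 1\<close> by (intro mult_left_mono) auto
  also have "\<dots> \<le> (8 * l\<^sup>2) * exp 1"
  proof (rule mult_right_mono)
    \<comment> \<open>Expands to \<open>2 * l + 1 \<le> 8 * l\<^sup>2\<close>, while
      \<open>q \<le> l + 1\<close> bounds \<open>2 * q - 1\<close> by
      \<open>2 * l + 1\<close>.\<close>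
    have "(l - 1/2) * (8 * l + 2) \<ge> 0" using l by (intro mult_nonneg_nonneg) auto
    then show "2 * real q - 1 \<le> 8 * l\<^sup>2" using ql by (simp add: power2_eq_square algebra_simps)
  qed simp
  also have "\<dots> \<le> (exp 1 ^ 3 * l\<^sup>2) * exp 1"
  proof (intro mult_right_mono)
    have "2 \<le> exp (1::real)" using exp_ge_add_one_self [of 1] by simp
    then have "(2::real) ^ 3 \<le> exp 1 ^ 3" by (rule power_mono) simp
    then show "8 \<le> exp (1::real) ^ 3" by simp
  qed auto
  also have "\<dots> = ((exp 1)\<^sup>2 * ln d)\<^sup>2"
    by (simp add: l_def power2_eq_square power3_eq_cube)
  finally show "(2 * real q - 1) * d powr (1 / real q) \<le> ((exp 1)\<^sup>2 * ln d)\<^sup>2" .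
qed

section \<open>Stationarity\<close>

definition normal_cone :: "'a::real_inner set \<Rightarrow> 'a \<Rightarrow> 'a set" where
  "normal_cone X u = {n. \<forall>y\<in>X. n \<bullet> (y - u) \<le> 0}"

text \<open>Off \<open>X\<close> the difference quotient is infinite, so only points of
  \<open>X\<close> count. There it is a remainder \<open>R\<close>, tending to 0, minus the
  normalised inner product with \<open>n\<close>. If \<open>n\<close> is normal the quotient is at
  least \<open>R\<close>; if not, convexity provides a segment along which it stays below a negative
  number.\<close>

lemma frechet_subdiff_plus_delta_set:
  fixes X :: "'a::euclidean_space set"
  assumes X: "convex X" and u: "u \<in> X" and g: "GDERIV f u :> g"
  shows "frechet_subdiff (\<lambda>y. ereal (f y) + delta_set X y) u = (+) g ` normal_cone X u"
proof -
  define R where "R = (\<lambda>y. (f y - f u - g \<bullet> (y - u)) / norm (y - u))"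
  have R: "(R \<longlongrightarrow> 0) (at u)"
  proof -
    have "((\<lambda>y. norm (f y - f u - (y - u) \<bullet> g) / norm (y - u)) \<longlongrightarrow> 0) (at u)"
      using g unfolding gderiv_def has_derivative_iff_norm by blast
    then have "((\<lambda>y. \<bar>R y\<bar>) \<longlongrightarrow> 0) (at u)"
      by (simp add: R_def inner_commute abs_divide)
    then show ?thesis by (simp add: tendsto_rabs_zero_iff)
  qed
  let ?h = "\<lambda>y. ereal (f y) + delta_set X y"
  let ?Q = "\<lambda>v y. (?h y - ?h u - ereal (v \<bullet> (y - u))) / ereal (norm (y - u))"
  have Q_in: "?Q (g + n) y = ereal (R y - n \<bullet> (y - u) / norm (y - u))" if "y \<in> X" "y \<noteq> u" for n y
    using that u by (simp add: R_def delta_set_def inner_add_left diff_divide_distrib add_divide_distrib)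
  have Q_out: "?Q v y = \<infinity>" if "y \<notin> X" for v y
  proof -
    have "y \<noteq> u" using that u by auto
    then show ?thesis using that u by (simp add: delta_set_def)
  qed
  have "g + n \<in> frechet_subdiff ?h u \<longleftrightarrow> n \<in> normal_cone X u" for n
  proof
    assume n: "n \<in> normal_cone X u"
    have "0 \<le> Liminf (at u) (?Q (g + n))"
      unfolding le_Liminf_iff
    proof (intro allI impI)
      fix e :: ereal assume "e < 0"
      then obtain c where c: "e < ereal c" "c < 0"
        by (metis ereal_dense2 ereal_less(2) less_ereal.simps(1) zero_ereal_def)
      have "\<forall>\<^sub>F y in at u. c < R y \<and> y \<noteq> u"
        using order_tendstoD(1) [OF R c(2)] by (intro eventually_conj eventually_neq_at_within)
      then show "\<forall>\<^sub>F y in at u. e < ?Q (g + n) y"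
      proof eventually_elim
        case (elim y)
        show ?case
        proof (cases "y \<in> X")
          case True
          have "n \<bullet> (y - u) / norm (y - u) \<le> 0"
            using n True by (intro divide_nonpos_nonneg) (auto simp: normal_cone_def)
          then have "ereal c < ?Q (g + n) y" using elim True by (simp add: Q_in)
          then show ?thesis using c(1) by (rule less_trans [rotated])
        next
          case False
          then have "?Q (g + n) y = \<infinity>" by (rule Q_out)
          moreover have "e < \<infinity>" using c(1) less_trans [of e "ereal c" "\<infinity>"] by simp
          ultimately show ?thesis by (simp only:)
        qed
      qed
    qed
    then show "g + n \<in> frechet_subdiff ?h u"
      using u by (simp add: frechet_subdiff_def delta_set_def)
  next
    assume "g + n \<in> frechet_subdiff ?h u"
    then have L: "0 \<le> Liminf (at u) (?Q (g + n))"
      by (simp add: frechet_subdiff_def)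
    show "n \<in> normal_cone X u"
      unfolding normal_cone_def
    proof (intro CollectI ballI, rule ccontr)
      fix y assume y: "y \<in> X" and "\<not> n \<bullet> (y - u) \<le> 0"
      then have pos: "n \<bullet> (y - u) > 0" by simp
      then have ne: "y \<noteq> u" by auto
      define c where "c = n \<bullet> (y - u) / norm (y - u)"
      have c: "c > 0" using pos ne by (simp add: c_def)
      \<comment> \<open>Approach \<open>u\<close> on the segment towards \<open>y\<close>: it stays
        in \<open>X\<close>, and the normalised inner product with \<open>n\<close> is constantly
        \<open>c\<close> there, so the quotient tends to \<open>- c\<close>.\<close>
      define w where "w = (\<lambda>s. u + s *\<^sub>R (y - u))"
      have w: "filterlim w (at u) (at_right 0)"
        unfolding filterlim_at
      proof
        have "(w \<longlongrightarrow> u + 0 *\<^sub>R (y - u)) (at_right 0)" unfolding w_def by (intro tendsto_intros)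
        then show "(w \<longlongrightarrow> u) (at_right 0)" by simp
        show "\<forall>\<^sub>F s in at_right 0. w s \<in> UNIV \<and> w s \<noteq> u"
          unfolding eventually_at_right_field using ne by (intro exI [of _ 1]) (auto simp: w_def)
      qed
      have "ereal (- c / 2) < 0" using c by simp
      then have "\<forall>\<^sub>F y in at u. ereal (- c / 2) < ?Q (g + n) y"
        using L unfolding le_Liminf_iff by blast
      moreover have "\<forall>\<^sub>F y in at u. R y < c / 2"
        using c by (intro order_tendstoD(2) [OF R]) simp
      ultimately have "\<forall>\<^sub>F y in at u. ereal (- c / 2) < ?Q (g + n) y \<and> R y < c / 2"
        by (rule eventually_conj)
      then have "\<forall>\<^sub>F s in at_right 0. ereal (- c / 2) < ?Q (g + n) (w s) \<and> R (w s) < c / 2"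
        using w by (rule eventually_compose_filterlim)
      moreover have "\<forall>\<^sub>F s in at_right 0. 0 < s \<and> s < (1::real)"
        unfolding eventually_at_right_field by (intro exI [of _ 1]) auto
      ultimately have "\<forall>\<^sub>F s in at_right (0::real). False"
      proof eventually_elim
        case (elim s)
        have "w s = (1 - s) *\<^sub>R u + s *\<^sub>R y" by (simp add: w_def algebra_simps)
        then have ws: "w s \<in> X" using elim u y X by (simp add: convexD)
        have "w s \<noteq> u" using elim ne by (simp add: w_def)
        moreover have "n \<bullet> (w s - u) / norm (w s - u) = c" using elim by (simp add: w_def c_def)
        ultimately have "ereal (- c / 2) < ereal (R (w s) - c)" using elim ws by (simp add: Q_in)
        then show False using elim by simp
      qed
      then show False by (simp add: eventually_False trivial_limit_at_right_real)
    qed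
  qed
  moreover have "v \<in> (+) g ` N \<longleftrightarrow> v - g \<in> N" for v and N :: "'a set"
    by (auto simp: image_iff) (metis add.commute diff_add_cancel)
  ultimately show ?thesis
    by (intro set_eqI) (metis add.commute diff_add_cancel)
qed

section \<open>Measurability of the distance from zero to a translated normal cone\<close>

lemma compact_infnorm_le: "compact {p :: 'a::euclidean_space. infnorm p \<le> a}"
proof (rule compact_eq_bounded_closed [THEN iffD2, OF conjI])
  have "norm p \<le> sqrt (real DIM('a)) * a" if "infnorm p \<le> a" for p :: 'a
    using norm_le_infnorm [of p] that by (meson mult_left_mono order_trans real_sqrt_ge_zero of_nat_0_le_iff)
  then show "bounded {p :: 'a. infnorm p \<le> a}" by (auto simp: bounded_iff)
  show "closed {p :: 'a. infnorm p \<le> a}" by (intro closed_Collect_le continuous_intros)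
qed

text \<open>The normal cone inequality passes to the limit. The sums \<open>g u + n\<close> are
  followed instead of the normals, since they lie in a fixed compact sup-norm ball and so have a
  convergent subsequence.\<close>

lemma closed_translated_normal_cone_sublevel:
  fixes X :: "'a::euclidean_space set"
  assumes X: "closed X" and g: "continuous_on X g"
  shows "closed {u \<in> X. \<exists>n\<in>normal_cone X u. infnorm (g u + n) \<le> a}"
  unfolding closed_sequential_limits
proof (intro allI impI, elim conjE)
  fix u :: "nat \<Rightarrow> 'a" and l
  assume u: "\<forall>j. u j \<in> {u \<in> X. \<exists>n\<in>normal_cone X u. infnorm (g u + n) \<le> a}" and l: "u \<longlonglongrightarrow> l"
  then have uX: "u j \<in> X" for j by auto
  then have lX: "l \<in> X" using X l closed_sequentially by blast
  have gl: "(\<lambda>j. g (u j)) \<longlonglongrightarrow> g l"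
    using continuous_on_tendsto_compose [OF g l lX] uX by simp
  have "\<forall>j. \<exists>p. infnorm p \<le> a \<and> p - g (u j) \<in> normal_cone X (u j)"
  proof
    fix j
    obtain n where "n \<in> normal_cone X (u j)" "infnorm (g (u j) + n) \<le> a" using u by blast
    then show "\<exists>p. infnorm p \<le> a \<and> p - g (u j) \<in> normal_cone X (u j)"
      by (intro exI [of _ "g (u j) + n"]) simp
  qed
  then obtain p where p: "\<And>j. infnorm (p j) \<le> a" "\<And>j. p j - g (u j) \<in> normal_cone X (u j)"
    by metis
  then have "\<forall>j. p j \<in> {p. infnorm p \<le> a}" by simp
  then obtain q r where q: "q \<in> {p. infnorm p \<le> a}" and r: "strict_mono r" "(p \<circ> r) \<longlonglongrightarrow> q"
    by (rule seq_compactE [OF compact_imp_seq_compact [OF compact_infnorm_le]])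
  have "q - g l \<in> normal_cone X l"
    unfolding normal_cone_def
  proof (intro CollectI ballI)
    fix y assume y: "y \<in> X"
    have "(\<lambda>j. ((p \<circ> r) j - g (u (r j))) \<bullet> (y - u (r j))) \<longlonglongrightarrow> (q - g l) \<bullet> (y - l)"
      using LIMSEQ_subseq_LIMSEQ [OF l r(1)] LIMSEQ_subseq_LIMSEQ [OF gl r(1)] r(2)
      by (intro tendsto_intros) (auto simp: o_def)
    then show "(q - g l) \<bullet> (y - l) \<le> 0"
      by (rule LIMSEQ_le_const2) (use p(2) y in \<open>auto simp: normal_cone_def\<close>)
  qed
  then show "l \<in> {u \<in> X. \<exists>n\<in>normal_cone X u. infnorm (g u + n) \<le> a}"
    using lX q by (auto intro!: bexI [of _ "q - g l"])
qed

text \<open>A strict bound on the infimum is witnessed by one normal vector and a rational level, so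
  strict sublevel sets are countable unions of the closed sets above.\<close>

lemma measurable_dist_inf_zero_translated_normal_cone:
  fixes X :: "'a::euclidean_space set"
  assumes X: "closed X" and g: "continuous_on X g"
  shows "(\<lambda>u. dist_inf_zero ((+) (g u) ` normal_cone X u)) \<in> borel_measurable (restrict_space borel X)"
proof (rule borel_measurableI_less)
  fix y :: ennreal
  let ?S = "\<lambda>a. {u \<in> X. \<exists>n\<in>normal_cone X u. infnorm (g u + n) \<le> a}"
  have "(dist_inf_zero ((+) (g u) ` normal_cone X u) < y) \<longleftrightarrow>
     (\<exists>a\<in>\<rat>. ennreal a < y \<and> (\<exists>n\<in>normal_cone X u. infnorm (g u + n) \<le> a))" for u
  proof
    assume "dist_inf_zero ((+) (g u) ` normal_cone X u) < y"
    then obtain n where n: "n \<in> normal_cone X u" "ennreal (infnorm (g u + n)) < y"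
      by (auto simp: dist_inf_zero_def INF_less_iff)
    \<comment> \<open>A real level above the norm is wanted. An infinite \<open>y\<close> offers
      none itself, so 1 is added to the norm there.\<close>
    have "\<exists>c. infnorm (g u + n) < c \<and> ennreal c \<le> y"
    proof (cases y)
      case (real b)
      then show ?thesis using n(2) by (intro exI [of _ b]) (auto simp: ennreal_less_iff infnorm_pos_le)
    next
      case top
      then show ?thesis by (intro exI [of _ "infnorm (g u + n) + 1"]) auto
    qed
    then obtain c where c: "infnorm (g u + n) < c" "ennreal c \<le> y" by blast
    obtain a where a: "a \<in> \<rat>" "infnorm (g u + n) < a" "a < c"
      using Rats_dense_in_real [OF c(1)] by blast
    have "ennreal a < ennreal c"
      using a infnorm_pos_le [of "g u + n"] by (intro ennreal_lessI) auto
    then show "\<exists>a\<in>\<rat>. ennreal a < y \<and> (\<exists>n\<in>normal_cone X u. infnorm (g u + n) \<le> a)"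
      using a c n(1) by (intro bexI [of _ a]) (auto intro: less_imp_le)
  next
    assume "\<exists>a\<in>\<rat>. ennreal a < y \<and> (\<exists>n\<in>normal_cone X u. infnorm (g u + n) \<le> a)"
    then obtain a n where "ennreal a < y" "n \<in> normal_cone X u" "infnorm (g u + n) \<le> a" by blast
    then show "dist_inf_zero ((+) (g u) ` normal_cone X u) < y"
      unfolding dist_inf_zero_def
      by (intro INF_lower [THEN order_le_less_trans, of "g u + n"]) (auto intro: ennreal_leI order_le_less_trans)
  qed
  then have "{u \<in> space (restrict_space borel X). dist_inf_zero ((+) (g u) ` normal_cone X u) < y}
     = (\<Union>a\<in>{a\<in>\<rat>. ennreal a < y}. ?S a)"
    by (auto simp: space_restrict_space)
  also have "\<dots> \<in> sets (restrict_space borel X)"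
  proof (rule sets.countable_UN'')
    show "countable {a\<in>\<rat>. ennreal a < y}" using countable_rat by (rule countable_subset [rotated]) auto
    fix a
    have "?S a \<in> sets borel" using closed_translated_normal_cone_sublevel [OF X g] by (rule borel_closed)
    moreover have "?S a = X \<inter> ?S a" by auto
    ultimately show "?S a \<in> sets (restrict_space borel X)"
      unfolding sets_restrict_space by blast
  qed
  finally show "{u \<in> space (restrict_space borel X). dist_inf_zero ((+) (g u) ` normal_cone X u) < y}
     \<in> sets (restrict_space borel X)" .
qed

section \<open>The proximal step\<close>

text \<open>Divide by \<open>s\<close> and let it tend to 0 from the right. Minimality along a
  segment thereby becomes a first-order condition without differentiating the l1 norm.\<close>

lemma quadratic_perturbation_nonneg:
  fixes b c :: real
  assumes "\<And>s. 0 < s \<Longrightarrow> s < 1 \<Longrightarrow> 0 \<le> s * b + s\<^sup>2 * c"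
  shows "0 \<le> b"
proof (rule tendsto_lowerbound)
  have "((\<lambda>s. b + s * c) \<longlongrightarrow> b + 0 * c) (at_right 0)" by (intro tendsto_intros)
  then show "((\<lambda>s. b + s * c) \<longlongrightarrow> b) (at_right 0)" by simp
  have "0 \<le> b + s * c" if "0 < s" "s < 1" for s
  proof -
    have "0 \<le> s * (b + s * c)" using assms [OF that] by (simp add: algebra_simps power2_eq_square)
    then show ?thesis using that by (simp add: zero_le_mult_iff)
  qed
  then show "\<forall>\<^sub>F s in at_right 0. 0 \<le> b + s * c"
    unfolding eventually_at_right_field by (intro exI [of _ 1]) auto
qed simp

lemma prox_step_in: "prox_step X \<phi> \<eta> x g x' \<Longrightarrow> x' \<in> X"
  by (simp add: prox_step_def is_arg_min_def)

lemma prox_step_le: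
  assumes "prox_step X \<phi> \<eta> x g x'" "y \<in> X"
  shows "1/2 * (norm (x' - (x - \<eta> *\<^sub>R g)))\<^sup>2 + \<phi> (x' - x) \<le> 1/2 * (norm (y - (x - \<eta> *\<^sub>R g)))\<^sup>2 + \<phi> (y - x)"
  using assms by (auto simp: prox_step_def is_arg_min_def not_less)

context
  fixes X :: "(real ^ 'n) set" and \<rho> \<eta> :: real
  assumes X: "convex X" and \<rho>: "\<rho> \<ge> 0"
begin

abbreviation (input) "l1_prox \<equiv> prox_step X (\<lambda>z. \<rho> / 2 * (l1norm z)\<^sup>2) \<eta>"

text \<open>Compare \<open>x'\<close> with the midpoint of \<open>x'\<close> and \<open>y\<close>:
  the parallelogram identity supplies the quadratic gain, and the squared l1 norm contributes its
  convexity. The midpoint yields 1/4 in place of the 1/2 of full strong convexity, which suffices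
  for stability of the minimizer.\<close>

lemma l1_prox_quadratic_growth:
  assumes s: "l1_prox x g x'" and y: "y \<in> X"
  shows "1/2 * (norm (x' - (x - \<eta> *\<^sub>R g)))\<^sup>2 + \<rho> / 2 * (l1norm (x' - x))\<^sup>2 + 1/4 * (norm (y - x'))\<^sup>2
     \<le> 1/2 * (norm (y - (x - \<eta> *\<^sub>R g)))\<^sup>2 + \<rho> / 2 * (l1norm (y - x))\<^sup>2"
proof -
  define a where "a = x - \<eta> *\<^sub>R g"
  define z where "z = (1/2) *\<^sub>R x' + (1/2) *\<^sub>R y"
  have "z \<in> X" unfolding z_def using X y prox_step_in [OF s] by (intro convexD) auto
  from prox_step_le [OF s this] have le: "1/2 * (norm (x' - a))\<^sup>2 + \<rho> / 2 * (l1norm (x' - x))\<^sup>2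
     \<le> 1/2 * (norm (z - a))\<^sup>2 + \<rho> / 2 * (l1norm (z - x))\<^sup>2" by (simp add: a_def)
  have "z - a = (1/2) *\<^sub>R ((x' - a) + (y - a))"
    by (simp add: z_def scaleR_add_right scaleR_diff_right flip: scaleR_add_left)
  then have "(norm (z - a))\<^sup>2 = 1/4 * (norm ((x' - a) + (y - a)))\<^sup>2"
    by (simp add: power_mult_distrib power2_eq_square)
  moreover have "(norm (v + w))\<^sup>2 + (norm (w - v))\<^sup>2 = 2 * (norm v)\<^sup>2 + 2 * (norm w)\<^sup>2" for v w :: "real ^ 'n"
    unfolding power2_norm_eq_inner by (simp add: inner_simps inner_commute)
  from this [of "x' - a" "y - a"]
  have "(norm ((x' - a) + (y - a)))\<^sup>2 + (norm ((y - a) - (x' - a)))\<^sup>2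
      = 2 * (norm (x' - a))\<^sup>2 + 2 * (norm (y - a))\<^sup>2" .
  moreover have "(y - a) - (x' - a) = y - x'" by simp
  ultimately have n: "(norm (z - a))\<^sup>2 = 1/2 * (norm (x' - a))\<^sup>2 + 1/2 * (norm (y - a))\<^sup>2 - 1/4 * (norm (y - x'))\<^sup>2"
    by simp
  have "z - x = (1/2) *\<^sub>R (x' - x) + (1/2) *\<^sub>R (y - x)"
    by (simp add: z_def scaleR_diff_right flip: scaleR_add_left)
  then have "l1norm (z - x) \<le> 1/2 * l1norm (x' - x) + 1/2 * l1norm (y - x)"
    using l1norm_triangle [of "(1/2) *\<^sub>R (x' - x)" "(1/2) *\<^sub>R (y - x)"] by simp
  then have "(l1norm (z - x))\<^sup>2 \<le> (1/2 * l1norm (x' - x) + 1/2 * l1norm (y - x))\<^sup>2"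
    by (intro power_mono) auto
  also have "\<dots> \<le> 1/2 * (l1norm (x' - x))\<^sup>2 + 1/2 * (l1norm (y - x))\<^sup>2"
    using zero_le_power2 [of "l1norm (x' - x) - l1norm (y - x)"]
    by (simp add: power2_eq_square algebra_simps)
  finally have "\<rho> / 2 * (l1norm (z - x))\<^sup>2 \<le> \<rho> / 2 * (1/2 * (l1norm (x' - x))\<^sup>2 + 1/2 * (l1norm (y - x))\<^sup>2)"
    using \<rho> by (intro mult_left_mono) auto
  then show ?thesis using le n unfolding a_def [symmetric] by (simp add: algebra_simps)
qed

text \<open>Compare with \<open>x\<close> itself, where the proximal term vanishes; the square of
  \<open>norm (x' - x)\<close> left after expansion is nonnegative and is dropped.\<close>

lemma l1_prox_descent:
  assumes s: "l1_prox x g x'" and x: "x \<in> X" and \<eta>: "\<eta> > 0"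
  shows "g \<bullet> (x' - x) \<le> - (\<rho> / (2 * \<eta>)) * (l1norm (x' - x))\<^sup>2"
proof -
  have "1/2 * (norm (x' - x + \<eta> *\<^sub>R g))\<^sup>2 + \<rho> / 2 * (l1norm (x' - x))\<^sup>2 \<le> 1/2 * (norm (\<eta> *\<^sub>R g))\<^sup>2"
    using prox_step_le [OF s x] by (simp add: algebra_simps)
  moreover have "(norm (x' - x + \<eta> *\<^sub>R g))\<^sup>2 = (norm (x' - x))\<^sup>2 + 2 * \<eta> * (g \<bullet> (x' - x)) + (norm (\<eta> *\<^sub>R g))\<^sup>2"
    unfolding power2_norm_eq_inner by (simp add: inner_simps inner_commute algebra_simps)
  ultimately have "\<eta> * (g \<bullet> (x' - x)) + \<rho> / 2 * (l1norm (x' - x))\<^sup>2 \<le> 0"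
    using zero_le_power2 [of "norm (x' - x)"] by linarith
  then show ?thesis using \<eta> by (simp add: field_simps)
qed

text \<open>The epigraph of \<open>w \<mapsto> (x' - x + \<eta> g) \<bullet> w + \<rho> |x' - x|\<^sub>1 |w|\<^sub>1\<close> lies above \<open>(X - x') \<times> {0}\<close>;
  the normal vector is read off a hyperplane separating the two.\<close>

lemma l1_prox_normal_vector:
  assumes s: "l1_prox x g x'"
  shows "\<exists>n\<in>normal_cone X x'. infnorm (x' - x + \<eta> *\<^sub>R g + n) \<le> \<rho> * l1norm (x' - x)"
proof -
  define a where "a = x' - x + \<eta> *\<^sub>R g"
  define r where "r = \<rho> * l1norm (x' - x)"
  have r: "r \<ge> 0" using \<rho> by (simp add: r_def)
  have x': "x' \<in> X" by (rule prox_step_in [OF s])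
  \<comment> \<open>To first order, half of \<open>\<rho>\<close> times the squared l1 norm grows by
    at most \<open>\<rho> * l1norm (x' - x)\<close> times the l1 norm of the displacement; this is
    where \<open>r\<close> comes from.\<close>
  have first_order: "0 \<le> a \<bullet> (y - x') + r * l1norm (y - x')" if y: "y \<in> X" for y
  proof (rule quadratic_perturbation_nonneg)
    fix \<tau> :: real assume \<tau>: "0 < \<tau>" "\<tau> < 1"
    define w where "w = y - x'"
    have "x' + \<tau> *\<^sub>R w = (1 - \<tau>) *\<^sub>R x' + \<tau> *\<^sub>R y" by (simp add: w_def algebra_simps)
    then have "x' + \<tau> *\<^sub>R w \<in> X" using \<tau> x' y X by (simp add: convexD)
    from prox_step_le [OF s this]
    have le: "1/2 * (norm a)\<^sup>2 + \<rho> / 2 * (l1norm (x' - x))\<^sup>2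
      \<le> 1/2 * (norm (a + \<tau> *\<^sub>R w))\<^sup>2 + \<rho> / 2 * (l1norm ((x' - x) + \<tau> *\<^sub>R w))\<^sup>2"
      by (simp add: a_def algebra_simps)
    have n: "(norm (a + \<tau> *\<^sub>R w))\<^sup>2 = (norm a)\<^sup>2 + 2 * \<tau> * (a \<bullet> w) + \<tau>\<^sup>2 * (norm w)\<^sup>2"
      unfolding power2_norm_eq_inner by (simp add: inner_simps inner_commute power2_eq_square)
    have "(l1norm ((x' - x) + \<tau> *\<^sub>R w))\<^sup>2 \<le> (l1norm (x' - x) + \<tau> * l1norm w)\<^sup>2"
      using l1norm_triangle [of "x' - x" "\<tau> *\<^sub>R w"] \<tau> by (intro power_mono) auto
    then have "\<rho> / 2 * (l1norm ((x' - x) + \<tau> *\<^sub>R w))\<^sup>2 \<le> \<rho> / 2 * (l1norm (x' - x) + \<tau> * l1norm w)\<^sup>2"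
      using \<rho> by (intro mult_left_mono) auto
    also have "\<dots> = \<rho> / 2 * (l1norm (x' - x))\<^sup>2 + \<tau> * (r * l1norm w) + \<tau>\<^sup>2 * (\<rho> / 2 * (l1norm w)\<^sup>2)"
      by (simp add: r_def power2_eq_square algebra_simps)
    finally show "0 \<le> \<tau> * (a \<bullet> (y - x') + r * l1norm (y - x')) + \<tau>\<^sup>2 * (1/2 * (norm w)\<^sup>2 + \<rho> / 2 * (l1norm w)\<^sup>2)"
      using le n unfolding w_def [symmetric] by (simp add: algebra_simps)
  qed
  define S where "S = (\<lambda>y. y - x') ` X \<times> {..(0::real)}"
  define T where "T = {p :: (real ^ 'n) \<times> real. a \<bullet> fst p + r * l1norm (fst p) < snd p}"
  have l1_convex: "l1norm (u *\<^sub>R v + v' *\<^sub>R w) \<le> u * l1norm v + v' * l1norm w" if "0 \<le> u" "0 \<le> v'"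
    for u v' and v w :: "real ^ 'n"
    using l1norm_triangle [of "u *\<^sub>R v" "v' *\<^sub>R w"] that by simp
  have "convex S" unfolding S_def using X by (intro convex_Times convex_translation_subtract) auto
  moreover have "convex T"
    unfolding convex_def
  proof (intro ballI allI impI)
    fix p q and u v :: real
    assume pq: "p \<in> T" "q \<in> T" and uv: "0 \<le> u" "0 \<le> v" "u + v = 1"
    let ?l = "\<lambda>p. a \<bullet> fst p + r * l1norm (fst p)"
    have "?l (u *\<^sub>R p + v *\<^sub>R q) \<le> u * ?l p + v * ?l q"
      using mult_left_mono [OF l1_convex [OF uv(1,2), of "fst p" "fst q"] r]
      by (simp add: inner_simps algebra_simps)
    also have "\<dots> < u * snd p + v * snd q"
    proof (cases "u = 0")
      case True
      then show ?thesis using uv pq by (simp add: T_def)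
    next
      case False
      then have "u * ?l p < u * snd p" using uv pq by (simp add: T_def)
      moreover have "v * ?l q \<le> v * snd q" using uv pq by (intro mult_left_mono) (auto simp: T_def)
      ultimately show ?thesis by linarith
    qed
    finally show "u *\<^sub>R p + v *\<^sub>R q \<in> T" by (simp add: T_def)
  qed
  moreover have "(0, 0) \<in> S" using x' by (auto simp: S_def intro: image_eqI [of _ _ x'])
  moreover have T0: "(w, a \<bullet> w + r * l1norm w + \<epsilon>) \<in> T" if "\<epsilon> > 0" for w \<epsilon> using that by (simp add: T_def)
  moreover have "S \<inter> T = {}"
  proof (intro equals0I, elim IntE)
    fix p assume "p \<in> S" "p \<in> T"
    then obtain y where "y \<in> X" "fst p = y - x'" "snd p \<le> 0" by (auto simp: S_def)
    then show False using first_order [of y] \<open>p \<in> T\<close> by (simp add: T_def)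
  qed
  ultimately obtain c \<beta> where c: "c \<noteq> 0" "\<forall>p\<in>S. c \<bullet> p \<le> \<beta>" "\<forall>p\<in>T. c \<bullet> p \<ge> \<beta>"
    using separating_hyperplane_sets [of S T] T0 [of 1 0] by (metis empty_iff zero_less_one)
  obtain c1 c2 where c12: "c = (c1, c2)" by (cases c)
  have "0 \<le> \<beta>" using c(2) \<open>(0, 0) \<in> S\<close> c12 by force
  have T1: "\<beta> \<le> c1 \<bullet> w + c2 * (a \<bullet> w + r * l1norm w + \<epsilon>)" if "\<epsilon> > 0" for w \<epsilon>
    using c(3) T0 [OF that, of w] c12 by force
  \<comment> \<open>The hyperplane is not vertical: \<open>T\<close> projects onto the whole space,
    so \<open>c2 = 0\<close> would force \<open>c1 = 0\<close>.\<close>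
  have "c2 > 0"
  proof -
    have "c2 \<ge> 0" using T1 [of 1 0] \<open>0 \<le> \<beta>\<close> by simp
    moreover have "c2 \<noteq> 0"
    proof
      assume "c2 = 0"
      then have "0 \<le> c1 \<bullet> (- c1)" using T1 [of 1 "- c1"] \<open>0 \<le> \<beta>\<close> by simp
      then have "c1 = 0" using inner_ge_zero [of c1] inner_eq_zero_iff [of c1] by simp
      then show False using \<open>c2 = 0\<close> c c12 by (simp add: zero_prod_def)
    qed
    ultimately show ?thesis by simp
  qed
  have "\<beta> \<le> 0"
  proof (rule field_le_epsilon)
    fix e :: real assume "e > 0"
    then show "\<beta> \<le> 0 + e" using T1 [of "e / c2" 0] \<open>c2 > 0\<close> by simp
  qed
  define n where "n = (1 / c2) *\<^sub>R c1"
  have "n \<in> normal_cone X x'"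
    unfolding normal_cone_def
  proof (intro CollectI ballI)
    fix y assume "y \<in> X"
    then have "(y - x', 0) \<in> S" by (auto simp: S_def)
    then have "c1 \<bullet> (y - x') \<le> 0" using c(2) c12 \<open>\<beta> \<le> 0\<close> by force
    then show "n \<bullet> (y - x') \<le> 0" using \<open>c2 > 0\<close> by (simp add: n_def divide_nonpos_pos)
  qed
  moreover have upper: "0 \<le> (a + n) \<bullet> w + r * l1norm w" for w
  proof -
    have "0 \<le> c1 \<bullet> w + c2 * (a \<bullet> w + r * l1norm w)"
    proof (rule field_le_epsilon)
      fix e :: real assume "e > 0"
      then show "0 \<le> c1 \<bullet> w + c2 * (a \<bullet> w + r * l1norm w) + e"
        using T1 [of "e / c2" w] \<open>c2 > 0\<close> \<open>0 \<le> \<beta>\<close> by (simp add: distrib_left)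
    qed
    also have "\<dots> = c2 * ((a + n) \<bullet> w + r * l1norm w)"
      using \<open>c2 > 0\<close> by (simp add: n_def inner_simps algebra_simps)
    finally show ?thesis using \<open>c2 > 0\<close> by (simp add: zero_le_mult_iff)
  qed
  \<comment> \<open>Testing with plus and minus a unit vector: the duality of l1 and sup norm,
    coordinate by coordinate.\<close>
  have "\<bar>(a + n) $ i\<bar> \<le> r" for i
  proof -
    have l: "l1norm (axis i (c::real) :: real ^ 'n) = \<bar>c\<bar>" for c
    proof -
      have "(\<Sum>j\<in>UNIV. \<bar>axis i c $ j\<bar>) = (\<Sum>j\<in>UNIV. if j = i then \<bar>c\<bar> else 0)"
        by (intro sum.cong) (auto simp: axis_def)
      then show ?thesis by (simp add: l1norm_def)
    qed
    show ?thesis using upper [of "axis i 1"] upper [of "axis i (-1)"] l [of 1] l [of "-1"]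
      by (simp add: inner_axis)
  qed
  ultimately show ?thesis unfolding a_def [symmetric] r_def [symmetric] infnorm_le_iff_cart by blast
qed

text \<open>Summing the two growth inequalities leaves a quadratic inequality for the distance of the
  minimizers.\<close>

lemma l1_prox_dist_le:
  fixes x y g h :: "real ^ 'n"
  defines "c \<equiv> real CARD('n)"
  assumes s: "l1_prox x g x'" and s': "l1_prox y h y'"
  shows "dist x' y' \<le> 2 * (norm ((x - \<eta> *\<^sub>R g) - (y - \<eta> *\<^sub>R h)) + \<rho> * c\<^sup>2 * norm (x - y))
     + sqrt (2 * \<rho> * c * norm (x - y) * (2 * l1norm (x' - x) + c * norm (x - y)))"
proof -
  define a where "a = x - \<eta> *\<^sub>R g"
  define b where "b = y - \<eta> *\<^sub>R h"
  define D where "D = norm (x' - y')"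
  define u where "u = norm (x - y)"
  define R where "R = l1norm (x' - x)"
  have nn: "0 \<le> c" "0 \<le> D" "0 \<le> u" "0 \<le> R" by (auto simp: c_def D_def u_def R_def)
  have diff_sq: "(l1norm v)\<^sup>2 - (l1norm w)\<^sup>2 \<le> l1norm (v - w) * (l1norm v + l1norm w)" for v w :: "real ^ 'n"
  proof -
    have "(l1norm v)\<^sup>2 - (l1norm w)\<^sup>2 = (l1norm v - l1norm w) * (l1norm v + l1norm w)"
      by (simp add: power2_eq_square algebra_simps)
    also have "\<dots> \<le> l1norm (v - w) * (l1norm v + l1norm w)"
      using l1norm_triangle_diff [of v w] by (intro mult_right_mono) auto
    finally show ?thesis .
  qed
  have lu: "l1norm (x - y) \<le> c * u" and lD: "l1norm (y' - x') \<le> c * D"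
    using l1norm_le_norm [of "x - y"] l1norm_le_norm [of "x' - y'"]
    by (auto simp: c_def u_def D_def l1norm_minus_commute)
  have y'x: "l1norm (y' - x) \<le> R + c * D"
    using l1norm_triangle [of "y' - x'" "x' - x"] lD by (simp add: R_def)
  have y'y: "l1norm (y' - y) \<le> R + c * D + c * u"
    using l1norm_triangle [of "y' - x" "x - y"] lu y'x by simp
  have x'y: "l1norm (x' - y) \<le> R + c * u"
    using l1norm_triangle [of "x' - x" "x - y"] lu by (simp add: R_def)
  \<comment> \<open>The two terms differ only in their centres \<open>x\<close> and
    \<open>y\<close>, so the difference of squares carries a factor \<open>u\<close> that vanishes
    as the centres approach each other.\<close>
  have A: "(l1norm (y' - x))\<^sup>2 - (l1norm (y' - y))\<^sup>2 \<le> c * u * (2 * R + 2 * c * D + c * u)"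
  proof -
    have "(l1norm (y' - x))\<^sup>2 - (l1norm (y' - y))\<^sup>2 \<le> l1norm (x - y) * (l1norm (y' - x) + l1norm (y' - y))"
      using diff_sq [of "y' - x" "y' - y"] by (simp add: l1norm_minus_commute)
    also have "\<dots> \<le> (c * u) * (2 * R + 2 * c * D + c * u)"
      using lu y'x y'y nn by (intro mult_mono) auto
    finally show ?thesis .
  qed
  have B: "(l1norm (x' - y))\<^sup>2 - (l1norm (x' - x))\<^sup>2 \<le> c * u * (2 * R + c * u)"
  proof -
    have "(l1norm (x' - y))\<^sup>2 - (l1norm (x' - x))\<^sup>2 \<le> l1norm (x - y) * (l1norm (x' - y) + l1norm (x' - x))"
      using diff_sq [of "x' - y" "x' - x"] by simp
    also have "\<dots> \<le> (c * u) * (2 * R + c * u)"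
      using lu x'y nn by (intro mult_mono) (auto simp: R_def)
    finally show ?thesis .
  qed
  \<comment> \<open>The squared norms cancel in this combination; only the shift
    \<open>a - b\<close> paired with \<open>x' - y'\<close> survives.\<close>
  have C: "(norm (y' - a))\<^sup>2 - (norm (x' - a))\<^sup>2 + (norm (x' - b))\<^sup>2 - (norm (y' - b))\<^sup>2 \<le> 2 * (norm (a - b) * D)"
  proof -
    have "(norm (y' - a))\<^sup>2 - (norm (x' - a))\<^sup>2 + (norm (x' - b))\<^sup>2 - (norm (y' - b))\<^sup>2 = 2 * ((a - b) \<bullet> (x' - y'))"
      unfolding power2_norm_eq_inner by (simp add: inner_simps inner_commute algebra_simps)
    also have "(a - b) \<bullet> (x' - y') \<le> norm (a - b) * D"
      unfolding D_def by (rule norm_cauchy_schwarz)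
    finally show ?thesis by simp
  qed
  have "\<rho> / 2 * ((l1norm (y' - x))\<^sup>2 - (l1norm (y' - y))\<^sup>2 + ((l1norm (x' - y))\<^sup>2 - (l1norm (x' - x))\<^sup>2))
      \<le> \<rho> / 2 * (c * u * (2 * R + 2 * c * D + c * u) + c * u * (2 * R + c * u))"
    using A B \<rho> by (intro mult_left_mono) auto
  moreover have "1/2 * (norm (x' - a))\<^sup>2 + \<rho> / 2 * (l1norm (x' - x))\<^sup>2 + 1/4 * D\<^sup>2
      \<le> 1/2 * (norm (y' - a))\<^sup>2 + \<rho> / 2 * (l1norm (y' - x))\<^sup>2"
    using l1_prox_quadratic_growth [OF s prox_step_in [OF s']] by (simp add: a_def D_def norm_minus_commute)
  moreover have "1/2 * (norm (y' - b))\<^sup>2 + \<rho> / 2 * (l1norm (y' - y))\<^sup>2 + 1/4 * D\<^sup>2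
      \<le> 1/2 * (norm (x' - b))\<^sup>2 + \<rho> / 2 * (l1norm (x' - y))\<^sup>2"
    using l1_prox_quadratic_growth [OF s' prox_step_in [OF s]] by (simp add: b_def D_def)
  ultimately have "1/2 * D\<^sup>2 \<le> norm (a - b) * D + \<rho> / 2 * (c * u * (2 * R + 2 * c * D + c * u) + c * u * (2 * R + c * u))"
    using C by (simp add: algebra_simps)
  then have quad: "D\<^sup>2 \<le> (2 * (norm (a - b) + \<rho> * c\<^sup>2 * u)) * D + 2 * \<rho> * c * u * (2 * R + c * u)"
    (is "_ \<le> ?\<alpha> * D + ?\<beta>")
    using mult_nonneg_nonneg [of "\<rho> * c\<^sup>2 * u" D] nn \<rho> by (simp add: power2_eq_square algebra_simps)
  have \<alpha>: "?\<alpha> \<ge> 0" using nn \<rho> by simp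
  have \<beta>: "?\<beta> \<ge> 0" using nn \<rho> by simp
  \<comment> \<open>Otherwise \<open>D * (D - ?\<alpha>)\<close> would exceed
    \<open>?\<beta>\<close>. The bound obtained tends to 0 as \<open>(y, h)\<close> tends to
    \<open>(x, g)\<close>.\<close>
  have "D \<le> ?\<alpha> + sqrt ?\<beta>"
  proof (rule ccontr)
    assume "\<not> ?thesis"
    then have gt: "D > ?\<alpha> + sqrt ?\<beta>" by simp
    then have "D * (D - ?\<alpha>) > sqrt ?\<beta> * sqrt ?\<beta>"
      using \<alpha> \<beta> real_sqrt_ge_zero [OF \<beta>] by (intro mult_strict_mono') auto
    then show False using quad \<beta> by (simp add: power2_eq_square algebra_simps)
  qed
  then show ?thesis by (simp add: dist_norm D_def a_def b_def u_def R_def)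
qed

section \<open>Uniqueness and measurability of the proximal minimizer\<close>

lemma l1_prox_unique: "l1_prox x g x' \<Longrightarrow> l1_prox x g x'' \<Longrightarrow> x' = x''"
  using l1_prox_dist_le [of x g x' x g x''] by simp

text \<open>The iterates are given only as minimizers, so their measurability has to be derived. By
  the stability bound the minimizer is unique and depends continuously on \<open>(x, g)\<close> over
  the set \<open>S\<close> of data that admit one; the composition runs through the trace
  sigma-algebra on \<open>S\<close>.\<close>

lemma borel_measurable_l1_prox:
  fixes x g x' :: "'w \<Rightarrow> real ^ 'n"
  assumes [measurable]: "x \<in> borel_measurable N" "g \<in> borel_measurable N"
    and step: "\<And>\<omega>. \<omega> \<in> space N \<Longrightarrow> l1_prox (x \<omega>) (g \<omega>) (x' \<omega>)"
  shows "x' \<in> borel_measurable N"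
proof -
  define S where "S = {p. \<exists>z. l1_prox (fst p) (snd p) z}"
  define T where "T = (\<lambda>p. SOME z. l1_prox (fst p) (snd p) z)"
  have T: "l1_prox (fst p) (snd p) (T p)" if "p \<in> S" for p
    using that unfolding S_def T_def by (auto intro: someI)
  have "continuous_on S T"
    unfolding continuous_on_def
  proof
    fix p assume p: "p \<in> S"
    let ?c = "real CARD('n)"
    let ?e = "\<lambda>q. 2 * (norm ((fst p - \<eta> *\<^sub>R snd p) - (fst q - \<eta> *\<^sub>R snd q)) + \<rho> * ?c\<^sup>2 * norm (fst p - fst q))
       + sqrt (2 * \<rho> * ?c * norm (fst p - fst q) * (2 * l1norm (T p - fst p) + ?c * norm (fst p - fst q)))"
    have "(?e \<longlongrightarrow> ?e p) (at p within S)" by (intro tendsto_intros)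
    then have e: "(?e \<longlongrightarrow> 0) (at p within S)" by simp
    have "((\<lambda>q. dist (T p) (T q)) \<longlongrightarrow> 0) (at p within S)"
    proof (rule tendsto_sandwich [OF _ _ tendsto_const e])
      show "\<forall>\<^sub>F q in at p within S. dist (T p) (T q) \<le> ?e q"
        unfolding eventually_at_filter by (intro always_eventually allI impI l1_prox_dist_le T p)
    qed auto
    then show "(T \<longlongrightarrow> T p) (at p within S)"
      by (subst tendsto_dist_iff) (simp add: dist_commute)
  qed
  then have TM: "T \<in> borel_measurable (restrict_space borel S)"
    by (rule borel_measurable_continuous_on_restrict)
  have "(\<lambda>\<omega>. (x \<omega>, g \<omega>)) \<in> N \<rightarrow>\<^sub>M restrict_space borel S"
  proof (rule measurable_restrict_space2)
    show "(\<lambda>\<omega>. (x \<omega>, g \<omega>)) \<in> space N \<rightarrow> S"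
      unfolding S_def by (intro Pi_I CollectI exI) (simp only: fst_conv snd_conv, rule step)
  qed simp
  then have "(\<lambda>\<omega>. T (x \<omega>, g \<omega>)) \<in> borel_measurable N"
    using TM by (rule measurable_compose)
  moreover have "T (x \<omega>, g \<omega>) = x' \<omega>" if "\<omega> \<in> space N" for \<omega>
    proof (rule l1_prox_unique)
    show "l1_prox (x \<omega>) (g \<omega>) (T (x \<omega>, g \<omega>))"
      using T [of "(x \<omega>, g \<omega>)"] step [OF that] unfolding S_def fst_conv snd_conv mem_Collect_eq by blast
  qed (rule step [OF that])
  ultimately show ?thesis by (simp cong: measurable_cong)
qed

end

section \<open>Measurability of the stochastic gradient\<close>

text \<open>Replace \<open>u\<close> by simple functions \<open>s i u\<close> tending to
  \<open>u\<close>. With finitely many values in the first argument, joint measurability reduces to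
  that of each \<open>h v\<close>, and continuity in \<open>u\<close> gives the limit.\<close>

lemma measurable_caratheodory:
  fixes h :: "'a::{second_countable_topology, metric_space} \<Rightarrow> 'z \<Rightarrow> 'b::metric_space"
  assumes cont: "\<And>z. z \<in> space P \<Longrightarrow> continuous_on UNIV (\<lambda>u. h u z)"
    and meas: "\<And>u. h u \<in> borel_measurable P"
  shows "(\<lambda>(u, z). h u z) \<in> borel_measurable (borel \<Otimes>\<^sub>M P)"
proof -
  obtain s :: "nat \<Rightarrow> 'a \<Rightarrow> 'a" where s: "\<And>i. simple_function borel (s i)" "\<And>u. (\<lambda>i. s i u) \<longlonglongrightarrow> u"
    using borel_measurable_implies_sequence_metric [of "\<lambda>u::'a. u" borel undefined] by (simp, blast)
  show ?thesis
  proof (rule borel_measurable_LIMSEQ_metric)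
    fix i
    have m: "(\<lambda>p. h v (snd p)) \<in> borel_measurable (borel \<Otimes>\<^sub>M P)" for v
      using measurable_compose [OF measurable_snd meas] .
    have "s i \<in> borel \<rightarrow>\<^sub>M count_space (range (s i))"
      using s(1) [of i] by (intro measurable_count_space_eq2 [THEN iffD2])
        (auto simp: simple_function_def)
    from measurable_compose [OF measurable_fst this]
    have "(\<lambda>p. h (s i (fst p)) (snd p)) \<in> borel_measurable (borel \<Otimes>\<^sub>M P)"
      by (intro measurable_compose_countable' [OF m])
        (use s(1) [of i] in \<open>auto simp: simple_function_def intro: countable_finite\<close>)
    then show "(\<lambda>(u, z). h (s i u) z) \<in> borel_measurable (borel \<Otimes>\<^sub>M P)"
      by (simp add: case_prod_beta')
  next
    fix p :: "'a \<times> 'z" assume "p \<in> space (borel \<Otimes>\<^sub>M P)"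
    then have "continuous_on UNIV (\<lambda>u. h u (snd p))" using cont by (simp add: space_pair_measure mem_Times_iff)
    then have "(\<lambda>i. h (s i (fst p)) (snd p)) \<longlonglongrightarrow> h (fst p) (snd p)"
      using s(2) [of "fst p"] by (rule continuous_on_tendsto_compose) auto
    then show "(\<lambda>i. case p of (u, z) \<Rightarrow> h (s i u) z) \<longlonglongrightarrow> (case p of (u, z) \<Rightarrow> h u z)"
      by (simp add: case_prod_beta')
  qed
qed

lemma GDERIV_imp_continuous_on:
  "(\<And>u. GDERIV f u :> g u) \<Longrightarrow> continuous_on S f"
  unfolding gderiv_def
  by (blast intro: continuous_at_imp_continuous_on has_derivative_continuous)

lemma GDERIV_imp_has_real_derivative:
  assumes "GDERIV f (u + s *\<^sub>R v) :> g"
  shows "((\<lambda>s. f (u + s *\<^sub>R v)) has_real_derivative g \<bullet> v) (at s within S)"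
proof -
  have "((\<lambda>s. u + s *\<^sub>R v) has_derivative (\<lambda>h. h *\<^sub>R v)) (at s within S)"
    by (auto intro!: derivative_eq_intros)
  from has_derivative_compose [OF this assms [unfolded gderiv_def]]
  show ?thesis
    by (simp add: has_field_derivative_def inner_commute mult_commute_abs)
qed

lemma GDERIV_difference_quotient_LIMSEQ:
  assumes "GDERIV f u :> g"
  shows "(\<lambda>j. (f (u + (1 / real (Suc j)) *\<^sub>R v) - f u) / (1 / real (Suc j))) \<longlonglongrightarrow> g \<bullet> v"
proof -
  have "((\<lambda>s. (f (u + s *\<^sub>R v) - f u) / s) \<longlongrightarrow> g \<bullet> v) (at 0)"
    using GDERIV_imp_has_real_derivative [of f u 0 v g UNIV] assms by (simp add: has_field_derivative_iff)
  moreover have "filterlim (\<lambda>j. 1 / real (Suc j)) (at 0) sequentially"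
    unfolding filterlim_at using LIMSEQ_inverse_real_of_nat by (simp add: field_simps)
  ultimately show ?thesis by (rule filterlim_compose)
qed

text \<open>The stochastic gradient is evaluated at random iterates, which requires joint
  measurability. As it may be discontinuous in \<open>u\<close>, the preceding argument is applied
  to \<open>F\<close>; each component of the gradient is then a pointwise limit of difference
  quotients of \<open>F\<close>.\<close>

lemma measurable_parametric_gradient:
  fixes F :: "'a::euclidean_space \<Rightarrow> 'z \<Rightarrow> real"
  assumes F: "\<And>u. F u \<in> borel_measurable P"
    and g: "\<And>u z. z \<in> space P \<Longrightarrow> GDERIV (\<lambda>y. F y z) u :> g u z"
  shows "(\<lambda>(u, z). g u z) \<in> borel_measurable (borel \<Otimes>\<^sub>M P)"
proof -
  have joint: "(\<lambda>(u, z). F u z) \<in> borel_measurable (borel \<Otimes>\<^sub>M P)"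
    by (intro measurable_caratheodory F) (rule GDERIV_imp_continuous_on, rule g)
  have m: "(\<lambda>p. F (fst p + v) (snd p)) \<in> borel_measurable (borel \<Otimes>\<^sub>M P)" for v
  proof -
    have "(\<lambda>p. (fst p + v, snd p)) \<in> (borel \<Otimes>\<^sub>M P) \<rightarrow>\<^sub>M (borel \<Otimes>\<^sub>M P)"
      by (intro measurable_Pair borel_measurable_add measurable_fst measurable_snd borel_measurable_const)
    from measurable_compose [OF this joint]
    show ?thesis by (simp only: prod.case)
  qed
  show ?thesis
  proof (rule borel_measurable_euclidean_space [THEN iffD2, OF ballI])
    fix b :: 'a
    show "(\<lambda>p. (case p of (u, z) \<Rightarrow> g u z) \<bullet> b) \<in> borel_measurable (borel \<Otimes>\<^sub>M P)"
    proof (rule borel_measurable_LIMSEQ_metric)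
      fix j
      show "(\<lambda>p. (F (fst p + (1 / real (Suc j)) *\<^sub>R b) (snd p) - F (fst p) (snd p)) / (1 / real (Suc j)))
        \<in> borel_measurable (borel \<Otimes>\<^sub>M P)"
        using m [of 0] by (intro borel_measurable_divide borel_measurable_diff m borel_measurable_const) (simp only: add_0_right)
    next
      fix p :: "'a \<times> 'z" assume "p \<in> space (borel \<Otimes>\<^sub>M P)"
      then have "snd p \<in> space P" by (auto simp: space_pair_measure)
      from GDERIV_difference_quotient_LIMSEQ [OF g [OF this, of "fst p"], of b]
      show "(\<lambda>j. (F (fst p + (1 / real (Suc j)) *\<^sub>R b) (snd p) - F (fst p) (snd p)) / (1 / real (Suc j)))
        \<longlonglongrightarrow> (case p of (u, z) \<Rightarrow> g u z) \<bullet> b"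
        by (simp add: case_prod_beta')
    qed
  qed
qed

section \<open>Second moments\<close>

lemma infnorm_sum_sq_le: "(infnorm (x + y))\<^sup>2 \<le> 2 * (infnorm x)\<^sup>2 + 2 * (infnorm (y :: 'a::euclidean_space))\<^sup>2"
proof -
  have "(infnorm (x + y))\<^sup>2 \<le> (infnorm x + infnorm y)\<^sup>2"
    by (intro power_mono infnorm_triangle infnorm_pos_le)
  also have "\<dots> \<le> 2 * (infnorm x)\<^sup>2 + 2 * (infnorm y)\<^sup>2"
    using zero_le_power2 [of "infnorm x - infnorm y"] by (simp add: power2_eq_square algebra_simps)
  finally show ?thesis .
qed

text \<open>Jensen through the pointwise bound \<open>g \<le> g\<^sup>2 / (2 * s) + s / 2\<close>,
  for which \<open>s = sqrt A\<close> is the best choice; the added \<open>e\<close> keeps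
  \<open>s\<close> positive when \<open>A = 0\<close>.\<close>

lemma (in prob_space) nn_integral_le_sqrt_nn_integral_sq:
  fixes g :: "'a \<Rightarrow> real"
  assumes [measurable]: "g \<in> borel_measurable M" and g: "\<And>x. x \<in> space M \<Longrightarrow> 0 \<le> g x"
    and le: "(\<integral>\<^sup>+x. ennreal ((g x)\<^sup>2) \<partial>M) \<le> ennreal A" and A: "0 \<le> A"
  shows "(\<integral>\<^sup>+x. ennreal (g x) \<partial>M) \<le> ennreal (sqrt A)"
proof (rule ennreal_le_epsilon)
  fix e :: real assume e: "e > 0"
  define s where "s = sqrt A + e"
  have s: "s > 0" using e A by (simp add: s_def add_nonneg_pos)
  have As: "A \<le> s * s"
    using e A mult_mono [of "sqrt A" s "sqrt A" s] by (simp add: s_def)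
  have "(\<integral>\<^sup>+x. ennreal (g x) \<partial>M) \<le> (\<integral>\<^sup>+x. ennreal (1 / (2 * s)) * ennreal ((g x)\<^sup>2) + ennreal (s / 2) \<partial>M)"
  proof (rule nn_integral_mono)
    fix x
    have "0 \<le> (g x - s)\<^sup>2 / (2 * s)" using s by simp
    also have "\<dots> = 1 / (2 * s) * (g x)\<^sup>2 + s / 2 - g x"
      using s by (simp add: power2_eq_square field_simps)
    finally have "ennreal (g x) \<le> ennreal (1 / (2 * s) * (g x)\<^sup>2 + s / 2)" by (intro ennreal_leI) simp
    also have "\<dots> = ennreal (1 / (2 * s)) * ennreal ((g x)\<^sup>2) + ennreal (s / 2)"
      using s by (subst ennreal_plus) (auto simp flip: ennreal_mult)
    finally show "ennreal (g x) \<le> ennreal (1 / (2 * s)) * ennreal ((g x)\<^sup>2) + ennreal (s / 2)" .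
  qed
  also have "\<dots> = ennreal (1 / (2 * s)) * (\<integral>\<^sup>+x. ennreal ((g x)\<^sup>2) \<partial>M) + ennreal (s / 2)"
    by (simp add: nn_integral_add nn_integral_cmult emeasure_space_1)
  also have "\<dots> \<le> ennreal (1 / (2 * s)) * ennreal A + ennreal (s / 2)"
    using le by (intro add_right_mono mult_left_mono) auto
  also have "\<dots> = ennreal (1 / (2 * s) * A + s / 2)"
    using s A by (subst ennreal_plus) (auto simp flip: ennreal_mult)
  also have "\<dots> \<le> ennreal s"
    using s As by (intro ennreal_leI) (simp add: field_simps)
  finally show "(\<integral>\<^sup>+x. ennreal (g x) \<partial>M) \<le> ennreal (sqrt A) + ennreal e"
    using e A by (simp add: s_def flip: ennreal_plus)
qed

text \<open>Jensen for the squared sup norm: in each coordinate the modulus of the mean is at most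
  the mean of the sup norm, to which the preceding bound applies.\<close>

lemma (in prob_space) infnorm_expectation_sq_le:
  fixes g :: "'a \<Rightarrow> real ^ 'n"
  assumes g: "integrable M g"
  shows "ennreal ((infnorm (\<integral>z. g z \<partial>M))\<^sup>2) \<le> (\<integral>\<^sup>+z. ennreal ((infnorm (g z))\<^sup>2) \<partial>M)"
proof (cases "(\<integral>\<^sup>+z. ennreal ((infnorm (g z))\<^sup>2) \<partial>M)")
  case (real A)
  have [measurable]: "g \<in> borel_measurable M" using g by auto
  have "\<bar>(\<integral>z. g z \<partial>M) $ i\<bar> \<le> sqrt A" for i
  proof -
    have "(\<integral>z. g z \<partial>M) $ i = (\<integral>z. g z $ i \<partial>M)"
      using g integral_inner_left [of "axis i 1" M g] by (simp add: inner_axis)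
    then have "\<bar>(\<integral>z. g z \<partial>M) $ i\<bar> \<le> (\<integral>z. \<bar>g z $ i\<bar> \<partial>M)" by simp
    also have "\<dots> \<le> (\<integral>z. infnorm (g z) \<partial>M)"
      using g integrable_infnorm [OF g] integrable_inner_left [of "axis i 1" M g]
      by (intro integral_mono integrable_abs component_le_infnorm_cart) (auto simp: inner_axis)
    also have "\<dots> \<le> sqrt A"
    proof -
      have "(\<integral>\<^sup>+z. ennreal (infnorm (g z)) \<partial>M) \<le> ennreal (sqrt A)"
        using real by (intro nn_integral_le_sqrt_nn_integral_sq) (auto simp: infnorm_pos_le)
      then show ?thesis
        using integrable_infnorm [OF g] real
        by (subst (asm) nn_integral_eq_integral) (auto simp: infnorm_pos_le)
    qed
    finally show ?thesis .
  qed
  then have "infnorm (\<integral>z. g z \<partial>M) \<le> sqrt A" by (simp add: infnorm_le_iff_cart)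
  then have "(infnorm (\<integral>z. g z \<partial>M))\<^sup>2 \<le> (sqrt A)\<^sup>2" by (intro power_mono infnorm_pos_le)
  then show ?thesis using real by (simp add: ennreal_leI)
qed simp

text \<open>The Euclidean identity E|g - c|^2 = E|g|^2 - |c|^2 has no sup-norm counterpart. The
  triangle inequality contributes 2 and Jensen for \<open>c\<close> another 2; this 4 reappears in
  the step-size condition and under the first square root of the final bound.\<close>

lemma (in prob_space) nn_integral_infnorm_centered_sq_le:
  fixes g :: "'a \<Rightarrow> real ^ 'n"
  assumes g: "has_bochner_integral M g c"
  shows "(\<integral>\<^sup>+z. ennreal ((infnorm (g z - c))\<^sup>2) \<partial>M) \<le> 4 * (\<integral>\<^sup>+z. ennreal ((infnorm (g z))\<^sup>2) \<partial>M)"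
proof -
  have [measurable]: "g \<in> borel_measurable M" using g by (auto simp: has_bochner_integral_iff)
  have "(\<integral>\<^sup>+z. ennreal ((infnorm (g z - c))\<^sup>2) \<partial>M)
     \<le> (\<integral>\<^sup>+z. 2 * ennreal ((infnorm (g z))\<^sup>2) + 2 * ennreal ((infnorm c)\<^sup>2) \<partial>M)"
  proof (rule nn_integral_mono)
    fix z
    have "ennreal ((infnorm (g z - c))\<^sup>2) \<le> ennreal (2 * (infnorm (g z))\<^sup>2 + 2 * (infnorm c)\<^sup>2)"
      using infnorm_sum_sq_le [of "g z" "- c"] by (intro ennreal_leI) (simp add: infnorm_neg)
    then show "ennreal ((infnorm (g z - c))\<^sup>2) \<le> 2 * ennreal ((infnorm (g z))\<^sup>2) + 2 * ennreal ((infnorm c)\<^sup>2)"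
      by (simp add: ennreal_mult)
  qed
  also have "\<dots> = 2 * (\<integral>\<^sup>+z. ennreal ((infnorm (g z))\<^sup>2) \<partial>M) + 2 * ennreal ((infnorm c)\<^sup>2)"
    by (simp add: nn_integral_add nn_integral_cmult emeasure_space_1)
  also have "\<dots> \<le> 2 * (\<integral>\<^sup>+z. ennreal ((infnorm (g z))\<^sup>2) \<partial>M) + 2 * (\<integral>\<^sup>+z. ennreal ((infnorm (g z))\<^sup>2) \<partial>M)"
    using infnorm_expectation_sq_le [of g] g
    by (intro add_left_mono mult_left_mono) (auto simp: has_bochner_integral_iff)
  also have "\<dots> = 4 * (\<integral>\<^sup>+z. ennreal ((infnorm (g z))\<^sup>2) \<partial>M)"
    by (simp flip: distrib_right)
  finally show ?thesis .
qed

text \<open>The Lipschitz bound holds on \<open>X\<close>, so the argument stays on a segment, which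
  convexity keeps in \<open>X\<close>. That \<open>f\<close> minus its quadratic model is
  nonincreasing along it replaces an integral of the gradient.\<close>

lemma descent_lemma_l1:
  fixes f :: "real ^ 'n \<Rightarrow> real"
  assumes X: "convex X" and f: "\<And>u. GDERIV f u :> g u"
    and lip: "\<And>u v. u \<in> X \<Longrightarrow> v \<in> X \<Longrightarrow> infnorm (g u - g v) \<le> L * l1norm (u - v)"
    and u: "u \<in> X" and v: "v \<in> X"
  shows "f v \<le> f u + g u \<bullet> (v - u) + L / 2 * (l1norm (v - u))\<^sup>2"
proof -
  define w where "w = v - u"
  define \<psi> where "\<psi> = (\<lambda>s. f (u + s *\<^sub>R w) - s * (g u \<bullet> w) - s\<^sup>2 * (L / 2 * (l1norm w)\<^sup>2))"
  have "\<psi> 1 \<le> \<psi> 0"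
  proof (rule DERIV_nonpos_imp_nonincreasing [of 0 1 \<psi>])
    fix s :: real assume s: "0 \<le> s" "s \<le> 1"
    let ?D = "g (u + s *\<^sub>R w) \<bullet> w - g u \<bullet> w - 2 * s * (L / 2 * (l1norm w)\<^sup>2)"
    have "(\<psi> has_real_derivative ?D) (at s)"
      unfolding \<psi>_def by (auto intro!: derivative_eq_intros GDERIV_imp_has_real_derivative f)
    moreover have "?D \<le> 0"
    proof -
      have "u + s *\<^sub>R w = (1 - s) *\<^sub>R u + s *\<^sub>R v" by (simp add: w_def algebra_simps)
      then have "u + s *\<^sub>R w \<in> X" using s X u v by (simp add: convexD)
      then have "infnorm (g (u + s *\<^sub>R w) - g u) \<le> L * (s * l1norm w)"
        using lip [of "u + s *\<^sub>R w" u] u s by simp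
      then have "(g (u + s *\<^sub>R w) - g u) \<bullet> w \<le> L * (s * l1norm w) * l1norm w"
        by (intro order_trans [OF inner_le_infnorm_l1norm] mult_right_mono) auto
      then show ?thesis by (simp add: inner_diff_left power2_eq_square algebra_simps)
    qed
    ultimately show "\<exists>y. (\<psi> has_real_derivative y) (at s) \<and> y \<le> 0" by blast
  qed simp
  then show ?thesis by (simp add: \<psi>_def w_def)
qed

section \<open>Independence\<close>

text \<open>Integrates out \<open>U\<close> with the rest frozen. The first argument of
  \<open>g\<close> is the outcome itself, seen through the sigma-algebra generated by
  \<open>V\<close>, so functions of the past can be inserted without factoring them through
  \<open>V\<close>.\<close>

lemma (in prob_space) nn_integral_indep_rv:
  assumes ind: "indep_rv N U N' V"
    and g: "(\<lambda>(\<omega>, z). g \<omega> z) \<in> borel_measurable (vimage_algebra (space M) V N' \<Otimes>\<^sub>M N)"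
  shows "(\<integral>\<^sup>+\<omega>. g \<omega> (U \<omega>) \<partial>M) = (\<integral>\<^sup>+\<omega>. \<integral>\<^sup>+z. g \<omega> z \<partial>distr M N U \<partial>M)"
proof -
  have [measurable]: "U \<in> M \<rightarrow>\<^sub>M N" "V \<in> M \<rightarrow>\<^sub>M N'" using ind by (auto simp: indep_rv_def)
  define A where "A = vimage_algebra (space M) V N'"
  have id: "(\<lambda>\<omega>. \<omega>) \<in> M \<rightarrow>\<^sub>M A"
    unfolding A_def by (intro measurable_vimage_algebra2) auto
  have sA: "space A = space M" "sets A = {V -` B \<inter> space M | B. B \<in> sets N'}"
    unfolding A_def using measurable_space [of V M N'] by (simp, subst sets_vimage_algebra2) auto
  interpret A: prob_space "distr M A (\<lambda>\<omega>. \<omega>)" using id by (rule prob_space_distr)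
  interpret U: prob_space "distr M N U" by (rule prob_space_distr) simp
  have pair: "(\<lambda>\<omega>. (\<omega>, U \<omega>)) \<in> M \<rightarrow>\<^sub>M A \<Otimes>\<^sub>M N"
    using id by (rule measurable_Pair) simp
  \<comment> \<open>Sets of the first factor are preimages under \<open>V\<close>, so agreement of
    the two measures on rectangles is precisely independence.\<close>
  have eq: "distr M A (\<lambda>\<omega>. \<omega>) \<Otimes>\<^sub>M distr M N U = distr M (A \<Otimes>\<^sub>M N) (\<lambda>\<omega>. (\<omega>, U \<omega>))"
  proof (rule pair_measure_eqI)
    fix a b assume a: "a \<in> sets (distr M A (\<lambda>\<omega>. \<omega>))" and b: "b \<in> sets (distr M N U)"
    then obtain B where B: "B \<in> sets N'" "a = V -` B \<inter> space M" by (auto simp: sA)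
    have "prob ((U -` b \<inter> space M) \<inter> a) = prob (U -` b \<inter> space M) * prob a"
      using ind b B unfolding indep_rv_def by (intro indep_setD) auto
    moreover have "(\<lambda>\<omega>. (\<omega>, U \<omega>)) -` (a \<times> b) \<inter> space M = (U -` b \<inter> space M) \<inter> a" using B by auto
    moreover have "(\<lambda>\<omega>. \<omega>) -` a \<inter> space M = a" using B by auto
    ultimately show "emeasure (distr M A (\<lambda>\<omega>. \<omega>)) a * emeasure (distr M N U) b
      = emeasure (distr M (A \<Otimes>\<^sub>M N) (\<lambda>\<omega>. (\<omega>, U \<omega>))) (a \<times> b)"
      using a b by (simp add: emeasure_distr id pair emeasure_eq_measure mult.commute flip: ennreal_mult)
  qed (auto intro: A.sigma_finite_measure_axioms U.sigma_finite_measure_axioms cong: sets_pair_measure_cong)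
  have "(\<integral>\<^sup>+\<omega>. g \<omega> (U \<omega>) \<partial>M) = (\<integral>\<^sup>+p. (case p of (\<omega>, z) \<Rightarrow> g \<omega> z) \<partial>distr M (A \<Otimes>\<^sub>M N) (\<lambda>\<omega>. (\<omega>, U \<omega>)))"
    using g pair by (subst nn_integral_distr) (auto simp: A_def)
  also have "\<dots> = (\<integral>\<^sup>+\<omega>. \<integral>\<^sup>+z. g \<omega> z \<partial>distr M N U \<partial>distr M A (\<lambda>\<omega>. \<omega>))"
    unfolding eq [symmetric] using g by (subst U.nn_integral_fst [symmetric]) (auto simp: A_def)
  also have "\<dots> = (\<integral>\<^sup>+\<omega>. \<integral>\<^sup>+z. g \<omega> z \<partial>distr M N U \<partial>M)"
  proof -
    have "(\<lambda>(\<omega>, z). g \<omega> z) \<in> borel_measurable (A \<Otimes>\<^sub>M distr M N U)"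
      using g by (simp add: A_def cong: measurable_cong_sets)
    then have "(\<lambda>\<omega>. \<integral>\<^sup>+z. g \<omega> z \<partial>distr M N U) \<in> borel_measurable A"
      by (rule U.borel_measurable_nn_integral)
    then show ?thesis by (simp add: nn_integral_distr id)
  qed
  finally show ?thesis .
qed

text \<open>Two independences combine: the samples among each other, and the starting point against
  the whole family. On rectangles the probability of the event of \<open>x\<close> splits off first
  and that of the fresh sample next; the pi-lambda theorem extends this to the product
  sigma-algebra.\<close>

lemma (in prob_space) indep_rv_fresh_sample:
  fixes \<zeta> :: "nat \<Rightarrow> nat \<Rightarrow> 'a \<Rightarrow> 'z"
  assumes samples: "indep_vars (\<lambda>_. P) (\<lambda>(k, i). \<zeta> k i) J"
    and x: "indep_rv N x (Pi\<^sub>M J (\<lambda>_. P)) (sample_family J \<zeta>)"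
    and I: "I \<subseteq> J" and j: "(k, i) \<in> J - I"
  shows "indep_rv P (\<zeta> k i) (N \<Otimes>\<^sub>M Pi\<^sub>M I (\<lambda>_. P)) (\<lambda>\<omega>. (x \<omega>, sample_family I \<zeta> \<omega>))"
proof -
  let ?F = "Pi\<^sub>M I (\<lambda>_. P)"
  have [measurable]: "x \<in> M \<rightarrow>\<^sub>M N" "sample_family J \<zeta> \<in> M \<rightarrow>\<^sub>M Pi\<^sub>M J (\<lambda>_. P)"
    using x by (auto simp: indep_rv_def)
  have proj: "sample_family I \<zeta> \<omega> = restrict (sample_family J \<zeta> \<omega>) I" for \<omega>
    using I by (auto simp: sample_family_def restrict_def fun_eq_iff subset_iff)
  have rI: "(\<lambda>w. restrict w I) \<in> Pi\<^sub>M J (\<lambda>_. P) \<rightarrow>\<^sub>M ?F" using I by (rule measurable_restrict_subset)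
  have famI [measurable]: "sample_family I \<zeta> \<in> M \<rightarrow>\<^sub>M ?F"
    using measurable_compose [OF _ rI, of "sample_family J \<zeta>" M] by (simp add: proj [abs_def])
  have \<zeta>_eq: "\<zeta> k i \<omega> = sample_family J \<zeta> \<omega> (k, i)" for \<omega>
    using j by (simp add: sample_family_def)
  have pj: "(\<lambda>w. w (k, i)) \<in> Pi\<^sub>M J (\<lambda>_. P) \<rightarrow>\<^sub>M P" using j by (intro measurable_component_singleton) simp
  have \<zeta>m [measurable]: "\<zeta> k i \<in> M \<rightarrow>\<^sub>M P"
    using measurable_compose [OF _ pj, of "sample_family J \<zeta>" M] by (simp add: \<zeta>_eq [abs_def])
  have xJ: "prob ((x -` A \<inter> space M) \<inter> (sample_family J \<zeta> -` B \<inter> space M))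
     = prob (x -` A \<inter> space M) * prob (sample_family J \<zeta> -` B \<inter> space M)"
    if "A \<in> sets N" "B \<in> sets (Pi\<^sub>M J (\<lambda>_. P))" for A B
    using x that unfolding indep_rv_def by (intro indep_setD) auto
  have \<zeta>I: "prob ((\<zeta> k i -` C \<inter> space M) \<inter> (sample_family I \<zeta> -` B \<inter> space M))
     = prob (\<zeta> k i -` C \<inter> space M) * prob (sample_family I \<zeta> -` B \<inter> space M)"
    if C: "C \<in> sets P" and B: "B \<in> sets ?F" for B C
  proof -
    have "indep_var (Pi\<^sub>M {(k, i)} (\<lambda>_. P)) (\<lambda>\<omega>. restrict (\<lambda>j. (case j of (k, i) \<Rightarrow> \<zeta> k i) \<omega>) {(k, i)})
       ?F (\<lambda>\<omega>. restrict (\<lambda>j. (case j of (k, i) \<Rightarrow> \<zeta> k i) \<omega>) I)"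
      using samples by (rule indep_var_restrict) (use I j in auto)
    moreover have "(\<lambda>\<omega>. restrict (\<lambda>j. (case j of (k, i) \<Rightarrow> \<zeta> k i) \<omega>) I) = sample_family I \<zeta>"
      by (auto simp: sample_family_def restrict_def case_prod_beta')
    ultimately have iv: "indep_var (Pi\<^sub>M {(k, i)} (\<lambda>_. P)) (\<lambda>\<omega>. restrict (\<lambda>j. (case j of (k, i) \<Rightarrow> \<zeta> k i) \<omega>) {(k, i)})
       ?F (sample_family I \<zeta>)" by simp
    let ?C = "(\<lambda>w. w (k, i)) -` C \<inter> space (Pi\<^sub>M {(k, i)} (\<lambda>_. P))"
    have C': "?C \<in> sets (Pi\<^sub>M {(k, i)} (\<lambda>_. P))"
      using C by (intro measurable_sets [OF measurable_component_singleton]) auto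
    from indep_varD [OF iv C' B]
    have "prob ((\<lambda>\<omega>. (restrict (\<lambda>j. (case j of (k, i) \<Rightarrow> \<zeta> k i) \<omega>) {(k, i)}, sample_family I \<zeta> \<omega>)) -` (?C \<times> B) \<inter> space M)
      = prob ((\<lambda>\<omega>. restrict (\<lambda>j. (case j of (k, i) \<Rightarrow> \<zeta> k i) \<omega>) {(k, i)}) -` ?C \<inter> space M)
        * prob (sample_family I \<zeta> -` B \<inter> space M)" .
    moreover have "(\<lambda>\<omega>. restrict (\<lambda>j. (case j of (k, i) \<Rightarrow> \<zeta> k i) \<omega>) {(k, i)}) -` ?C \<inter> space M = \<zeta> k i -` C \<inter> space M"
      using measurable_space [OF \<zeta>m] by (auto simp: space_PiM PiE_def extensional_def)
    moreover have "(\<lambda>\<omega>. (restrict (\<lambda>j. (case j of (k, i) \<Rightarrow> \<zeta> k i) \<omega>) {(k, i)}, sample_family I \<zeta> \<omega>)) -` (?C \<times> B) \<inter> space M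
      = (\<zeta> k i -` C \<inter> space M) \<inter> (sample_family I \<zeta> -` B \<inter> space M)"
      using measurable_space [OF \<zeta>m] by (auto simp: space_PiM PiE_def extensional_def)
    ultimately show ?thesis by simp
  qed
  let ?V = "\<lambda>\<omega>. (x \<omega>, sample_family I \<zeta> \<omega>)"
  let ?R = "{A \<times> B | A B. A \<in> sets N \<and> B \<in> sets ?F}"
  let ?G = "{?V -` R \<inter> space M | R. R \<in> ?R}"
  let ?H = "{\<zeta> k i -` C \<inter> space M | C. C \<in> sets P}"
  have "indep_set ?H ?G"
    unfolding indep_set_def
  proof (rule indep_setI [unfolded indep_set_def])
    show "?H \<subseteq> events" by auto
    show "?G \<subseteq> events" by auto
    fix a b assume "a \<in> ?H" "b \<in> ?G"
    then obtain A B C where a: "a = \<zeta> k i -` C \<inter> space M" "C \<in> sets P"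
      and b: "b = ?V -` (A \<times> B) \<inter> space M" "A \<in> sets N" "B \<in> sets ?F" by blast
    \<comment> \<open>Both sample events are rewritten as events of the family over
      \<open>J\<close>, the form in which independence from \<open>x\<close> is available.\<close>
    let ?B = "(\<lambda>w. restrict w I) -` B \<inter> space (Pi\<^sub>M J (\<lambda>_. P))"
    let ?C = "(\<lambda>w. w (k, i)) -` C \<inter> space (Pi\<^sub>M J (\<lambda>_. P))"
    have m: "?B \<in> sets (Pi\<^sub>M J (\<lambda>_. P))" "?C \<in> sets (Pi\<^sub>M J (\<lambda>_. P))"
      using measurable_sets [OF rI b(3)] measurable_sets [OF pj a(2)] by auto
    have fs: "sample_family J \<zeta> \<omega> \<in> space (Pi\<^sub>M J (\<lambda>_. P))" if "\<omega> \<in> space M" for \<omega>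
      using that by (rule measurable_space [rotated]) simp
    have B_eq: "sample_family J \<zeta> -` ?B \<inter> space M = sample_family I \<zeta> -` B \<inter> space M"
      using fs by (auto simp: proj)
    have BC_eq: "sample_family J \<zeta> -` (?C \<inter> ?B) \<inter> space M
      = (\<zeta> k i -` C \<inter> space M) \<inter> (sample_family I \<zeta> -` B \<inter> space M)"
      using fs by (auto simp: proj \<zeta>_eq)
    have "prob (a \<inter> b) = prob ((x -` A \<inter> space M) \<inter> (sample_family J \<zeta> -` (?C \<inter> ?B) \<inter> space M))"
      unfolding BC_eq a b by (rule arg_cong [where f = prob]) auto
    also have "\<dots> = prob (x -` A \<inter> space M) * prob (sample_family J \<zeta> -` (?C \<inter> ?B) \<inter> space M)"
      by (rule xJ [OF b(2) sets.Int [OF m(2,1)]])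
    also have "\<dots> = prob a * (prob (x -` A \<inter> space M) * prob (sample_family J \<zeta> -` ?B \<inter> space M))"
      unfolding BC_eq B_eq a \<zeta>I [OF a(2) b(3)] by (simp only: mult.left_commute)
    also have "\<dots> = prob a * prob ((x -` A \<inter> space M) \<inter> (sample_family J \<zeta> -` ?B \<inter> space M))"
      by (simp only: xJ [OF b(2) m(1)])
    also have "(x -` A \<inter> space M) \<inter> (sample_family J \<zeta> -` ?B \<inter> space M) = b"
      unfolding B_eq b by auto
    finally show "prob (a \<inter> b) = prob a * prob b" .
  qed
  moreover have "Int_stable ?H"
    unfolding Setcompr_eq_image
  proof (rule Int_stableI_image)
    fix C D assume "C \<in> sets P" "D \<in> sets P"
    then show "\<exists>E\<in>sets P. (\<zeta> k i -` C \<inter> space M) \<inter> (\<zeta> k i -` D \<inter> space M) = \<zeta> k i -` E \<inter> space M"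
      by (intro bexI [of _ "C \<inter> D"]) auto
  qed
  moreover have "Int_stable ?G"
    unfolding Setcompr_eq_image
  proof (rule Int_stableI_image)
    fix C D assume "C \<in> ?R" "D \<in> ?R"
    then have "C \<inter> D \<in> ?R" by (rule Int_stableD [OF Int_stable_pair_measure_generator])
    moreover have "(?V -` C \<inter> space M) \<inter> (?V -` D \<inter> space M) = ?V -` (C \<inter> D) \<inter> space M" by blast
    ultimately show "\<exists>E\<in>?R. (?V -` C \<inter> space M) \<inter> (?V -` D \<inter> space M) = ?V -` E \<inter> space M"
      by (rule bexI [rotated])
  qed
  ultimately have "indep_set (sigma_sets (space M) ?H) (sigma_sets (space M) ?G)"
    by (rule indep_set_sigma_sets)
  moreover have "sigma_sets (space M) ?H = ?H"
    using sigma_sets_vimage_commute [of "\<zeta> k i" "space M" "space P" "sets P"] measurable_space [OF \<zeta>m]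
    by (simp add: sets.sigma_sets_eq)
  moreover have "sigma_sets (space M) ?G = {?V -` R \<inter> space M | R. R \<in> sets (N \<Otimes>\<^sub>M ?F)}"
    unfolding sets_pair_measure
    by (rule sigma_sets_vimage_commute [symmetric])
      (use measurable_space [of x M N] measurable_space [OF famI] in auto)
  ultimately show ?thesis unfolding indep_rv_def by auto
qed

section \<open>The variance-reduced method\<close>

locale vr_prox_method = prob_space M + P: prob_space P
  for M :: "'w measure" and P :: "'z measure" +
  fixes X :: "(real ^ 'n) set"
    and F :: "real ^ 'n \<Rightarrow> 'z \<Rightarrow> real"
    and gF :: "real ^ 'n \<Rightarrow> 'z \<Rightarrow> real ^ 'n"
    and f :: "real ^ 'n \<Rightarrow> real"
    and gf :: "real ^ 'n \<Rightarrow> real ^ 'n"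
    and x G :: "nat \<Rightarrow> 'w \<Rightarrow> real ^ 'n"
    and \<zeta> :: "nat \<Rightarrow> nat \<Rightarrow> 'w \<Rightarrow> 'z"
    and L f_low \<sigma>2 \<rho> \<eta> :: real
    and K q\<^sub>0 m\<^sub>1 m :: nat
    and J :: "(nat \<times> nat) set"
  assumes X: "closed X" "convex X"
    and F: "\<And>u. F u \<in> borel_measurable P"
    and gf: "\<And>u. GDERIV f u :> gf u"
    and gF: "\<And>u z. z \<in> space P \<Longrightarrow> GDERIV (\<lambda>y. F y z) u :> gF u z"
    and unbiased: "\<And>u. u \<in> X \<Longrightarrow> has_bochner_integral P (gF u) (gf u)"
    and variance: "\<And>u. u \<in> X \<Longrightarrow> (\<integral>\<^sup>+z. ennreal ((infnorm (gF u z - gf u))\<^sup>2) \<partial>P) \<le> ennreal \<sigma>2"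
      "\<sigma>2 \<ge> 0"
    and L: "L \<ge> 0"
    and smooth: "\<And>u v. u \<in> X \<Longrightarrow> v \<in> X \<Longrightarrow>
        (\<integral>\<^sup>+z. ennreal ((infnorm (gF u z - gF v z))\<^sup>2) \<partial>P) \<le> ennreal (L\<^sup>2 * (l1norm (u - v))\<^sup>2)"
    and lower: "\<And>u. u \<in> X \<Longrightarrow> f_low \<le> f u"
    and params: "K \<ge> 1" "q\<^sub>0 \<ge> 1" "m\<^sub>1 \<ge> 1" "m \<ge> 1" "\<rho> > 0" "\<eta> > 0"
    and J: "J = sample_idx K (batch_size q\<^sub>0 m\<^sub>1 m)"
    and samples: "indep_vars (\<lambda>_. P) (\<lambda>(k, i). \<zeta> k i) J"
      "\<And>k i. (k, i) \<in> J \<Longrightarrow> distr M P (\<zeta> k i) = P"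
    and start: "\<And>\<omega>. \<omega> \<in> space M \<Longrightarrow> x 1 \<omega> \<in> X"
      "integrable M (\<lambda>\<omega>. f (x 1 \<omega>))"
      "indep_rv borel (x 1) (Pi\<^sub>M J (\<lambda>_. P)) (sample_family J \<zeta>)"
    and estimate: "\<And>k \<omega>. k \<in> {1..K} \<Longrightarrow> \<omega> \<in> space M \<Longrightarrow>
        vr_estimate gF q\<^sub>0 m\<^sub>1 m (\<lambda>j. x j \<omega>) (\<lambda>j i. \<zeta> j i \<omega>) (\<lambda>j. G j \<omega>) k"
    and update: "\<And>k \<omega>. k \<in> {1..K} \<Longrightarrow> \<omega> \<in> space M \<Longrightarrow>
        prox_step X (\<lambda>z. \<rho> / 2 * (l1norm z)\<^sup>2) \<eta> (x k \<omega>) (G k \<omega>) (x (k + 1) \<omega>)"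
begin

text \<open>\<open>past I\<close> is the information carried by the starting point and the samples with index in \<open>I\<close>.\<close>

definition past :: "(nat \<times> nat) set \<Rightarrow> 'w measure" where
  "past I = vimage_algebra (space M) (\<lambda>\<omega>. (x 1 \<omega>, sample_family I \<zeta> \<omega>)) (borel \<Otimes>\<^sub>M Pi\<^sub>M I (\<lambda>_. P))"

text \<open>Lexicographic initial segment of the samples. Batches are numbered from 1, so
  \<open>upto k 0\<close> holds the samples drawn strictly before iteration
  \<open>k\<close>.\<close>

definition upto :: "nat \<Rightarrow> nat \<Rightarrow> (nat \<times> nat) set" where
  "upto k i = {(k', i') \<in> J. k' < k \<or> k' = k \<and> i' \<le> i}"

definition err :: "nat \<Rightarrow> 'w \<Rightarrow> real ^ 'n" where
  "err k \<omega> = G k \<omega> - gf (x k \<omega>)"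

definition step :: "nat \<Rightarrow> 'w \<Rightarrow> real ^ 'n" where
  "step k \<omega> = x (k + 1) \<omega> - x k \<omega>"

section \<open>Measurability with respect to the past\<close>

lemma upto_subset: "upto k i \<subseteq> J" by (auto simp: upto_def)

lemma upto_mono: "k < k' \<or> k = k' \<and> i \<le> i' \<Longrightarrow> upto k i \<subseteq> upto k' i'"
  by (auto simp: upto_def)

lemma in_J_iff: "(k, i) \<in> J \<longleftrightarrow> k \<in> {1..K} \<and> i \<in> {1..batch_size q\<^sub>0 m\<^sub>1 m k}"
  by (auto simp: J sample_idx_def)

lemma space_past [simp]: "space (past I) = space M"
  by (simp add: past_def)

lemma sample_measurable: "(k, i) \<in> J \<Longrightarrow> \<zeta> k i \<in> M \<rightarrow>\<^sub>M P"
  using samples(1) by (auto simp: indep_vars_def)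

lemma sample_family_measurable:
  assumes "I \<subseteq> J" shows "sample_family I \<zeta> \<in> M \<rightarrow>\<^sub>M Pi\<^sub>M I (\<lambda>_. P)"
  unfolding sample_family_def using assms sample_measurable
  by (intro measurable_restrict) (auto simp: subset_iff)

lemma x1_measurable: "x 1 \<in> borel_measurable M"
  using start(3) by (simp add: indep_rv_def)

lemma past_data_measurable:
  assumes "I \<subseteq> J"
  shows "(\<lambda>\<omega>. (x 1 \<omega>, sample_family I \<zeta> \<omega>)) \<in> past I \<rightarrow>\<^sub>M borel \<Otimes>\<^sub>M Pi\<^sub>M I (\<lambda>_. P)"
  unfolding past_def using measurable_space [OF sample_family_measurable [OF assms]]
  by (intro measurable_vimage_algebra1) (auto simp: space_pair_measure)

lemma past_x1: "I \<subseteq> J \<Longrightarrow> x 1 \<in> past I \<rightarrow>\<^sub>M borel"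
  using measurable_compose [OF past_data_measurable measurable_fst] by simp

lemma past_family: "I \<subseteq> J \<Longrightarrow> sample_family I \<zeta> \<in> past I \<rightarrow>\<^sub>M Pi\<^sub>M I (\<lambda>_. P)"
  using measurable_compose [OF past_data_measurable measurable_snd] by simp

lemma past_sample:
  assumes "I \<subseteq> J" "(k, i) \<in> I"
  shows "\<zeta> k i \<in> past I \<rightarrow>\<^sub>M P"
proof -
  have "(\<lambda>\<omega>. sample_family I \<zeta> \<omega> (k, i)) \<in> past I \<rightarrow>\<^sub>M P"
    using assms by (intro measurable_compose [OF past_family measurable_component_singleton]) auto
  then show ?thesis using assms by (simp add: sample_family_def)
qed

lemma past_mono:
  assumes "h \<in> past I \<rightarrow>\<^sub>M N" "I \<subseteq> I'" "I' \<subseteq> J"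
  shows "h \<in> past I' \<rightarrow>\<^sub>M N"
proof -
  have restrict: "sample_family I \<zeta> \<omega> = restrict (sample_family I' \<zeta> \<omega>) I" for \<omega>
    using assms by (auto simp: sample_family_def restrict_def fun_eq_iff subset_iff)
  have "sample_family I \<zeta> \<in> past I' \<rightarrow>\<^sub>M Pi\<^sub>M I (\<lambda>_. P)"
    using measurable_compose [OF past_family measurable_restrict_subset, OF assms(3,2)]
    by (simp add: restrict [abs_def])
  then have "(\<lambda>\<omega>. \<omega>) \<in> past I' \<rightarrow>\<^sub>M past I"
    unfolding past_def [of I]
    by (intro measurable_vimage_algebra2 measurable_Pair past_x1 assms(3)) auto
  from measurable_compose [OF this assms(1)] show ?thesis by simp
qed

lemma past_subset:
  assumes "h \<in> past I \<rightarrow>\<^sub>M N" "I \<subseteq> J"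
  shows "h \<in> M \<rightarrow>\<^sub>M N"
proof -
  have "(\<lambda>\<omega>. \<omega>) \<in> M \<rightarrow>\<^sub>M past I"
    unfolding past_def
    by (intro measurable_vimage_algebra2 measurable_Pair x1_measurable sample_family_measurable assms(2)) auto
  from measurable_compose [OF this assms(1)] show ?thesis by simp
qed

section \<open>Regularity of the gradients and adaptedness of the iterates\<close>

lemma gF_measurable: "(\<lambda>(u, z). gF u z) \<in> borel_measurable (borel \<Otimes>\<^sub>M P)"
  using F gF by (rule measurable_parametric_gradient)

lemma gF_compose:
  assumes "h \<in> borel_measurable N" "w \<in> N \<rightarrow>\<^sub>M P"
  shows "(\<lambda>\<omega>. gF (h \<omega>) (w \<omega>)) \<in> borel_measurable N"
  using measurable_compose [OF measurable_Pair [OF assms] gF_measurable] by simp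

text \<open>The Lipschitz bound for \<open>gf\<close> concerns points of \<open>X\<close>; on the
  whole space measurability comes from difference quotients of \<open>f\<close>, with a one-point
  parameter space.\<close>

lemma gf_measurable: "gf \<in> borel_measurable borel"
proof -
  have f: "f \<in> borel_measurable borel"
    by (rule borel_measurable_continuous_onI) (rule GDERIV_imp_continuous_on, rule gf)
  have "(\<lambda>(u, z). gf u) \<in> borel_measurable (borel \<Otimes>\<^sub>M count_space {()})"
    by (rule measurable_parametric_gradient [where F = "\<lambda>u z. f u"]) (use gf in auto)
  moreover have "(\<lambda>u. (u, ())) \<in> borel \<rightarrow>\<^sub>M borel \<Otimes>\<^sub>M count_space {()}"
    by (intro measurable_Pair) auto
  ultimately show ?thesis using measurable_compose by fastforce
qed

text \<open>Jensen transfers the mean-square smoothness of the samples to their mean, with the same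
  constant.\<close>

lemma gf_lipschitz:
  assumes u: "u \<in> X" and v: "v \<in> X"
  shows "infnorm (gf u - gf v) \<le> L * l1norm (u - v)"
proof -
  have "has_bochner_integral P (\<lambda>z. gF u z - gF v z) (gf u - gf v)"
    using unbiased u v by (intro has_bochner_integral_diff) auto
  then have "ennreal ((infnorm (gf u - gf v))\<^sup>2) \<le> (\<integral>\<^sup>+z. ennreal ((infnorm (gF u z - gF v z))\<^sup>2) \<partial>P)"
    using P.infnorm_expectation_sq_le [of "\<lambda>z. gF u z - gF v z"] by (auto simp: has_bochner_integral_iff)
  also have "\<dots> \<le> ennreal ((L * l1norm (u - v))\<^sup>2)"
    using smooth [OF u v] by (simp add: power_mult_distrib)
  finally have "(infnorm (gf u - gf v))\<^sup>2 \<le> (L * l1norm (u - v))\<^sup>2" by (simp add: ennreal_le_iff)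
  then show ?thesis by (rule power2_le_imp_le) (use L in auto)
qed

lemma gf_continuous_on: "continuous_on X gf"
proof (rule continuous_on_sequentiallyI)
  fix u a assume u: "\<forall>n. u n \<in> X" "a \<in> X" "u \<longlonglongrightarrow> a"
  let ?D = "real CARD('n)"
  have "(\<lambda>n. sqrt ?D * (L * (?D * norm (u n - a)))) \<longlonglongrightarrow> sqrt ?D * (L * (?D * norm (a - a)))"
    by (intro tendsto_intros u)
  then have lim: "(\<lambda>n. sqrt ?D * (L * (?D * norm (u n - a)))) \<longlonglongrightarrow> 0" by simp
  have "norm (gf (u n) - gf a) \<le> sqrt ?D * (L * (?D * norm (u n - a)))" for n
  proof -
    have "norm (gf (u n) - gf a) \<le> sqrt ?D * infnorm (gf (u n) - gf a)"
      using norm_le_infnorm [of "gf (u n) - gf a"] by simp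
    also have "\<dots> \<le> sqrt ?D * (L * (?D * norm (u n - a)))"
      using gf_lipschitz [of "u n" a] u mult_left_mono [OF l1norm_le_norm [of "u n - a"] L]
      by (intro mult_left_mono) auto
    finally show ?thesis .
  qed
  then have "(\<lambda>n. gf (u n) - gf a) \<longlonglongrightarrow> 0"
    by (intro Lim_null_comparison [OF _ lim]) auto
  then show "(\<lambda>n. gf (u n)) \<longlonglongrightarrow> gf a" by (rule LIM_zero_cancel)
qed

lemma x_in_X: "\<omega> \<in> space M \<Longrightarrow> k \<in> {1..K + 1} \<Longrightarrow> x k \<omega> \<in> X"
proof (cases "k = 1")
  case False
  assume \<omega>: "\<omega> \<in> space M" and k: "k \<in> {1..K + 1}"
  obtain j where "k = j + 1" "j \<in> {1..K}"
    using False k by (intro that [of "k - 1"]) auto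
  then show ?thesis using update [OF _ \<omega>, THEN prox_step_in] by simp
qed (use start in auto)

lemma not_restart_gt_1: "\<not> restart q\<^sub>0 k \<Longrightarrow> k \<ge> 1 \<Longrightarrow> k > 1"
  by (cases "k = 1") (auto simp: restart_def)

text \<open>\<open>G (k - 1)\<close> is part of the claim because the recursive estimate refers to
  its predecessor, and the induction is strong because that estimate involves two consecutive
  iterates. The new iterate follows by measurability of the proximal step.\<close>

lemma iterates_measurable:
  assumes "k \<in> {1..K + 1}"
  shows "x k \<in> borel_measurable (past (upto k 0)) \<and>
    (k > 1 \<longrightarrow> G (k - 1) \<in> borel_measurable (past (upto k 0)))"
  using assms
proof (induction k rule: less_induct)
  case (less k)
  show ?case
  proof (cases "k = 1")
    case True
    then show ?thesis using past_x1 [OF upto_subset] by simp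
  next
    case False
    define j where "j = k - 1"
    have j: "k = j + 1" "j \<in> {1..K}" using False less.prems by (auto simp: j_def)
    have sub: "upto i 0 \<subseteq> upto k 0" if "i \<le> k" for i using that by (intro upto_mono) auto
    have xm: "x i \<in> borel_measurable (past (upto k 0))" if "i < k" "i \<ge> 1" for i
      using less.IH [of i] that less.prems sub [of i] by (auto intro!: past_mono [OF _ _ upto_subset])
    have Gm: "G (j - 1) \<in> borel_measurable (past (upto k 0))" if "j > 1"
      using less.IH [of j] that j sub [of j] by (auto intro!: past_mono [OF _ _ upto_subset])
    define b where "b = batch_size q\<^sub>0 m\<^sub>1 m j"
    have zm: "\<zeta> j i \<in> past (upto k 0) \<rightarrow>\<^sub>M P" if "i \<in> {1..b}" for i
      using that j by (intro past_sample upto_subset) (auto simp: upto_def in_J_iff b_def)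
    have "G j \<in> borel_measurable (past (upto k 0))"
    proof (cases "restart q\<^sub>0 j")
      case True
      have "(\<lambda>\<omega>. (1 / real b) *\<^sub>R (\<Sum>i=1..b. gF (x j \<omega>) (\<zeta> j i \<omega>))) \<in> borel_measurable (past (upto k 0))"
        using j by (intro borel_measurable_scaleR borel_measurable_const borel_measurable_sum gF_compose xm zm) auto
      then show ?thesis
        by (rule measurable_cong [THEN iffD1, rotated])
          (use estimate [OF j(2)] True in \<open>simp add: vr_estimate_def Let_def b_def\<close>)
    next
      case False
      then have j1: "j > 1" using j not_restart_gt_1 by auto
      have "(\<lambda>\<omega>. (1 / real b) *\<^sub>R (\<Sum>i=1..b. gF (x j \<omega>) (\<zeta> j i \<omega>) - gF (x (j - 1) \<omega>) (\<zeta> j i \<omega>)) + G (j - 1) \<omega>)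
        \<in> borel_measurable (past (upto k 0))"
        using j j1 by (intro borel_measurable_add borel_measurable_scaleR borel_measurable_const
            borel_measurable_sum borel_measurable_diff gF_compose xm zm Gm) auto
      then show ?thesis
        by (rule measurable_cong [THEN iffD1, rotated])
          (use estimate [OF j(2)] False in \<open>simp add: vr_estimate_def Let_def b_def\<close>)
    qed
    moreover have "x k \<in> borel_measurable (past (upto k 0))"
    proof (rule borel_measurable_l1_prox)
      show "x j \<in> borel_measurable (past (upto k 0))" using j by (intro xm) auto
      show "G j \<in> borel_measurable (past (upto k 0))" by fact
      show "prox_step X (\<lambda>z. \<rho> / 2 * (l1norm z)\<^sup>2) \<eta> (x j \<omega>) (G j \<omega>) (x k \<omega>)"
        if "\<omega> \<in> space (past (upto k 0))" for \<omega> using update [OF j(2)] that j by simp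
    qed (use X params in auto)
    ultimately show ?thesis by (simp add: j_def)
  qed
qed

lemma x_measurable:
  assumes "k \<in> {1..K + 1}" "upto k 0 \<subseteq> I" "I \<subseteq> J"
  shows "x k \<in> borel_measurable (past I)"
  using past_mono iterates_measurable assms by blast

lemma err_measurable:
  assumes "k \<in> {1..K}" "upto (k + 1) 0 \<subseteq> I" "I \<subseteq> J"
  shows "err k \<in> borel_measurable (past I)"
proof -
  have "G k \<in> borel_measurable (past I)"
    using iterates_measurable [of "k + 1"] assms by (auto intro: past_mono)
  moreover have "x k \<in> borel_measurable (past I)"
    using assms upto_mono [of k "k + 1" 0 0] by (intro x_measurable) auto
  ultimately show ?thesis unfolding err_def [abs_def]
    by (intro borel_measurable_diff measurable_compose [OF _ gf_measurable])
qed

lemma step_measurable: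
  assumes "k \<in> {1..K}" "upto (k + 1) 0 \<subseteq> I" "I \<subseteq> J"
  shows "step k \<in> borel_measurable (past I)"
  unfolding step_def [abs_def] using assms upto_mono [of k "k + 1" 0 0]
  by (intro borel_measurable_diff x_measurable) auto

lemma step_borel: "k \<in> {1..K} \<Longrightarrow> step k \<in> borel_measurable M"
  by (rule past_subset [OF step_measurable [OF _ upto_subset order_refl] order_refl])

lemma err_borel: "k \<in> {1..K} \<Longrightarrow> err k \<in> borel_measurable M"
  by (rule past_subset [OF err_measurable [OF _ upto_subset order_refl] order_refl])

subsection \<open>The estimation error\<close>

context
  fixes q :: nat and e C :: real
  assumes q: "q \<ge> 1" and e: "e > 0"
    and C_def: "C = (2 * real q - 1) * real CARD('n) powr (1 / real q)"
begin

abbreviation (input) "h \<equiv> pnorm_sq q e :: real ^ 'n \<Rightarrow> real"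
lemma C_nonneg: "C \<ge> 0"
  using q unfolding C_def by (intro mult_nonneg_nonneg) auto

lemma h_compose: "g \<in> borel_measurable N \<Longrightarrow> (\<lambda>\<omega>. ennreal (h (g \<omega>))) \<in> borel_measurable N"
  by (intro measurable_compose [OF _ measurable_ennreal]
      borel_measurable_continuous_on [OF continuous_on_pnorm_sq [OF e]])

text \<open>One sample is added at a time. It is independent of \<open>past (upto k i)\<close>,
  which determines the partial sum and the function \<open>D\<close>, so integrating it out raises
  the potential by at most \<open>C * V\<close>. Measurability is part of the claim since the next
  sample needs it.\<close>

lemma batch_potential:
  fixes D :: "'w \<Rightarrow> 'z \<Rightarrow> real ^ 'n"
  assumes k: "k \<in> {1..K}" and i: "i \<le> batch_size q\<^sub>0 m\<^sub>1 m k"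
    and S: "S \<in> borel_measurable (past (upto k 0))"
    and D: "(\<lambda>(\<omega>, z). D \<omega> z) \<in> borel_measurable (past (upto k 0) \<Otimes>\<^sub>M P)"
    and D0: "\<And>\<omega>. \<omega> \<in> space M \<Longrightarrow> has_bochner_integral P (D \<omega>) 0"
    and V: "\<And>\<omega>. \<omega> \<in> space M \<Longrightarrow> (\<integral>\<^sup>+z. ennreal ((infnorm (D \<omega> z))\<^sup>2) \<partial>P) \<le> V \<omega>"
    and Vm: "V \<in> borel_measurable M"
  shows "(\<lambda>\<omega>. S \<omega> + (\<Sum>j=1..i. D \<omega> (\<zeta> k j \<omega>))) \<in> borel_measurable (past (upto k i)) \<and>
    (\<integral>\<^sup>+\<omega>. ennreal (h (S \<omega> + (\<Sum>j=1..i. D \<omega> (\<zeta> k j \<omega>)))) \<partial>M)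
      \<le> (\<integral>\<^sup>+\<omega>. ennreal (h (S \<omega>)) \<partial>M) + of_nat i * (ennreal C * (\<integral>\<^sup>+\<omega>. V \<omega> \<partial>M))"
  using i
proof (induction i)
  case 0
  then show ?case using S by simp
next
  case (Suc i)
  define T where "T = (\<lambda>\<omega>. S \<omega> + (\<Sum>j=1..i. D \<omega> (\<zeta> k j \<omega>)))"
  have T: "T \<in> borel_measurable (past (upto k i))"
    and IH: "(\<integral>\<^sup>+\<omega>. ennreal (h (T \<omega>)) \<partial>M)
      \<le> (\<integral>\<^sup>+\<omega>. ennreal (h (S \<omega>)) \<partial>M) + of_nat i * (ennreal C * (\<integral>\<^sup>+\<omega>. V \<omega> \<partial>M))"
    using Suc by (auto simp: T_def)
  have TS: "S \<omega> + (\<Sum>j=1..Suc i. D \<omega> (\<zeta> k j \<omega>)) = T \<omega> + D \<omega> (\<zeta> k (Suc i) \<omega>)" for \<omega>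
    by (simp add: T_def)
  have kJ: "(k, Suc i) \<in> J" using k Suc.prems by (simp add: in_J_iff)
  have idm: "(\<lambda>\<omega>. \<omega>) \<in> past (upto k j) \<rightarrow>\<^sub>M past (upto k 0)" for j
    by (rule past_mono [OF _ upto_mono upto_subset]) auto
  have Dm: "(\<lambda>(\<omega>, z). D \<omega> z) \<in> borel_measurable (past (upto k j) \<Otimes>\<^sub>M P)" for j
    using measurable_compose [OF measurable_Pair [OF measurable_compose [OF measurable_fst idm] measurable_snd] D]
    by (simp add: case_prod_beta')
  have "(\<lambda>\<omega>. D \<omega> (\<zeta> k (Suc i) \<omega>)) \<in> borel_measurable (past (upto k (Suc i)))"
  proof -
    have "\<zeta> k (Suc i) \<in> past (upto k (Suc i)) \<rightarrow>\<^sub>M P"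
      using kJ by (intro past_sample upto_subset) (auto simp: upto_def)
    from measurable_compose [OF measurable_Pair [OF measurable_ident this] Dm] show ?thesis by simp
  qed
  moreover have "T \<in> borel_measurable (past (upto k (Suc i)))"
    using T by (rule past_mono [OF _ upto_mono upto_subset]) auto
  ultimately have "(\<lambda>\<omega>. T \<omega> + D \<omega> (\<zeta> k (Suc i) \<omega>)) \<in> borel_measurable (past (upto k (Suc i)))"
    by (rule borel_measurable_add [rotated])
  moreover have "(\<integral>\<^sup>+\<omega>. ennreal (h (T \<omega> + D \<omega> (\<zeta> k (Suc i) \<omega>))) \<partial>M)
      \<le> (\<integral>\<^sup>+\<omega>. ennreal (h (S \<omega>)) \<partial>M) + of_nat (Suc i) * (ennreal C * (\<integral>\<^sup>+\<omega>. V \<omega> \<partial>M))"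
  proof -
    have ind: "indep_rv P (\<zeta> k (Suc i)) (borel \<Otimes>\<^sub>M Pi\<^sub>M (upto k i) (\<lambda>_. P))
        (\<lambda>\<omega>. (x 1 \<omega>, sample_family (upto k i) \<zeta> \<omega>))"
      using kJ by (intro indep_rv_fresh_sample [OF samples(1) start(3) upto_subset]) (auto simp: upto_def)
    have "(\<lambda>p. T (fst p) + D (fst p) (snd p)) \<in> borel_measurable (past (upto k i) \<Otimes>\<^sub>M P)"
      using measurable_compose [OF measurable_fst T] Dm [of i]
      by (intro borel_measurable_add) (auto simp: case_prod_beta')
    from h_compose [OF this]
    have hm: "(\<lambda>(\<omega>, z). ennreal (h (T \<omega> + D \<omega> z))) \<in> borel_measurable (past (upto k i) \<Otimes>\<^sub>M P)"
      by (simp add: case_prod_beta')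
    have "(\<integral>\<^sup>+\<omega>. ennreal (h (T \<omega> + D \<omega> (\<zeta> k (Suc i) \<omega>))) \<partial>M)
        = (\<integral>\<^sup>+\<omega>. \<integral>\<^sup>+z. ennreal (h (T \<omega> + D \<omega> z)) \<partial>P \<partial>M)"
      using nn_integral_indep_rv [OF ind hm [unfolded past_def]] samples(2) [OF kJ] by simp
    also have "\<dots> \<le> (\<integral>\<^sup>+\<omega>. ennreal (h (T \<omega>)) + ennreal C * V \<omega> \<partial>M)"
    proof (rule nn_integral_mono)
      fix \<omega> assume \<omega>: "\<omega> \<in> space M"
      show "(\<integral>\<^sup>+z. ennreal (h (T \<omega> + D \<omega> z)) \<partial>P) \<le> ennreal (h (T \<omega>)) + ennreal C * V \<omega>"
        by (rule order_trans [OF nn_integral_pnorm_sq_add_le [OF P.prob_space_axioms e q D0 [OF \<omega>], folded C_def]])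
          (intro add_left_mono mult_left_mono V \<omega>, simp)
    qed
    also have "\<dots> = (\<integral>\<^sup>+\<omega>. ennreal (h (T \<omega>)) \<partial>M) + ennreal C * (\<integral>\<^sup>+\<omega>. V \<omega> \<partial>M)"
      using h_compose [OF past_subset [OF T upto_subset]] Vm
      by (simp add: nn_integral_add nn_integral_cmult)
    also have "\<dots> \<le> ((\<integral>\<^sup>+\<omega>. ennreal (h (S \<omega>)) \<partial>M) + of_nat i * (ennreal C * (\<integral>\<^sup>+\<omega>. V \<omega> \<partial>M)))
        + ennreal C * (\<integral>\<^sup>+\<omega>. V \<omega> \<partial>M)"
      using IH by (rule add_right_mono)
    also have "\<dots> = (\<integral>\<^sup>+\<omega>. ennreal (h (S \<omega>)) \<partial>M) + of_nat (Suc i) * (ennreal C * (\<integral>\<^sup>+\<omega>. V \<omega> \<partial>M))"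
      by (simp add: distrib_right add_ac)
    finally show ?thesis .
  qed
  ultimately show ?case by (simp only: TS)
qed

text \<open>Averaging scales each second moment by 1/b^2 and b samples contribute, which leaves the
  gain 1/b of a batch.\<close>

lemma batch_average_potential:
  fixes D :: "'w \<Rightarrow> 'z \<Rightarrow> real ^ 'n"
  assumes k: "k \<in> {1..K}" and b: "b = batch_size q\<^sub>0 m\<^sub>1 m k"
    and S: "S \<in> borel_measurable (past (upto k 0))"
    and D: "(\<lambda>(\<omega>, z). D \<omega> z) \<in> borel_measurable (past (upto k 0) \<Otimes>\<^sub>M P)"
    and D0: "\<And>\<omega>. \<omega> \<in> space M \<Longrightarrow> has_bochner_integral P (D \<omega>) 0"
    and V: "\<And>\<omega>. \<omega> \<in> space M \<Longrightarrow> (\<integral>\<^sup>+z. ennreal ((infnorm (D \<omega> z))\<^sup>2) \<partial>P) \<le> V \<omega>"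
    and Vm: "V \<in> borel_measurable M"
  shows "(\<integral>\<^sup>+\<omega>. ennreal (h (S \<omega> + (1 / real b) *\<^sub>R (\<Sum>j=1..b. D \<omega> (\<zeta> k j \<omega>)))) \<partial>M)
      \<le> (\<integral>\<^sup>+\<omega>. ennreal (h (S \<omega>)) \<partial>M) + ennreal (C / real b) * (\<integral>\<^sup>+\<omega>. V \<omega> \<partial>M)"
proof -
  have b1: "b \<ge> 1" using params by (simp add: b batch_size_def)
  let ?D = "\<lambda>\<omega> z. (1 / real b) *\<^sub>R D \<omega> z"
  let ?V = "\<lambda>\<omega>. ennreal ((1 / real b)\<^sup>2) * V \<omega>"
  have Dz: "D \<omega> \<in> borel_measurable P" if "\<omega> \<in> space M" for \<omega>
    using D0 [OF that] by (auto simp: has_bochner_integral_iff)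
  have "(\<integral>\<^sup>+\<omega>. ennreal (h (S \<omega> + (\<Sum>j=1..b. ?D \<omega> (\<zeta> k j \<omega>)))) \<partial>M)
      \<le> (\<integral>\<^sup>+\<omega>. ennreal (h (S \<omega>)) \<partial>M) + of_nat b * (ennreal C * (\<integral>\<^sup>+\<omega>. ?V \<omega> \<partial>M))"
  proof (rule batch_potential [OF k _ S, THEN conjunct2])
    show "(\<lambda>(\<omega>, z). ?D \<omega> z) \<in> borel_measurable (past (upto k 0) \<Otimes>\<^sub>M P)"
      using borel_measurable_scaleR [OF borel_measurable_const D] by (simp add: case_prod_beta')
    show "has_bochner_integral P (?D \<omega>) 0" if "\<omega> \<in> space M" for \<omega>
      using has_bochner_integral_scaleR_right [OF D0 [OF that]] by simp
    show "(\<integral>\<^sup>+z. ennreal ((infnorm (?D \<omega> z))\<^sup>2) \<partial>P) \<le> ?V \<omega>" if "\<omega> \<in> space M" for \<omega>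
    proof -
      have "(\<integral>\<^sup>+z. ennreal ((infnorm (?D \<omega> z))\<^sup>2) \<partial>P)
          = (\<integral>\<^sup>+z. ennreal ((1 / real b)\<^sup>2) * ennreal ((infnorm (D \<omega> z))\<^sup>2) \<partial>P)"
        by (simp only: infnorm_mul power_mult_distrib power2_abs) (simp add: ennreal_mult)
      also have "\<dots> = ennreal ((1 / real b)\<^sup>2) * (\<integral>\<^sup>+z. ennreal ((infnorm (D \<omega> z))\<^sup>2) \<partial>P)"
        using Dz [OF that] by (intro nn_integral_cmult) measurable
      also have "\<dots> \<le> ?V \<omega>" using V [OF that] by (rule mult_left_mono) simp
      finally show ?thesis .
    qed
    show "?V \<in> borel_measurable M" using Vm by measurable
  qed (simp add: b)
  also have "of_nat b * (ennreal C * (\<integral>\<^sup>+\<omega>. ?V \<omega> \<partial>M)) = ennreal (C / real b) * (\<integral>\<^sup>+\<omega>. V \<omega> \<partial>M)"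
  proof -
    have "of_nat b * (ennreal C * (\<integral>\<^sup>+\<omega>. ?V \<omega> \<partial>M))
        = (ennreal (real b) * (ennreal C * ennreal ((1 / real b)\<^sup>2))) * (\<integral>\<^sup>+\<omega>. V \<omega> \<partial>M)"
      using Vm by (simp add: nn_integral_cmult ennreal_of_nat_eq_real_of_nat mult.assoc)
    also have "ennreal (real b) * (ennreal C * ennreal ((1 / real b)\<^sup>2)) = ennreal (real b * (C * (1 / real b)\<^sup>2))"
      using C_nonneg by (simp only: ennreal_mult [symmetric] zero_le_power2 mult_nonneg_nonneg of_nat_0_le_iff)
    also have "real b * (C * (1 / real b)\<^sup>2) = C / real b"
      using b1 by (simp add: power2_eq_square)
    finally show ?thesis .
  qed
  finally show ?thesis by (simp add: scaleR_sum_right)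
qed

text \<open>At a restart the error is a plain average of centred gradients, so the potential starts
  from its value at 0, which is positive because of the shift \<open>e\<close>.\<close>

lemma err_potential_restart:
  assumes k: "k \<in> {1..K}" and r: "restart q\<^sub>0 k"
  shows "(\<integral>\<^sup>+\<omega>. ennreal (h (err k \<omega>)) \<partial>M) \<le> ennreal (h 0) + ennreal (C / real m\<^sub>1) * ennreal \<sigma>2"
proof -
  have b: "m\<^sub>1 = batch_size q\<^sub>0 m\<^sub>1 m k" using r by (simp add: batch_size_def)
  let ?D = "\<lambda>\<omega> z. gF (x k \<omega>) z - gf (x k \<omega>)"
  have xk: "x k \<omega> \<in> X" if "\<omega> \<in> space M" for \<omega> using x_in_X that k by auto
  have xm: "x k \<in> borel_measurable (past (upto k 0))"
    using k by (intro x_measurable upto_subset) auto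
  have "err k \<omega> = 0 + (1 / real m\<^sub>1) *\<^sub>R (\<Sum>j=1..m\<^sub>1. ?D \<omega> (\<zeta> k j \<omega>))" if "\<omega> \<in> space M" for \<omega>
    using estimate [OF k that] r params
    by (simp add: vr_estimate_def Let_def err_def b [symmetric] sum_subtractf scaleR_diff_right
        scaleR_sum_left [symmetric] del: sum_constant)
       (simp add: sum_constant_scaleR del: sum_constant)
  then have "(\<integral>\<^sup>+\<omega>. ennreal (h (err k \<omega>)) \<partial>M)
      = (\<integral>\<^sup>+\<omega>. ennreal (h (0 + (1 / real m\<^sub>1) *\<^sub>R (\<Sum>j=1..m\<^sub>1. ?D \<omega> (\<zeta> k j \<omega>)))) \<partial>M)"
    by (intro nn_integral_cong) simp
  also have "\<dots> \<le> (\<integral>\<^sup>+\<omega>. ennreal (h 0) \<partial>M) + ennreal (C / real m\<^sub>1) * (\<integral>\<^sup>+\<omega>. ennreal \<sigma>2 \<partial>M)"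
  proof (rule batch_average_potential [OF k b])
    show "(\<lambda>(\<omega>, z). ?D \<omega> z) \<in> borel_measurable (past (upto k 0) \<Otimes>\<^sub>M P)"
      unfolding case_prod_beta'
      by (intro borel_measurable_diff gF_compose measurable_compose [OF measurable_fst xm] measurable_snd
          measurable_compose [OF measurable_fst measurable_compose [OF xm gf_measurable]])
    show "has_bochner_integral P (?D \<omega>) 0" if "\<omega> \<in> space M" for \<omega>
      using has_bochner_integral_diff [OF unbiased [OF xk [OF that]]
          has_bochner_integral_integrable [OF P.integrable_const, of "gf (x k \<omega>)"]]
      by (simp add: P.prob_space)
    show "(\<integral>\<^sup>+z. ennreal ((infnorm (?D \<omega> z))\<^sup>2) \<partial>P) \<le> ennreal \<sigma>2" if "\<omega> \<in> space M" for \<omega>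
      by (rule variance(1) [OF xk [OF that]])
  qed auto
  finally show ?thesis by (simp add: emeasure_space_1)
qed

lemma err_potential_continue:
  assumes k: "k \<in> {1..K}" and r: "\<not> restart q\<^sub>0 k"
  shows "(\<integral>\<^sup>+\<omega>. ennreal (h (err k \<omega>)) \<partial>M) \<le> (\<integral>\<^sup>+\<omega>. ennreal (h (err (k - 1) \<omega>)) \<partial>M)
    + ennreal (C / real m) * (\<integral>\<^sup>+\<omega>. ennreal (4 * L\<^sup>2 * (l1norm (step (k - 1) \<omega>))\<^sup>2) \<partial>M)"
proof -
  have k1: "k > 1" using k r not_restart_gt_1 by auto
  have b: "m = batch_size q\<^sub>0 m\<^sub>1 m k" using r by (simp add: batch_size_def)
  let ?E = "\<lambda>\<omega> z. gF (x k \<omega>) z - gF (x (k - 1) \<omega>) z"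
  let ?c = "\<lambda>\<omega>. gf (x k \<omega>) - gf (x (k - 1) \<omega>)"
  let ?D = "\<lambda>\<omega> z. ?E \<omega> z - ?c \<omega>"
  have xX: "x k \<omega> \<in> X" "x (k - 1) \<omega> \<in> X" if "\<omega> \<in> space M" for \<omega>
  proof -
    have "k \<in> {1..K + 1}" "k - 1 \<in> {1..K + 1}" using k k1 by auto
    then show "x k \<omega> \<in> X" "x (k - 1) \<omega> \<in> X" using x_in_X [OF that] by blast+
  qed
  have xm: "x k \<in> borel_measurable (past (upto k 0))" "x (k - 1) \<in> borel_measurable (past (upto k 0))"
    using k k1 upto_mono [of "k - 1" k 0 0] by (auto intro!: x_measurable upto_subset)
  have E: "has_bochner_integral P (?E \<omega>) (?c \<omega>)" if "\<omega> \<in> space M" for \<omega>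
    using unbiased xX [OF that] by (intro has_bochner_integral_diff)
  have "err k \<omega> = err (k - 1) \<omega> + (1 / real m) *\<^sub>R (\<Sum>j=1..m. ?D \<omega> (\<zeta> k j \<omega>))" if "\<omega> \<in> space M" for \<omega>
    using estimate [OF k that] r params
    by (simp add: vr_estimate_def Let_def err_def b [symmetric] sum_subtractf scaleR_diff_right
        del: sum_constant)
       (simp add: sum_constant_scaleR del: sum_constant)
  then have "(\<integral>\<^sup>+\<omega>. ennreal (h (err k \<omega>)) \<partial>M)
      = (\<integral>\<^sup>+\<omega>. ennreal (h (err (k - 1) \<omega> + (1 / real m) *\<^sub>R (\<Sum>j=1..m. ?D \<omega> (\<zeta> k j \<omega>)))) \<partial>M)"
    by (intro nn_integral_cong) simp
  also have "\<dots> \<le> (\<integral>\<^sup>+\<omega>. ennreal (h (err (k - 1) \<omega>)) \<partial>M)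
      + ennreal (C / real m) * (\<integral>\<^sup>+\<omega>. ennreal (4 * L\<^sup>2 * (l1norm (step (k - 1) \<omega>))\<^sup>2) \<partial>M)"
  proof (rule batch_average_potential [OF k b])
    show "err (k - 1) \<in> borel_measurable (past (upto k 0))"
      using k k1 by (intro err_measurable upto_subset) auto
    show "(\<lambda>(\<omega>, z). ?D \<omega> z) \<in> borel_measurable (past (upto k 0) \<Otimes>\<^sub>M P)"
      unfolding case_prod_beta'
      by (intro borel_measurable_diff gF_compose measurable_compose [OF measurable_fst] xm measurable_snd
          measurable_compose [OF _ gf_measurable])
    show "has_bochner_integral P (?D \<omega>) 0" if "\<omega> \<in> space M" for \<omega>
      using has_bochner_integral_diff [OF E [OF that]
          has_bochner_integral_integrable [OF P.integrable_const, of "?c \<omega>"]]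
      by (simp add: P.prob_space)
    show "(\<integral>\<^sup>+z. ennreal ((infnorm (?D \<omega> z))\<^sup>2) \<partial>P) \<le> ennreal (4 * L\<^sup>2 * (l1norm (step (k - 1) \<omega>))\<^sup>2)"
      if "\<omega> \<in> space M" for \<omega>
    proof -
      have "(\<integral>\<^sup>+z. ennreal ((infnorm (?D \<omega> z))\<^sup>2) \<partial>P) \<le> 4 * (\<integral>\<^sup>+z. ennreal ((infnorm (?E \<omega> z))\<^sup>2) \<partial>P)"
        by (rule P.nn_integral_infnorm_centered_sq_le [OF E [OF that]])
      also have "\<dots> \<le> 4 * ennreal (L\<^sup>2 * (l1norm (x k \<omega> - x (k - 1) \<omega>))\<^sup>2)"
        by (intro mult_left_mono smooth xX that) simp
      finally show ?thesis using k1 by (simp add: step_def ennreal_mult mult.assoc)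
    qed
    have "step (k - 1) \<in> borel_measurable M" using k k1 by (intro step_borel) auto
    then show "(\<lambda>\<omega>. ennreal (4 * L\<^sup>2 * (l1norm (step (k - 1) \<omega>))\<^sup>2)) \<in> borel_measurable M"
      by measurable
  qed
  finally show ?thesis .
qed

end

text \<open>The iterations from the last restart up to \<open>k - 1\<close>.\<close>

definition window :: "nat \<Rightarrow> nat set" where
  "window k = {k - (k - 1) mod q\<^sub>0..<k}"

section \<open>Windows between restarts and their overlap\<close>

lemma restart_iff: "k \<ge> 1 \<Longrightarrow> restart q\<^sub>0 k \<longleftrightarrow> (k - 1) mod q\<^sub>0 = 0"
  unfolding restart_def using mod_eq_dvd_iff_nat [of 1 k q\<^sub>0] by (simp add: mod_eq_0_iff_dvd)

lemma window_restart: "k \<ge> 1 \<Longrightarrow> restart q\<^sub>0 k \<Longrightarrow> window k = {}"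
  by (simp add: window_def restart_iff)

lemma window_continue:
  assumes "k \<ge> 1" "\<not> restart q\<^sub>0 k"
  shows "window k = insert (k - 1) (window (k - 1))"
proof -
  have k: "k > 1" using assms not_restart_gt_1 by auto
  define j where "j = k - 2"
  have kj: "k = Suc (Suc j)" using k by (simp add: j_def)
  \<comment> \<open>Without a restart the residue does not wrap around.\<close>
  have "Suc j mod q\<^sub>0 = Suc (j mod q\<^sub>0)"
    using assms by (simp add: restart_iff kj mod_Suc split: if_splits)
  moreover have "j mod q\<^sub>0 \<le> j" by (rule mod_less_eq_dividend)
  ultimately show ?thesis by (auto simp: window_def kj)
qed

lemma window_subset:
  assumes "k \<ge> 1" "j \<in> window k" shows "1 \<le> j" "j < k" "k < j + q\<^sub>0"
proof -
  have "(k - 1) mod q\<^sub>0 < q\<^sub>0" using params by simp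
  moreover have "(k - 1) mod q\<^sub>0 \<le> k - 1" by (rule mod_less_eq_dividend)
  ultimately show "1 \<le> j" "j < k" "k < j + q\<^sub>0"
    using assms unfolding window_def atLeastLessThan_iff by linarith+
qed

text \<open>After exchanging the sums, \<open>j\<close> lies in \<open>window k\<close> only for
  \<open>k\<close> strictly between \<open>j\<close> and \<open>j + q\<^sub>0\<close>. This is the
  source of \<open>q\<^sub>0\<close> in the final bound.\<close>

lemma sum_window_le:
  fixes n :: "nat \<Rightarrow> real"
  assumes n: "\<And>j. 0 \<le> n j"
  shows "(\<Sum>k=1..K. \<Sum>j\<in>window k. n j) \<le> real q\<^sub>0 * (\<Sum>j=1..K. n j)"
proof -
  have "(\<Sum>k=1..K. \<Sum>j\<in>window k. n j) = (\<Sum>k=1..K. \<Sum>j=1..K. if j \<in> window k then n j else 0)"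
  proof (rule sum.cong [OF refl])
    fix k assume "k \<in> {1..K}"
    then have "window k \<subseteq> {1..K}" using window_subset(1,2) [of k] by force
    then show "(\<Sum>j\<in>window k. n j) = (\<Sum>j=1..K. if j \<in> window k then n j else 0)"
      by (simp add: sum.If_cases Int_absorb1)
  qed
  also have "\<dots> = (\<Sum>j=1..K. \<Sum>k=1..K. if j \<in> window k then n j else 0)"
    by (rule sum.swap)
  also have "\<dots> \<le> (\<Sum>j=1..K. real q\<^sub>0 * n j)"
  proof (rule sum_mono)
    fix j
    have "{k \<in> {1..K}. j \<in> window k} \<subseteq> {j<..<j + q\<^sub>0}" using window_subset by auto
    then have "card {k \<in> {1..K}. j \<in> window k} \<le> card {j<..<j + q\<^sub>0}" by (intro card_mono) auto
    also have "\<dots> \<le> q\<^sub>0" by simp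
    finally have "real (card {k \<in> {1..K}. j \<in> window k}) * n j \<le> real q\<^sub>0 * n j"
      using n by (intro mult_right_mono) auto
    then show "(\<Sum>k=1..K. if j \<in> window k then n j else 0) \<le> real q\<^sub>0 * n j"
      by (simp add: sum.If_cases Int_def)
  qed
  finally show ?thesis by (simp add: sum_distrib_left)
qed

text \<open>Extended valued, because finiteness of the second moments is established only by the
  induction inside \<open>average_bounds\<close>.\<close>

definition step_sq :: "nat \<Rightarrow> ennreal" where
  "step_sq k = (\<integral>\<^sup>+\<omega>. ennreal ((l1norm (step k \<omega>))\<^sup>2) \<partial>M)"

definition err_sq :: "nat \<Rightarrow> ennreal" where
  "err_sq k = (\<integral>\<^sup>+\<omega>. ennreal ((infnorm (err k \<omega>))\<^sup>2) \<partial>M)"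

text \<open>Increments accumulate inside a window and a restart discards all that precedes it, so
  the value at 0 and the variance term enter once, independently of the number of
  iterations.\<close>

lemma err_potential_window:
  assumes q: "q \<ge> 1" and e: "e > 0"
    and C: "C = (2 * real q - 1) * real CARD('n) powr (1 / real q)" and k: "k \<in> {1..K}"
  shows "(\<integral>\<^sup>+\<omega>. ennreal (pnorm_sq q e (err k \<omega>)) \<partial>M) \<le> ennreal (pnorm_sq q e (0 :: real ^ 'n))
    + ennreal (C / real m\<^sub>1) * ennreal \<sigma>2 + ennreal (4 * C * L\<^sup>2 / real m) * (\<Sum>j\<in>window k. step_sq j)"
  using k
proof (induction k)
  case (Suc k)
  show ?case
  proof (cases "restart q\<^sub>0 (Suc k)")
    case True
    then show ?thesis
      using err_potential_restart [OF q e C Suc.prems True] by (simp add: window_restart)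
  next
    case False
    have k1: "k \<in> {1..K}" using not_restart_gt_1 [OF False] Suc.prems by auto
    have C0: "C \<ge> 0" by (rule C_nonneg [OF q e C])
    have [measurable]: "step k \<in> borel_measurable M" using k1 by (rule step_borel)
    have "(\<integral>\<^sup>+\<omega>. ennreal (4 * L\<^sup>2 * (l1norm (step k \<omega>))\<^sup>2) \<partial>M)
        = (\<integral>\<^sup>+\<omega>. ennreal (4 * L\<^sup>2) * ennreal ((l1norm (step k \<omega>))\<^sup>2) \<partial>M)"
      by (simp add: ennreal_mult)
    also have "\<dots> = ennreal (4 * L\<^sup>2) * step_sq k"
      unfolding step_sq_def by (rule nn_integral_cmult) measurable
    finally have "ennreal (C / real m) * (\<integral>\<^sup>+\<omega>. ennreal (4 * L\<^sup>2 * (l1norm (step k \<omega>))\<^sup>2) \<partial>M)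
        = (ennreal (C / real m) * ennreal (4 * L\<^sup>2)) * step_sq k" by (simp only: mult.assoc)
    also have "ennreal (C / real m) * ennreal (4 * L\<^sup>2) = ennreal (4 * C * L\<^sup>2 / real m)"
      using C0 by (subst ennreal_mult [symmetric]) (auto simp: field_simps)
    finally have s: "ennreal (C / real m) * (\<integral>\<^sup>+\<omega>. ennreal (4 * L\<^sup>2 * (l1norm (step k \<omega>))\<^sup>2) \<partial>M)
        = ennreal (4 * C * L\<^sup>2 / real m) * step_sq k" .
    have "(\<integral>\<^sup>+\<omega>. ennreal (pnorm_sq q e (err (Suc k) \<omega>)) \<partial>M)
        \<le> (\<integral>\<^sup>+\<omega>. ennreal (pnorm_sq q e (err k \<omega>)) \<partial>M) + ennreal (4 * C * L\<^sup>2 / real m) * step_sq k"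
      using err_potential_continue [OF q e C Suc.prems False] by (simp add: s)
    also have "\<dots> \<le> (ennreal (pnorm_sq q e (0 :: real ^ 'n)) + ennreal (C / real m\<^sub>1) * ennreal \<sigma>2
        + ennreal (4 * C * L\<^sup>2 / real m) * (\<Sum>j\<in>window k. step_sq j)) + ennreal (4 * C * L\<^sup>2 / real m) * step_sq k"
      using Suc.IH [OF k1] by (rule add_right_mono)
    also have "\<dots> = ennreal (pnorm_sq q e (0 :: real ^ 'n)) + ennreal (C / real m\<^sub>1) * ennreal \<sigma>2
        + ennreal (4 * C * L\<^sup>2 / real m) * (\<Sum>j\<in>window (Suc k). step_sq j)"
    proof -
      have "finite (window k)" "k \<notin> window k" by (auto simp: window_def)
      then have "(\<Sum>j\<in>window (Suc k). step_sq j) = step_sq k + (\<Sum>j\<in>window k. step_sq j)"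
        using window_continue [of "Suc k"] False by simp
      then show ?thesis by (simp add: distrib_left add_ac)
    qed
    finally show ?thesis .
  qed
qed simp

text \<open>The potential dominates the squared sup norm. Its shift contributes
  \<open>\<delta>\<close> in total, which is arbitrarily small, while the constant \<open>C\<close>
  does not depend on the shift.\<close>

lemma err_sq_le:
  assumes d: "CARD('n) \<ge> 2" and k: "k \<in> {1..K}" and \<Omega>: "\<Omega> = (exp 1)\<^sup>2 * ln (real CARD('n))"
  shows "err_sq k \<le> ennreal (\<Omega>\<^sup>2 * \<sigma>2 / real m\<^sub>1)
    + ennreal (4 * \<Omega>\<^sup>2 * L\<^sup>2 / real m) * (\<Sum>j\<in>window k. step_sq j)"
proof (rule ennreal_le_epsilon)
  fix \<delta> :: real assume \<delta>: "\<delta> > 0"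
  define q where "q = nat \<lceil>ln (real CARD('n))\<rceil>"
  define C where "C = (2 * real q - 1) * real CARD('n) powr (1 / real q)"
  have q: "q \<ge> 1" and C: "C \<le> \<Omega>\<^sup>2"
    using pnorm_constant_bound [OF _ q_def] d by (auto simp: C_def \<Omega>)
  \<comment> \<open>Chosen so that the potential at 0, \<open>e powr (1 / real q)\<close>, equals
    \<open>\<delta>\<close>.\<close>
  define e where "e = \<delta> ^ q"
  have e: "e > 0" using \<delta> by (simp add: e_def)
  have h0: "pnorm_sq q e (0 :: real ^ 'n) = \<delta>"
    using q \<delta> by (simp add: pnorm_sq_zero e_def powr_realpow [symmetric] powr_powr)
  have C0: "C \<ge> 0" by (rule C_nonneg [OF q e C_def])
  have "err_sq k \<le> (\<integral>\<^sup>+\<omega>. ennreal (pnorm_sq q e (err k \<omega>)) \<partial>M)"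
    unfolding err_sq_def by (intro nn_integral_mono ennreal_leI infnorm_sq_le_pnorm_sq e q)
  also have "\<dots> \<le> ennreal \<delta> + ennreal (C / real m\<^sub>1) * ennreal \<sigma>2
      + ennreal (4 * C * L\<^sup>2 / real m) * (\<Sum>j\<in>window k. step_sq j)"
    using err_potential_window [OF q e C_def k] by (simp only: h0)
  also have "\<dots> \<le> ennreal \<delta> + ennreal (\<Omega>\<^sup>2 * \<sigma>2 / real m\<^sub>1)
      + ennreal (4 * \<Omega>\<^sup>2 * L\<^sup>2 / real m) * (\<Sum>j\<in>window k. step_sq j)"
  proof (intro add_mono order_refl mult_right_mono)
    have "ennreal (C / real m\<^sub>1) * ennreal \<sigma>2 = ennreal (C * \<sigma>2 / real m\<^sub>1)"
      using C0 variance(2) by (subst ennreal_mult [symmetric]) auto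
    also have "\<dots> \<le> ennreal (\<Omega>\<^sup>2 * \<sigma>2 / real m\<^sub>1)"
      using C variance(2) by (intro ennreal_leI divide_right_mono mult_right_mono) auto
    finally show "ennreal (C / real m\<^sub>1) * ennreal \<sigma>2 \<le> ennreal (\<Omega>\<^sup>2 * \<sigma>2 / real m\<^sub>1)" .
    show "ennreal (4 * C * L\<^sup>2 / real m) \<le> ennreal (4 * \<Omega>\<^sup>2 * L\<^sup>2 / real m)"
      using C by (intro ennreal_leI divide_right_mono mult_right_mono mult_left_mono) auto
  qed simp
  finally show "err_sq k \<le> ennreal (\<Omega>\<^sup>2 * \<sigma>2 / real m\<^sub>1)
    + ennreal (4 * \<Omega>\<^sup>2 * L\<^sup>2 / real m) * (\<Sum>j\<in>window k. step_sq j) + ennreal \<delta>"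
    by (simp add: add_ac)
qed

subsection \<open>Descent\<close>

text \<open>The proximal step offers \<open>\<rho> / (2 * \<eta>)\<close>. Half of it pays, by
  Young's inequality, for the pairing of error and step, with \<open>\<eta> / \<rho> = t / 2\<close>
  in front of the squared error; the other half remains.\<close>

lemma descent_step:
  assumes k: "k \<in> {1..K}" and \<omega>: "\<omega> \<in> space M"
  shows "(\<rho> / (4 * \<eta>) - L / 2) * (l1norm (step k \<omega>))\<^sup>2
    \<le> f (x k \<omega>) - f (x (k + 1) \<omega>) + \<eta> / \<rho> * (infnorm (err k \<omega>))\<^sup>2"
proof -
  let ?l = "l1norm (step k \<omega>)" and ?e = "infnorm (err k \<omega>)"
  have xX: "x k \<omega> \<in> X" "x (k + 1) \<omega> \<in> X" using x_in_X [OF \<omega>] k by auto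
  have "f (x (k + 1) \<omega>) \<le> f (x k \<omega>) + gf (x k \<omega>) \<bullet> step k \<omega> + L / 2 * ?l\<^sup>2"
    using descent_lemma_l1 [OF X(2) gf gf_lipschitz xX] by (simp add: step_def)
  moreover have "G k \<omega> \<bullet> step k \<omega> \<le> - (\<rho> / (2 * \<eta>)) * ?l\<^sup>2"
    using l1_prox_descent [OF X(2) _ update [OF k \<omega>] xX(1)] params by (simp add: step_def)
  moreover have "gf (x k \<omega>) \<bullet> step k \<omega> = G k \<omega> \<bullet> step k \<omega> + (- err k \<omega>) \<bullet> step k \<omega>"
    by (simp add: err_def inner_diff_left)
  moreover have "(- err k \<omega>) \<bullet> step k \<omega> \<le> ?e * ?l"
    using inner_le_infnorm_l1norm [of "- err k \<omega>"] by (simp only: infnorm_neg)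
  moreover have "?e * ?l \<le> \<eta> / \<rho> * ?e\<^sup>2 + \<rho> / (4 * \<eta>) * ?l\<^sup>2"
  proof -
    \<comment> \<open>The weights are those for which the step term comes out as exactly
      \<open>\<rho> / (4 * \<eta>)\<close>.\<close>
    have "0 \<le> \<eta> / \<rho> * (?e - \<rho> / (2 * \<eta>) * ?l)\<^sup>2" using params by simp
    also have "\<dots> = \<eta> / \<rho> * ?e\<^sup>2 + \<rho> / (4 * \<eta>) * ?l\<^sup>2 - ?e * ?l"
      using params by (simp add: power2_eq_square field_simps)
    finally show ?thesis by simp
  qed
  moreover have "\<rho> / (2 * \<eta>) * ?l\<^sup>2 = \<rho> / (4 * \<eta>) * ?l\<^sup>2 + \<rho> / (4 * \<eta>) * ?l\<^sup>2"
    by (simp flip: distrib_right)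
  ultimately show ?thesis by (simp add: left_diff_distrib)
qed

text \<open>The descent estimate telescopes along each path before integration, so \<open>f\<close>
  is integrated at the starting point alone. Partial sums up to \<open>j\<close> are kept for the
  finiteness induction.\<close>

lemma sum_step_sq_le:
  assumes c: "\<rho> / (4 * \<eta>) - L / 2 \<ge> 0" and \<Delta>: "\<Delta> = (\<integral>\<omega>. f (x 1 \<omega>) \<partial>M) - f_low" and j: "j \<le> K"
  shows "ennreal (\<rho> / (4 * \<eta>) - L / 2) * (\<Sum>k=1..j. step_sq k)
    \<le> ennreal \<Delta> + ennreal (\<eta> / \<rho>) * (\<Sum>k=1..j. err_sq k)"
proof -
  let ?c = "\<rho> / (4 * \<eta>) - L / 2"
  have kK: "k \<in> {1..K}" if "k \<in> {1..j}" for k using that j by auto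
  have sm: "step k \<in> borel_measurable M" and em: "err k \<in> borel_measurable M" if "k \<in> {1..j}" for k
    using step_borel err_borel kK [OF that] by auto
  have path: "?c * (\<Sum>k=1..j. (l1norm (step k \<omega>))\<^sup>2)
      \<le> (f (x 1 \<omega>) - f_low) + \<eta> / \<rho> * (\<Sum>k=1..j. (infnorm (err k \<omega>))\<^sup>2)" if \<omega>: "\<omega> \<in> space M" for \<omega>
  proof -
    have "?c * (\<Sum>k=1..i. (l1norm (step k \<omega>))\<^sup>2)
      \<le> (f (x 1 \<omega>) - f (x (i + 1) \<omega>)) + \<eta> / \<rho> * (\<Sum>k=1..i. (infnorm (err k \<omega>))\<^sup>2)" if "i \<le> K" for i
      using that
    proof (induction i)
      case (Suc i)
      then show ?case using descent_step [of "Suc i" \<omega>] \<omega> by (simp add: distrib_left)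
    qed simp
    from this [OF j] show ?thesis using lower [OF x_in_X [OF \<omega>, of "j + 1"]] j by simp
  qed
  \<comment> \<open>Nonnegativity keeps \<open>ennreal\<close> from truncating this
    difference.\<close>
  have f0: "0 \<le> f (x 1 \<omega>) - f_low" if "\<omega> \<in> space M" for \<omega>
    using lower [OF start(1) [OF that]] by simp
  have "ennreal ?c * (\<Sum>k=1..j. step_sq k) = (\<integral>\<^sup>+\<omega>. ennreal ?c * (\<Sum>k=1..j. ennreal ((l1norm (step k \<omega>))\<^sup>2)) \<partial>M)"
  proof -
    have m: "(\<lambda>\<omega>. ennreal ((l1norm (step k \<omega>))\<^sup>2)) \<in> borel_measurable M" if "k \<in> {1..j}" for k
      using sm [OF that] by measurable
    have "(\<integral>\<^sup>+\<omega>. (\<Sum>k=1..j. ennreal ((l1norm (step k \<omega>))\<^sup>2)) \<partial>M) = (\<Sum>k=1..j. step_sq k)"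
      unfolding step_sq_def by (rule nn_integral_sum) (rule m)
    then show ?thesis
      using nn_integral_cmult [OF borel_measurable_sum [OF m], of "{1..j}" "\<lambda>k. k" "ennreal ?c"] by (simp only:)
  qed
  also have "\<dots> \<le> (\<integral>\<^sup>+\<omega>. ennreal (f (x 1 \<omega>) - f_low)
      + ennreal (\<eta> / \<rho>) * (\<Sum>k=1..j. ennreal ((infnorm (err k \<omega>))\<^sup>2)) \<partial>M)"
  proof (rule nn_integral_mono)
    fix \<omega> assume \<omega>: "\<omega> \<in> space M"
    have "ennreal ?c * (\<Sum>k=1..j. ennreal ((l1norm (step k \<omega>))\<^sup>2)) = ennreal (?c * (\<Sum>k=1..j. (l1norm (step k \<omega>))\<^sup>2))"
      using c by (simp add: ennreal_mult sum_nonneg flip: sum_ennreal)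
    also have "\<dots> \<le> ennreal ((f (x 1 \<omega>) - f_low) + \<eta> / \<rho> * (\<Sum>k=1..j. (infnorm (err k \<omega>))\<^sup>2))"
      by (intro ennreal_leI path \<omega>)
    also have "\<dots> = ennreal (f (x 1 \<omega>) - f_low) + ennreal (\<eta> / \<rho>) * (\<Sum>k=1..j. ennreal ((infnorm (err k \<omega>))\<^sup>2))"
    proof -
      have nn: "0 \<le> (\<Sum>k=1..j. (infnorm (err k \<omega>))\<^sup>2)" "0 \<le> \<eta> / \<rho>" using params by (auto intro: sum_nonneg)
      have "(\<Sum>k=1..j. ennreal ((infnorm (err k \<omega>))\<^sup>2)) = ennreal (\<Sum>k=1..j. (infnorm (err k \<omega>))\<^sup>2)"
        by (rule sum_ennreal) simp
      then show ?thesis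
        using ennreal_mult [OF nn(2,1)] ennreal_plus [OF f0 [OF \<omega>] mult_nonneg_nonneg [OF nn(2,1)]] by (simp only:)
    qed
    finally show "ennreal ?c * (\<Sum>k=1..j. ennreal ((l1norm (step k \<omega>))\<^sup>2))
        \<le> ennreal (f (x 1 \<omega>) - f_low) + ennreal (\<eta> / \<rho>) * (\<Sum>k=1..j. ennreal ((infnorm (err k \<omega>))\<^sup>2))" .
  qed
  also have "\<dots> = (\<integral>\<^sup>+\<omega>. ennreal (f (x 1 \<omega>) - f_low) \<partial>M) + ennreal (\<eta> / \<rho>) * (\<Sum>k=1..j. err_sq k)"
  proof -
    have fm: "(\<lambda>\<omega>. f (x 1 \<omega>)) \<in> borel_measurable M" using start(2) by auto
    have "(\<integral>\<^sup>+\<omega>. ennreal (\<eta> / \<rho>) * (\<Sum>k=1..j. ennreal ((infnorm (err k \<omega>))\<^sup>2)) \<partial>M)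
        = ennreal (\<eta> / \<rho>) * (\<Sum>k=1..j. err_sq k)"
    proof -
      have m: "(\<lambda>\<omega>. ennreal ((infnorm (err k \<omega>))\<^sup>2)) \<in> borel_measurable M" if "k \<in> {1..j}" for k
        using em [OF that] by measurable
      have "(\<integral>\<^sup>+\<omega>. (\<Sum>k=1..j. ennreal ((infnorm (err k \<omega>))\<^sup>2)) \<partial>M) = (\<Sum>k=1..j. err_sq k)"
        unfolding err_sq_def by (rule nn_integral_sum) (rule m)
      then show ?thesis
        using nn_integral_cmult [OF borel_measurable_sum [OF m], of "{1..j}" "\<lambda>k. k" "ennreal (\<eta> / \<rho>)"] by (simp only:)
    qed
    moreover have "(\<lambda>\<omega>. ennreal (\<eta> / \<rho>) * (\<Sum>k=1..j. ennreal ((infnorm (err k \<omega>))\<^sup>2))) \<in> borel_measurable M"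
      by (intro borel_measurable_times_ennreal borel_measurable_const borel_measurable_sum
          measurable_compose [OF _ measurable_ennreal] borel_measurable_power borel_measurable_infnorm em)
    ultimately show ?thesis using fm by (subst nn_integral_add) auto
  qed
  also have "(\<integral>\<^sup>+\<omega>. ennreal (f (x 1 \<omega>) - f_low) \<partial>M) = ennreal \<Delta>"
    using start(2) f0 by (subst nn_integral_eq_integral) (auto simp: \<Delta> prob_space)
  finally show ?thesis .
qed

text \<open>Summed over the iterations with the overlap count, the error bound feeds a multiple of
  the total \<open>?N\<close> of squared steps back into the descent bound. The step-size condition
  makes its coefficient small enough to be absorbed.\<close>

lemma average_bounds:
  assumes d: "CARD('n) \<ge> 2" and \<Omega>: "\<Omega> = (exp 1)\<^sup>2 * ln (real CARD('n))"
    and \<Delta>: "\<Delta> = (\<integral>\<omega>. f (x 1 \<omega>) \<partial>M) - f_low"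
    and cond: "\<rho> / (4 * \<eta>) - L / 2 - 4 * \<eta> / \<rho> * \<Omega>\<^sup>2 * L\<^sup>2 * real q\<^sub>0 / real m > 0"
    and S: "S = (\<Delta> / real K + \<eta> / \<rho> * \<Omega>\<^sup>2 * \<sigma>2 / real m\<^sub>1)
        / (\<rho> / (4 * \<eta>) - L / 2 - 4 * \<eta> / \<rho> * \<Omega>\<^sup>2 * L\<^sup>2 * real q\<^sub>0 / real m)"
  shows "0 \<le> S" "ennreal (1 / real K) * (\<Sum>k=1..K. step_sq k) \<le> ennreal S"
    "ennreal (1 / real K) * (\<Sum>k=1..K. err_sq k)
      \<le> ennreal (\<Omega>\<^sup>2 * \<sigma>2 / real m\<^sub>1 + 4 * \<Omega>\<^sup>2 * L\<^sup>2 * real q\<^sub>0 / real m * S)"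
proof -
  define c where "c = \<rho> / (4 * \<eta>) - L / 2"
  define A where "A = \<Omega>\<^sup>2 * \<sigma>2 / real m\<^sub>1"
  define B where "B = 4 * \<Omega>\<^sup>2 * L\<^sup>2 / real m"
  define \<tau> where "\<tau> = \<eta> / \<rho>"
  have nn: "A \<ge> 0" "B \<ge> 0" "\<tau> > 0" using variance(2) params by (auto simp: A_def B_def \<tau>_def)
  have B': "4 * \<eta> / \<rho> * \<Omega>\<^sup>2 * L\<^sup>2 * real q\<^sub>0 / real m = \<tau> * B * real q\<^sub>0"
    by (simp add: B_def \<tau>_def)
  have c': "c - \<tau> * B * real q\<^sub>0 > 0" using cond unfolding B' c_def .
  have "0 \<le> \<tau> * B * real q\<^sub>0" using nn by simp
  with c' have c: "c > 0" by linarith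
  have \<Delta>0: "\<Delta> \<ge> 0"
  proof -
    have "f_low \<le> (\<integral>\<omega>. f (x 1 \<omega>) \<partial>M)"
      using start(2) by (intro integral_ge_const AE_I2 lower start(1))
    then show ?thesis by (simp add: \<Delta>)
  qed
  have err: "err_sq k \<le> ennreal A + ennreal B * (\<Sum>j\<in>window k. step_sq j)" if "k \<in> {1..K}" for k
    using err_sq_le [OF d that \<Omega>] by (simp add: A_def B_def)
  have desc: "ennreal c * (\<Sum>k=1..j. step_sq k) \<le> ennreal \<Delta> + ennreal \<tau> * (\<Sum>k=1..j. err_sq k)" if "j \<le> K" for j
    using sum_step_sq_le [OF _ \<Delta> that] c by (simp add: c_def \<tau>_def)
  \<comment> \<open>Absorption says nothing about an infinite total. The error bound at
    \<open>k\<close> involves only steps before \<open>k\<close>, and the descent bound up to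
    \<open>k\<close> only errors up to \<open>k\<close>, so finiteness propagates.\<close>
  have fin: "step_sq k < \<infinity> \<and> err_sq k < \<infinity>" if "k \<in> {1..K}" for k
    using that
  proof (induction k rule: less_induct)
    case (less k)
    have "(\<Sum>j\<in>window k. step_sq j) < \<infinity>"
    proof -
      have "step_sq j < \<infinity>" if "j \<in> window k" for j
        using less.IH [of j] window_subset [of k j] that less.prems by auto
      then show ?thesis by (auto simp: window_def)
    qed
    then have e: "err_sq k < \<infinity>"
      using err [OF less.prems] by (auto simp: ennreal_mult_less_top intro: order_le_less_trans)
    have "(\<Sum>j=1..k. err_sq j) < \<infinity>"
    proof -
      have "err_sq j < \<infinity>" if "j \<in> {1..k}" for j
        using e less.IH [of j] that less.prems by (cases "j = k") auto
      then show ?thesis by auto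
    qed
    then have "ennreal \<Delta> + ennreal \<tau> * (\<Sum>j=1..k. err_sq j) < \<infinity>"
      by (simp add: ennreal_mult_less_top del: sum_ennreal)
    then have "ennreal c * (\<Sum>j=1..k. step_sq j) < \<infinity>"
      using desc [of k] less.prems by (meson atLeastAtMost_iff order_le_less_trans)
    moreover have "s < \<infinity>" if "ennreal c * s < \<infinity>" for s
      using that c by (auto simp: ennreal_mult_less_top)
    ultimately have "(\<Sum>j=1..k. step_sq j) < \<infinity>" by blast
    then show ?case using e less.prems by auto
  qed
  define n where "n = (\<lambda>k. enn2real (step_sq k))"
  define r where "r = (\<lambda>k. enn2real (err_sq k))"
  have n0: "n k \<ge> 0" and r0: "r k \<ge> 0" for k by (simp_all add: n_def r_def)
  have n: "step_sq k = ennreal (n k)" and r: "err_sq k = ennreal (r k)" if "k \<in> {1..K}" for k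
    using fin [OF that] by (auto simp: n_def r_def)
  have sn: "(\<Sum>k=1..K. step_sq k) = ennreal (\<Sum>k=1..K. n k)"
    using n n0 by (simp flip: sum_ennreal)
  have sr: "(\<Sum>k=1..K. err_sq k) = ennreal (\<Sum>k=1..K. r k)"
    using r r0 by (simp flip: sum_ennreal)
  have rk: "r k \<le> A + B * (\<Sum>j\<in>window k. n j)" if k: "k \<in> {1..K}" for k
  proof -
    have "(\<Sum>j\<in>window k. step_sq j) = (\<Sum>j\<in>window k. ennreal (n j))"
      using window_subset [of k] k by (intro sum.cong n) force+
    then have "(\<Sum>j\<in>window k. step_sq j) = ennreal (\<Sum>j\<in>window k. n j)" using n0 by simp
    then have "ennreal (r k) \<le> ennreal A + ennreal B * ennreal (\<Sum>j\<in>window k. n j)"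
      using err [OF k] r [OF k] by simp
    also have "\<dots> = ennreal (A + B * (\<Sum>j\<in>window k. n j))"
      using nn n0 by (simp add: ennreal_plus ennreal_mult sum_nonneg del: ennreal_plus_if sum_ennreal)
    finally show ?thesis using nn n0 by (subst (asm) ennreal_le_iff) (auto intro!: add_nonneg_nonneg mult_nonneg_nonneg sum_nonneg)
  qed
  let ?N = "\<Sum>k=1..K. n k"
  have N0: "?N \<ge> 0" using n0 by (intro sum_nonneg)
  have sum_r: "(\<Sum>k=1..K. r k) \<le> real K * A + B * real q\<^sub>0 * ?N"
  proof -
    have "(\<Sum>k=1..K. r k) \<le> (\<Sum>k=1..K. A + B * (\<Sum>j\<in>window k. n j))" by (intro sum_mono rk)
    also have "\<dots> = real K * A + B * (\<Sum>k=1..K. \<Sum>j\<in>window k. n j)"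
      by (simp add: sum.distrib sum_distrib_left)
    also have "\<dots> \<le> real K * A + B * (real q\<^sub>0 * ?N)"
      using nn by (intro add_left_mono mult_left_mono sum_window_le n0)
    finally show ?thesis by (simp add: mult.assoc)
  qed
  have "ennreal (c * ?N) \<le> ennreal (\<Delta> + \<tau> * (\<Sum>k=1..K. r k))"
    using desc [of K] c nn \<Delta>0 N0 r0 unfolding sn sr
    by (simp add: ennreal_plus ennreal_mult sum_nonneg del: ennreal_plus_if)
  then have "c * ?N \<le> \<Delta> + \<tau> * (\<Sum>k=1..K. r k)"
    using nn \<Delta>0 r0 by (subst (asm) ennreal_le_iff) (auto intro!: add_nonneg_nonneg mult_nonneg_nonneg sum_nonneg)
  also have "\<dots> \<le> \<Delta> + \<tau> * (real K * A + B * real q\<^sub>0 * ?N)"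
    using sum_r nn by (intro add_left_mono mult_left_mono) auto
  \<comment> \<open>The multiple of \<open>?N\<close> moves to the left; \<open>c'\<close> says that
    the remaining coefficient is positive.\<close>
  finally have "(c - \<tau> * B * real q\<^sub>0) * ?N \<le> \<Delta> + real K * (\<tau> * A)"
    by (simp add: algebra_simps)
  then have "(c - \<tau> * B * real q\<^sub>0) * ?N / real K \<le> (\<Delta> + real K * (\<tau> * A)) / real K"
    by (rule divide_right_mono) simp
  then have "?N / real K * (c - \<tau> * B * real q\<^sub>0) \<le> \<Delta> / real K + \<tau> * A"
    using params by (simp add: add_divide_distrib mult.commute)
  moreover have S': "S = (\<Delta> / real K + \<tau> * A) / (c - \<tau> * B * real q\<^sub>0)"
    unfolding S B' by (simp add: A_def \<tau>_def c_def)
  ultimately have NS: "?N / real K \<le> S"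
    using c' by (simp add: pos_le_divide_eq)
  show "0 \<le> S" unfolding S' using c' nn \<Delta>0 params by (intro divide_nonneg_pos add_nonneg_nonneg mult_nonneg_nonneg) auto
  show "ennreal (1 / real K) * (\<Sum>k=1..K. step_sq k) \<le> ennreal S"
    unfolding sn using NS N0 by (simp add: ennreal_leI flip: ennreal_mult)
  have "(\<Sum>k=1..K. r k) / real K \<le> A + B * real q\<^sub>0 * (?N / real K)"
    using divide_right_mono [OF sum_r, of "real K"] params by (simp add: add_divide_distrib)
  also have "\<dots> \<le> A + B * real q\<^sub>0 * S"
    using NS nn by (intro add_left_mono mult_left_mono) auto
  finally have "(\<Sum>k=1..K. r k) / real K \<le> \<Omega>\<^sup>2 * \<sigma>2 / real m\<^sub>1 + 4 * \<Omega>\<^sup>2 * L\<^sup>2 * real q\<^sub>0 / real m * S"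
    by (simp add: A_def B_def)
  then show "ennreal (1 / real K) * (\<Sum>k=1..K. err_sq k)
      \<le> ennreal (\<Omega>\<^sup>2 * \<sigma>2 / real m\<^sub>1 + 4 * \<Omega>\<^sup>2 * L\<^sup>2 * real q\<^sub>0 / real m * S)"
    unfolding sr using r0 by (simp add: ennreal_leI sum_nonneg flip: ennreal_mult)
qed

subsection \<open>Stationarity of the random iterate\<close>

abbreviation (input) "stat u \<equiv> dist_inf_zero (frechet_subdiff (\<lambda>y. ereal (f y) + delta_set X y) u)"

text \<open>The subgradient \<open>v\<close> is split into a gradient increment, the error, the
  optimality residual over \<open>\<eta>\<close> and the step over \<open>\<eta>\<close>. In this
  order they account for \<open>L\<close>, the error norm, \<open>\<rho> / \<eta>\<close> and
  \<open>1 / \<eta>\<close>, the last because the sup norm is at most the l1 norm.\<close>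

lemma stat_le:
  assumes k: "k \<in> {1..K}" and \<omega>: "\<omega> \<in> space M"
  shows "stat (x (k + 1) \<omega>) \<le> ennreal ((L + (\<rho> + 1) / \<eta>) * l1norm (step k \<omega>) + infnorm (err k \<omega>))"
proof -
  let ?l = "l1norm (step k \<omega>)"
  have xX: "x k \<omega> \<in> X" "x (k + 1) \<omega> \<in> X" using x_in_X [OF \<omega>] k by auto
  obtain n where n: "n \<in> normal_cone X (x (k + 1) \<omega>)" "infnorm (step k \<omega> + \<eta> *\<^sub>R G k \<omega> + n) \<le> \<rho> * ?l"
    using l1_prox_normal_vector [OF X(2) _ update [OF k \<omega>]] params by (auto simp: step_def)
  define v where "v = gf (x (k + 1) \<omega>) + (1 / \<eta>) *\<^sub>R n"
  have "(1 / \<eta>) *\<^sub>R n \<in> normal_cone X (x (k + 1) \<omega>)"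
    using n(1) params by (auto simp: normal_cone_def divide_nonpos_pos)
  then have "v \<in> frechet_subdiff (\<lambda>y. ereal (f y) + delta_set X y) (x (k + 1) \<omega>)"
    unfolding frechet_subdiff_plus_delta_set [OF X(2) xX(2) gf] v_def by simp
  then have "stat (x (k + 1) \<omega>) \<le> ennreal (infnorm v)"
    unfolding dist_inf_zero_def by (rule INF_lower)
  also have "infnorm v \<le> (L + (\<rho> + 1) / \<eta>) * ?l + infnorm (err k \<omega>)"
  proof -
    let ?a = "gf (x (k + 1) \<omega>) - gf (x k \<omega>)"
    let ?b = "- err k \<omega>"
    let ?c = "(1 / \<eta>) *\<^sub>R (step k \<omega> + \<eta> *\<^sub>R G k \<omega> + n)"
    let ?d = "(- (1 / \<eta>)) *\<^sub>R step k \<omega>"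
    have "v = ?a + ?b + ?c + ?d"
      using params by (simp add: v_def err_def scaleR_add_right)
    then have "infnorm v \<le> infnorm ?a + infnorm ?b + infnorm ?c + infnorm ?d"
      using infnorm_triangle [of "?a + ?b + ?c" ?d] infnorm_triangle [of "?a + ?b" ?c] infnorm_triangle [of ?a ?b]
      by simp
    moreover have "infnorm ?a \<le> L * ?l" using gf_lipschitz [OF xX(2,1)] by (simp add: step_def)
    moreover have "infnorm ?b = infnorm (err k \<omega>)" by (rule infnorm_neg)
    moreover have "infnorm ?c \<le> \<rho> / \<eta> * ?l"
      using n(2) params by (simp add: infnorm_mul divide_right_mono)
    moreover have "infnorm ?d \<le> 1 / \<eta> * ?l"
      unfolding infnorm_mul using infnorm_le_l1norm [of "step k \<omega>"] params by (simp add: divide_right_mono)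
    ultimately have "infnorm v \<le> L * ?l + infnorm (err k \<omega>) + \<rho> / \<eta> * ?l + 1 / \<eta> * ?l" by linarith
    then show ?thesis by (simp add: distrib_right add_divide_distrib)
  qed
  finally show ?thesis by (simp add: ennreal_leI)
qed

section \<open>Averaging over the random output index\<close>

lemma stat_measurable:
  assumes k: "k \<in> {1..K}"
  shows "(\<lambda>\<omega>. stat (x (k + 1) \<omega>)) \<in> borel_measurable M"
proof -
  have xm: "x (k + 1) \<in> borel_measurable M"
    using k by (intro past_subset [OF x_measurable [OF _ upto_subset order_refl] order_refl]) auto
  have xX: "x (k + 1) \<omega> \<in> X" if "\<omega> \<in> space M" for \<omega> using x_in_X [OF that] k by auto
  have "x (k + 1) \<in> M \<rightarrow>\<^sub>M restrict_space borel X"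
    using xm xX by (intro measurable_restrict_space2) auto
  from measurable_compose [OF this measurable_dist_inf_zero_translated_normal_cone [OF X(1) gf_continuous_on]]
  show ?thesis
    by (rule measurable_cong [THEN iffD1, rotated])
      (simp only: frechet_subdiff_plus_delta_set [OF X(2) xX gf])
qed

text \<open>Every \<open>g k\<close> is a function of the starting point and the samples, from which
  \<open>Y\<close> is independent; splitting by the value of \<open>Y\<close> makes each term
  factor.\<close>

lemma nn_integral_random_index:
  assumes Y: "indep_rv (count_space {1..K}) Y (borel \<Otimes>\<^sub>M Pi\<^sub>M J (\<lambda>_. P)) (\<lambda>\<omega>. (x 1 \<omega>, sample_family J \<zeta> \<omega>))"
    and p: "\<And>k. k \<in> {1..K} \<Longrightarrow> measure M {\<omega> \<in> space M. Y \<omega> = k} = 1 / real K"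
    and g: "\<And>k. k \<in> {1..K} \<Longrightarrow> g k \<in> borel_measurable (past J)"
  shows "(\<integral>\<^sup>+\<omega>. g (Y \<omega>) \<omega> \<partial>M) = ennreal (1 / real K) * (\<Sum>k=1..K. \<integral>\<^sup>+\<omega>. g k \<omega> \<partial>M)"
proof -
  have Ym: "Y \<in> M \<rightarrow>\<^sub>M count_space {1..K}" using Y by (simp add: indep_rv_def)
  have Y_in: "Y \<omega> \<in> {1..K}" if "\<omega> \<in> space M" for \<omega> using measurable_space [OF Ym that] by simp
  have gM: "g k \<in> borel_measurable M" if "k \<in> {1..K}" for k
    using g [OF that] by (rule past_subset) simp
  have ind: "(\<lambda>\<omega>. indicator {k} (Y \<omega>) :: ennreal) \<in> borel_measurable M" for k
    by (rule measurable_compose [OF Ym]) simp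
  have "(\<integral>\<^sup>+\<omega>. g (Y \<omega>) \<omega> \<partial>M) = (\<integral>\<^sup>+\<omega>. (\<Sum>k=1..K. g k \<omega> * indicator {k} (Y \<omega>)) \<partial>M)"
  proof (rule nn_integral_cong)
    fix \<omega> assume "\<omega> \<in> space M"
    have "(\<Sum>k=1..K. g k \<omega> * indicator {k} (Y \<omega>)) = (\<Sum>k=1..K. if k = Y \<omega> then g k \<omega> else 0)"
      by (intro sum.cong) (auto simp: indicator_def)
    then show "g (Y \<omega>) \<omega> = (\<Sum>k=1..K. g k \<omega> * indicator {k} (Y \<omega>))"
      using Y_in [OF \<open>\<omega> \<in> space M\<close>] by simp
  qed
  also have "\<dots> = (\<Sum>k=1..K. \<integral>\<^sup>+\<omega>. g k \<omega> * indicator {k} (Y \<omega>) \<partial>M)"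
    using gM ind by (intro nn_integral_sum borel_measurable_times_ennreal) auto
  also have "\<dots> = (\<Sum>k=1..K. ennreal (1 / real K) * (\<integral>\<^sup>+\<omega>. g k \<omega> \<partial>M))"
  proof (rule sum.cong [OF refl])
    fix k assume k: "k \<in> {1..K}"
    have "(\<lambda>(\<omega>, z). g k \<omega> * indicator {k} z) \<in> borel_measurable (past J \<Otimes>\<^sub>M count_space {1..K})"
      unfolding case_prod_beta'
      by (intro borel_measurable_times_ennreal measurable_compose [OF measurable_fst g [OF k]]
          measurable_compose [OF measurable_snd]) simp
    from nn_integral_indep_rv [OF Y this [unfolded past_def]]
    have "(\<integral>\<^sup>+\<omega>. g k \<omega> * indicator {k} (Y \<omega>) \<partial>M)
        = (\<integral>\<^sup>+\<omega>. \<integral>\<^sup>+z. g k \<omega> * indicator {k} z \<partial>distr M (count_space {1..K}) Y \<partial>M)" .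
    also have "\<dots> = (\<integral>\<^sup>+\<omega>. g k \<omega> * ennreal (1 / real K) \<partial>M)"
    proof (rule nn_integral_cong)
      fix \<omega>
      have "emeasure (distr M (count_space {1..K}) Y) {k} = emeasure M {\<omega> \<in> space M. Y \<omega> = k}"
        using k Ym by (subst emeasure_distr) (auto intro!: arg_cong [where f = "emeasure M"])
      also have "\<dots> = ennreal (1 / real K)"
        using p [OF k] by (simp only: emeasure_eq_measure)
      finally show "(\<integral>\<^sup>+z. g k \<omega> * indicator {k} z \<partial>distr M (count_space {1..K}) Y) = g k \<omega> * ennreal (1 / real K)"
        using k by (subst nn_integral_cmult_indicator) auto
    qed
    also have "\<dots> = ennreal (1 / real K) * (\<integral>\<^sup>+\<omega>. g k \<omega> \<partial>M)"
      using gM [OF k] by (simp add: nn_integral_multc mult.commute)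
    finally show "(\<integral>\<^sup>+\<omega>. g k \<omega> * indicator {k} (Y \<omega>) \<partial>M) = ennreal (1 / real K) * (\<integral>\<^sup>+\<omega>. g k \<omega> \<partial>M)" .
  qed
  finally show ?thesis by (simp add: sum_distrib_left)
qed

text \<open>At the random index, averages over the iterations become second moments of one step and
  one error; Jensen then bounds the first moments that the pathwise estimate asks for.\<close>

theorem stationarity_bound:
  assumes d: "CARD('n) \<ge> 2" and \<Omega>: "\<Omega> = (exp 1)\<^sup>2 * ln (real CARD('n))"
    and \<Delta>: "\<Delta> = (\<integral>\<omega>. f (x 1 \<omega>) \<partial>M) - f_low"
    and cond: "\<rho> / (4 * \<eta>) - L / 2 - 4 * \<eta> / \<rho> * \<Omega>\<^sup>2 * L\<^sup>2 * real q\<^sub>0 / real m > 0"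
    and S: "S = (\<Delta> / real K + \<eta> / \<rho> * \<Omega>\<^sup>2 * \<sigma>2 / real m\<^sub>1)
        / (\<rho> / (4 * \<eta>) - L / 2 - 4 * \<eta> / \<rho> * \<Omega>\<^sup>2 * L\<^sup>2 * real q\<^sub>0 / real m)"
    and Y: "indep_rv (count_space {1..K}) Y (borel \<Otimes>\<^sub>M Pi\<^sub>M J (\<lambda>_. P)) (\<lambda>\<omega>. (x 1 \<omega>, sample_family J \<zeta> \<omega>))"
    and p: "\<And>k. k \<in> {1..K} \<Longrightarrow> measure M {\<omega> \<in> space M. Y \<omega> = k} = 1 / real K"
  shows "(\<lambda>\<omega>. stat (x (Y \<omega> + 1) \<omega>)) \<in> borel_measurable M"
    "(\<integral>\<^sup>+\<omega>. stat (x (Y \<omega> + 1) \<omega>) \<partial>M) \<le> ennreal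
      ((L + (\<rho> + 1) / \<eta> + sqrt (4 * \<Omega>\<^sup>2 * L\<^sup>2 * real q\<^sub>0 / real m)) * sqrt S + sqrt (\<Omega>\<^sup>2 * \<sigma>2 / real m\<^sub>1))"
proof -
  have Ym: "Y \<in> M \<rightarrow>\<^sub>M count_space {1..K}" using Y by (simp add: indep_rv_def)
  have Y_in: "Y \<omega> \<in> {1..K}" if "\<omega> \<in> space M" for \<omega> using measurable_space [OF Ym that] by simp
  show "(\<lambda>\<omega>. stat (x (Y \<omega> + 1) \<omega>)) \<in> borel_measurable M"
    by (rule measurable_compose_countable' [OF stat_measurable Ym]) auto
  have um: "(\<lambda>\<omega>. l1norm (step (Y \<omega>) \<omega>)) \<in> borel_measurable M"
    by (rule measurable_compose_countable' [OF borel_measurable_l1norm [OF step_borel] Ym]) auto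
  have vm: "(\<lambda>\<omega>. infnorm (err (Y \<omega>) \<omega>)) \<in> borel_measurable M"
    by (rule measurable_compose_countable' [OF borel_measurable_infnorm [OF err_borel] Ym]) auto
  note avg = average_bounds [OF d \<Omega> \<Delta> cond S]
  define A where "A = \<Omega>\<^sup>2 * \<sigma>2 / real m\<^sub>1"
  define B where "B = 4 * \<Omega>\<^sup>2 * L\<^sup>2 * real q\<^sub>0 / real m"
  define c where "c = L + (\<rho> + 1) / \<eta>"
  have nn: "A \<ge> 0" "B \<ge> 0" "c \<ge> 0" "S \<ge> 0"
    using variance(2) params L avg(1) by (auto simp: A_def B_def c_def)
  have "(\<integral>\<^sup>+\<omega>. ennreal ((l1norm (step (Y \<omega>) \<omega>))\<^sup>2) \<partial>M) = ennreal (1 / real K) * (\<Sum>k=1..K. step_sq k)"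
    unfolding step_sq_def
  proof (rule nn_integral_random_index [OF Y p])
    fix k assume "k \<in> {1..K}"
    then have [measurable]: "step k \<in> borel_measurable (past J)" by (intro step_measurable upto_subset) auto
    show "(\<lambda>\<omega>. ennreal ((l1norm (step k \<omega>))\<^sup>2)) \<in> borel_measurable (past J)" by measurable
  qed
  with avg(2) have U: "(\<integral>\<^sup>+\<omega>. ennreal (l1norm (step (Y \<omega>) \<omega>)) \<partial>M) \<le> ennreal (sqrt S)"
    using nn by (intro nn_integral_le_sqrt_nn_integral_sq um) auto
  have "(\<integral>\<^sup>+\<omega>. ennreal ((infnorm (err (Y \<omega>) \<omega>))\<^sup>2) \<partial>M) = ennreal (1 / real K) * (\<Sum>k=1..K. err_sq k)"
    unfolding err_sq_def
  proof (rule nn_integral_random_index [OF Y p])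
    fix k assume "k \<in> {1..K}"
    then have [measurable]: "err k \<in> borel_measurable (past J)" by (intro err_measurable upto_subset) auto
    show "(\<lambda>\<omega>. ennreal ((infnorm (err k \<omega>))\<^sup>2)) \<in> borel_measurable (past J)" by measurable
  qed
  with avg(3) have V: "(\<integral>\<^sup>+\<omega>. ennreal (infnorm (err (Y \<omega>) \<omega>)) \<partial>M) \<le> ennreal (sqrt (A + B * S))"
    using nn by (intro nn_integral_le_sqrt_nn_integral_sq vm) (auto simp: A_def B_def infnorm_pos_le)
  have "(\<integral>\<^sup>+\<omega>. stat (x (Y \<omega> + 1) \<omega>) \<partial>M)
      \<le> (\<integral>\<^sup>+\<omega>. ennreal c * ennreal (l1norm (step (Y \<omega>) \<omega>)) + ennreal (infnorm (err (Y \<omega>) \<omega>)) \<partial>M)"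
  proof (rule nn_integral_mono)
    fix \<omega> assume \<omega>: "\<omega> \<in> space M"
    show "stat (x (Y \<omega> + 1) \<omega>) \<le> ennreal c * ennreal (l1norm (step (Y \<omega>) \<omega>)) + ennreal (infnorm (err (Y \<omega>) \<omega>))"
      using stat_le [OF Y_in [OF \<omega>] \<omega>] nn
      by (simp add: c_def [symmetric] ennreal_plus ennreal_mult infnorm_pos_le del: ennreal_plus_if)
  qed
  also have "\<dots> = ennreal c * (\<integral>\<^sup>+\<omega>. ennreal (l1norm (step (Y \<omega>) \<omega>)) \<partial>M) + (\<integral>\<^sup>+\<omega>. ennreal (infnorm (err (Y \<omega>) \<omega>)) \<partial>M)"
    using um vm by (simp add: nn_integral_add nn_integral_cmult)
  also have "\<dots> \<le> ennreal c * ennreal (sqrt S) + ennreal (sqrt (A + B * S))"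
    by (intro add_mono mult_left_mono U V) simp
  also have "\<dots> = ennreal (c * sqrt S + sqrt (A + B * S))"
    using nn by (simp add: ennreal_plus ennreal_mult del: ennreal_plus_if)
  also have "\<dots> \<le> ennreal ((c + sqrt B) * sqrt S + sqrt A)"
  proof (rule ennreal_leI)
    \<comment> \<open>Subadditivity of the square root separates the step part, which joins the
      coefficient of \<open>sqrt S\<close>, from the variance part.\<close>
    have "sqrt (A + B * S) \<le> sqrt A + sqrt (B * S)"
      using nn by (intro sqrt_add_le_add_sqrt) auto
    then show "c * sqrt S + sqrt (A + B * S) \<le> (c + sqrt B) * sqrt S + sqrt A"
      by (simp add: real_sqrt_mult algebra_simps)
  qed
  finally show "(\<integral>\<^sup>+\<omega>. stat (x (Y \<omega> + 1) \<omega>) \<partial>M) \<le> ennreal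
      ((L + (\<rho> + 1) / \<eta> + sqrt (4 * \<Omega>\<^sup>2 * L\<^sup>2 * real q\<^sub>0 / real m)) * sqrt S + sqrt (\<Omega>\<^sup>2 * \<sigma>2 / real m\<^sub>1))"
    by (simp only: A_def B_def c_def)
qed

end

text \<open>Measurability is part of the conclusion so that the nonnegative integral, which is
  defined for every function, is a genuine expectation.\<close>

theorem theorem2:
  fixes X :: "(real ^ 'n) set"
    and P :: "'z measure"
    and F :: "real ^ 'n \<Rightarrow> 'z \<Rightarrow> real"
    and gF :: "real ^ 'n \<Rightarrow> 'z \<Rightarrow> real ^ 'n"
    and f :: "real ^ 'n \<Rightarrow> real"
    and gf :: "real ^ 'n \<Rightarrow> real ^ 'n"
    and M :: "'w measure"
    and x G :: "nat \<Rightarrow> 'w \<Rightarrow> real ^ 'n"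
    and \<zeta> :: "nat \<Rightarrow> nat \<Rightarrow> 'w \<Rightarrow> 'z"
    and Y :: "'w \<Rightarrow> nat"
    and L f_low \<sigma>2 \<rho> \<eta> t \<Omega> \<Delta> d :: real
    and K q\<^sub>0 m\<^sub>1 m :: nat
    and J :: "(nat \<times> nat) set"
  assumes dim: "CARD('n) \<ge> 2" "d = real CARD('n)"
    and X: "X \<noteq> {}" "closed X" "convex X"
    and P: "prob_space P"
    and f: "\<And>u. integrable P (F u)" "\<And>u. f u = (\<integral>z. F u z \<partial>P)"
    and gf: "\<And>u. GDERIV f u :> gf u"
    and gF: "\<And>u z. z \<in> space P \<Longrightarrow> GDERIV (\<lambda>y. F y z) u :> gF u z"
    and unbiased: "\<And>u. u \<in> X \<Longrightarrow> has_bochner_integral P (gF u) (gf u)"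
    and variance: "sigma_inf_sq X P gF gf < \<infinity>" "\<sigma>2 = enn2real (sigma_inf_sq X P gF gf)"
    and smooth: "L \<ge> 0"
      "\<And>u v. u \<in> X \<Longrightarrow> v \<in> X \<Longrightarrow>
        (\<integral>\<^sup>+z. ennreal ((infnorm (gF u z - gF v z))\<^sup>2) \<partial>P) \<le> ennreal (L\<^sup>2 * (l1norm (u - v))\<^sup>2)"
    and lower: "\<And>u. u \<in> X \<Longrightarrow> f_low \<le> f u"
    and params: "K \<ge> 1" "q\<^sub>0 \<ge> 1" "m\<^sub>1 \<ge> 1" "m \<ge> 1" "\<rho> > 0" "\<eta> > 0"
    and M: "prob_space M"
    and J: "J = sample_idx K (batch_size q\<^sub>0 m\<^sub>1 m)"
    and samples: "prob_space.indep_vars M (\<lambda>_. P) (\<lambda>(k, i). \<zeta> k i) J"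
      "\<And>k i. (k, i) \<in> J \<Longrightarrow> distr M P (\<zeta> k i) = P"
    and start: "\<And>\<omega>. \<omega> \<in> space M \<Longrightarrow> x 1 \<omega> \<in> X"
      "integrable M (\<lambda>\<omega>. f (x 1 \<omega>))"
      "prob_space.indep_rv M borel (x 1) (Pi\<^sub>M J (\<lambda>_. P)) (sample_family J \<zeta>)"
    and estimate: "\<And>k \<omega>. k \<in> {1..K} \<Longrightarrow> \<omega> \<in> space M \<Longrightarrow>
        vr_estimate gF q\<^sub>0 m\<^sub>1 m (\<lambda>j. x j \<omega>) (\<lambda>j i. \<zeta> j i \<omega>) (\<lambda>j. G j \<omega>) k"
    and update: "\<And>k \<omega>. k \<in> {1..K} \<Longrightarrow> \<omega> \<in> space M \<Longrightarrow>
        prox_step X (\<lambda>z. \<rho> / 2 * (l1norm z)\<^sup>2) \<eta> (x k \<omega>) (G k \<omega>) (x (k + 1) \<omega>)"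
    and out_index: "prob_space.indep_rv M (count_space {1..K}) Y
        (borel \<Otimes>\<^sub>M Pi\<^sub>M J (\<lambda>_. P)) (\<lambda>\<omega>. (x 1 \<omega>, sample_family J \<zeta> \<omega>))"
      "\<And>k. k \<in> {1..K} \<Longrightarrow> measure M {\<omega> \<in> space M. Y \<omega> = k} = 1 / real K"
    and Delta: "\<Delta> = (\<integral>\<omega>. f (x 1 \<omega>) \<partial>M) - f_low"
    and Omega: "\<Omega> = (exp 1)\<^sup>2 * ln d"
    and t: "t = 2 * \<eta> / \<rho>"
    and cond: "\<rho> / (4 * \<eta>) - L / 2 - 2 * t * \<Omega>\<^sup>2 * L\<^sup>2 * real q\<^sub>0 / real m > 0"
  shows "(\<lambda>\<omega>. dist_inf_zero (frechet_subdiff (\<lambda>y. ereal (f y) + delta_set X y) (x (Y \<omega> + 1) \<omega>)))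
           \<in> borel_measurable M \<and>
         (\<integral>\<^sup>+\<omega>. dist_inf_zero (frechet_subdiff (\<lambda>y. ereal (f y) + delta_set X y) (x (Y \<omega> + 1) \<omega>)) \<partial>M)
         \<le> ennreal
           ((L + (\<rho> + 1) / \<eta> + sqrt (4 * \<Omega>\<^sup>2 * L\<^sup>2 * real q\<^sub>0 / real m)) *
              sqrt ((\<Delta> / real K + t * \<Omega> * (exp 1)\<^sup>2 * ln d * \<sigma>2 / (2 * real m\<^sub>1)) /
                    (\<rho> / (4 * \<eta>) - L / 2 - 2 * t * \<Omega>\<^sup>2 * L\<^sup>2 * real q\<^sub>0 / real m))
            + sqrt (\<Omega> * (exp 1)\<^sup>2 * ln d * \<sigma>2 / real m\<^sub>1))"
proof -
  have \<sigma>2: "\<sigma>2 \<ge> 0" by (simp add: variance(2))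
  have sup: "(\<integral>\<^sup>+z. ennreal ((infnorm (gF u z - gf u))\<^sup>2) \<partial>P) \<le> ennreal \<sigma>2" if "u \<in> X" for u
  proof -
    have "(\<integral>\<^sup>+z. ennreal ((infnorm (gF u z - gf u))\<^sup>2) \<partial>P) \<le> sigma_inf_sq X P gF gf"
      unfolding sigma_inf_sq_def using that by (rule SUP_upper)
    then show ?thesis using variance by simp
  qed
  have Fm: "F u \<in> borel_measurable P" for u using f(1) by (rule borel_measurable_integrable)
  interpret vr_prox_method M P X F gF f gf x G \<zeta> L f_low \<sigma>2 \<rho> \<eta> K q\<^sub>0 m\<^sub>1 m J
    by (intro vr_prox_method.intro vr_prox_method_axioms.intro)
      (fact M P X Fm gf gF unbiased sup \<sigma>2 smooth lower params J samples start estimate update)+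
  have t': "2 * t * \<Omega>\<^sup>2 * L\<^sup>2 * real q\<^sub>0 / real m = 4 * \<eta> / \<rho> * \<Omega>\<^sup>2 * L\<^sup>2 * real q\<^sub>0 / real m"
    by (simp add: t)
  \<comment> \<open>The factor \<open>(exp 1)\<^sup>2 * ln d\<close> is \<open>\<Omega>\<close>
    itself, so the stated variance terms carry its square.\<close>
  have \<Omega>': "\<Omega> * (exp 1)\<^sup>2 * ln d = \<Omega>\<^sup>2" by (simp add: Omega power2_eq_square)
  have A: "t * \<Omega> * (exp 1)\<^sup>2 * ln d * \<sigma>2 / (2 * real m\<^sub>1) = \<eta> / \<rho> * \<Omega>\<^sup>2 * \<sigma>2 / real m\<^sub>1"
    by (simp add: t \<Omega>' [symmetric])
  show ?thesis
    using stationarity_bound [OF dim(1) Omega [unfolded dim(2)] Delta cond [unfolded t'] refl out_index]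
    unfolding t' A \<Omega>' by blast
qed

end
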